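(* Let $M,N,P$ be smooth manifolds with $P$ Riemannian, $p\in P$, $h:M\to P$ smooth, and consider the completely high index SDAE $$\mathbf{d}X_t = \Big[V(X_t,U_t) + \tfrac12 \sum_{l=1}^d {}^MG(\sigma_l(X_t,U_t))\Big]dt + \sum_{l=1}^d \sigma_l(X_t,U_t)\,dW^l_t,\qquad h(X_t)=p .$$ Let $\mathfrak{I}_p$ be the injectivity radius of $p\in P$, $\mathfrak{C}_p\subset P$ the cut-locus of $p$, and $\alpha\in(0,1]$. If there exists $\epsilon>0$ with $\epsilon<\mathfrak{I}_p$, and if there exists a semi-martingale $(X_t,U_t)\in M\times N$ with $h(X_0)=p$ satisfying the SDE $\mathbf{d}X_t = \big[V(X_t,U_t) + \tfrac12 \sum_{l=1}^d {}^MG(\sigma_l(X_t,U_t))\big]dt + \sum_{l=1}^d \sigma_l(X_t,U_t)\,dW^l_t$ and $$\Big(D_{X_t}hV(X_t,U_t)+\tfrac12\sum_{l=1}^d D_{X_t}h\nabla^{{}^MG}_S(\sigma_l)(X_t,U_t)+\tfrac12\sum_{l=1}^d {}^PG_S(D_{X_t}h\sigma_l)(X_t,U_t)\Big)[\Delta_p^2(h(X_t))]=-b\,\Delta_p^2(h(X_t))$$ for large enough $b>0$ (i.e. $b>\lambda/(\alpha\epsilon^4)$, with $\lambda<\infty$ as defined in the context), then $(X_t,U_t)$ is a bounded m-solution of the SDAE such that $$\mathbb{P}\big(h(X_t)\in\mathfrak{C}_p\ \text{for some } t\in(0,a]\big)<\alpha,$$ where $(0,a]$ is the interval of existence.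
   Context: $W_t=(W^1_t,\dots,W^d_t)$ is a $d$-dimensional Wiener process; $V,\sigma_l:M\times N\to TM$ satisfy $V(x,u),\sigma_l(x,u)\in T_xM$. The diffusion space $\mathfrak{D}_xM$ is the space of second order differential operators at $x$ without constant term, locally $L=a^i\partial_i+b^{ij}\partial^2_{ij}$ ($b$ symmetric), with symmetric part $\hat L=b^{ij}\partial_i\otimes\partial_j$. A diffusion generator on $M$ is a fiber preserving map ${}^MG:TM\to\mathfrak{D}M$ with $\widehat{{}^MG(Y)}=Y\otimes Y$. The intrinsic SDE $\mathbf{d}X_t=[V+\tfrac12\sum_l {}^MG(\sigma_l)]dt+\sum_l\sigma_l\,dW^l_t$ means that for every smooth $f:M\to\mathbb{R}$, $f(X_t)=f(X_0)+\int_0^t (V+\tfrac12\sum_l {}^MG(\sigma_l))[f]ds+\sum_l\int_0^t\sigma_l[f]dW^l_s$ (Itô). $G_S$ is the Stratonovich diffusion generator, $G_S(\sigma)[f]=\sigma[\sigma[f]]$ (for $\sigma(\cdot,u)$ with $u$ held fixed), and $\nabla^{{}^MG}_S={}^MG-{}^MG_S$, which is tangent-vector valued. A tangent vector $D_xhY\in T_{h(x)}P$ acts by $(D_xhY)[f(h(x))]=Y[f\circ h](x)$, and ${}^PG_S(D_xh\sigma_l)(x,u)[f(h(x))]=\sigma_l(\cdot,u)[\sigma_l(\cdot,u)[f\circ h]](x)$. $\Delta_p(z)$ is the Riemannian distance from $p$ to $z\in P$. $\lambda=\sup_{(x,u)\in S}\sum_{l}((D_xh)\sigma_l(x,u)[\Delta_p^2(h(x))])^2$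 where $S=\{(X_t(\omega),U_t(\omega)): t\in(0,a],\omega\in\Omega\}$ and $\Omega$ is the sample space. An m-solution is a semi-martingale $(X_t,U_t)$ with $\mathbb{E}(h(X_t))=p$ (mean in the Riemannian manifold $P$). An $\epsilon$ bounded m-solution with probability of explosion $\le\alpha$ is an m-solution with $\mathbb{P}(\sup_{s\in[0,t]}\Delta_p(h(X_s))>\epsilon)\le\alpha$ for all $t>0$; it is called a local bounded m-solution if this bound holds for any $t\in(0,a]$, for some $a>0$ making $(0,a]$ an interval of existence. *)

theory Defs
  imports "HOL-Probability.Probability"
begin

section \<open>Smooth manifolds\<close>

primrec k_smooth_on ::
  "nat \<Rightarrow> 'a::euclidean_space set \<Rightarrow> ('a \<Rightarrow> 'b::euclidean_space) \<Rightarrow> bool" where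
  "k_smooth_on 0 S f \<longleftrightarrow> continuous_on S f"
| "k_smooth_on (Suc k) S f \<longleftrightarrow>
     (\<forall>x\<in>S. f differentiable (at x)) \<and>
     (\<forall>v. k_smooth_on k S (\<lambda>x. frechet_derivative f (at x) v))"

text \<open>Only used on open sets.\<close>
definition smooth_on :: "'a::euclidean_space set \<Rightarrow> ('a \<Rightarrow> 'b::euclidean_space) \<Rightarrow> bool" where
  "smooth_on S f \<longleftrightarrow> (\<forall>k. k_smooth_on k S f)"

type_synonym ('m, 'e) chart = "'m set \<times> ('m \<Rightarrow> 'e)"
type_synonym ('m, 'e) atlas = "('m, 'e) chart set"

abbreviation chart_inv :: "('m, 'e) chart \<Rightarrow> 'e \<Rightarrow> 'm" where
  "chart_inv c \<equiv> inv_into (fst c) (snd c)"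

text \<open>The manifold is the whole (Hausdorff, second countable) type, so that its topology is the
  one of the type.\<close>
definition smooth_manifold ::
  "('m::{t2_space,second_countable_topology}, 'e::euclidean_space) atlas \<Rightarrow> bool" where
  "smooth_manifold A \<longleftrightarrow>
     (\<Union>c\<in>A. fst c) = UNIV \<and>
     (\<forall>c\<in>A. open (fst c) \<and> open (snd c ` fst c) \<and> inj_on (snd c) (fst c) \<and>
        homeomorphism (fst c) (snd c ` fst c) (snd c) (chart_inv c)) \<and>
     (\<forall>c\<in>A. \<forall>c'\<in>A. smooth_on (snd c ` (fst c \<inter> fst c')) (snd c' \<circ> chart_inv c))"

definition euclidean_atlas :: "('e::euclidean_space, 'e) atlas" where
  "euclidean_atlas = {(UNIV, \<lambda>x. x)}"

definition product_atlas :: "('m, 'e) atlas \<Rightarrow> ('n, 'f) atlas \<Rightarrow> ('m \<times> 'n, 'e \<times> 'f) atlas" where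
  "product_atlas A B = {(fst c \<times> fst c', map_prod (snd c) (snd c')) |c c'. c \<in> A \<and> c' \<in> B}"

definition smooth_map_at ::
  "('m::topological_space, 'e::euclidean_space) atlas \<Rightarrow> ('p, 'f::euclidean_space) atlas \<Rightarrow>
   'm \<Rightarrow> ('m \<Rightarrow> 'p) \<Rightarrow> bool" where
  "smooth_map_at A B x h \<longleftrightarrow>
     (\<exists>c\<in>A. \<exists>c'\<in>B. \<exists>S. open S \<and> x \<in> S \<and> S \<subseteq> fst c \<and> h ` S \<subseteq> fst c' \<and>
        smooth_on (snd c ` S) (snd c' \<circ> h \<circ> chart_inv c))"

definition smooth_map ::
  "('m::topological_space, 'e::euclidean_space) atlas \<Rightarrow> ('p, 'f::euclidean_space) atlas \<Rightarrow>
   ('m \<Rightarrow> 'p) \<Rightarrow> bool" where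
  "smooth_map A B h \<longleftrightarrow> (\<forall>x. smooth_map_at A B x h)"

text \<open>Smoothness in some neighbourhood of \<open>x\<close>.\<close>
definition smooth_fun_at ::
  "('m::topological_space, 'e::euclidean_space) atlas \<Rightarrow> 'm \<Rightarrow> ('m \<Rightarrow> real) \<Rightarrow> bool" where
  "smooth_fun_at A x f \<longleftrightarrow> smooth_map_at A euclidean_atlas x f"

definition smooth_fun ::
  "('m::topological_space, 'e::euclidean_space) atlas \<Rightarrow> ('m \<Rightarrow> real) \<Rightarrow> bool" where
  "smooth_fun A f \<longleftrightarrow> (\<forall>x. smooth_fun_at A x f)"

section \<open>Tangent vectors and second order operators\<close>

text \<open>An operator at \<open>x\<close> acts on the functions that are smooth in a neighbourhood of \<open>x\<close>; to make
  equality of operators extensional, it is given the value \<open>0\<close> on all other functions.\<close>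

type_synonym 'm operator = "('m \<Rightarrow> real) \<Rightarrow> real"

definition partial1 ::
  "('m, 'e::euclidean_space) chart \<Rightarrow> 'e \<Rightarrow> ('m \<Rightarrow> real) \<Rightarrow> 'e \<Rightarrow> real" where
  "partial1 c i f y = frechet_derivative (f \<circ> chart_inv c) (at y) i"

definition partial2 ::
  "('m, 'e::euclidean_space) chart \<Rightarrow> 'e \<Rightarrow> 'e \<Rightarrow> ('m \<Rightarrow> real) \<Rightarrow> 'e \<Rightarrow> real" where
  "partial2 c i j f y = frechet_derivative (partial1 c j f) (at y) i"

text \<open>The operator \<open>a\<^sup>i \<partial>\<^sub>i + b\<^sup>i\<^sup>j \<partial>\<^sup>2\<^sub>i\<^sub>j\<close> at \<open>x\<close> in the coordinates of \<open>c\<close>, where \<open>b i j\<close>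
  is the entry of \<open>b\<close> at the basis vectors \<open>i\<close>, \<open>j\<close>.\<close>
definition coord_op ::
  "('m::topological_space, 'e::euclidean_space) atlas \<Rightarrow> ('m, 'e) chart \<Rightarrow> 'm \<Rightarrow>
   'e \<Rightarrow> ('e \<Rightarrow> 'e \<Rightarrow> real) \<Rightarrow> 'm operator" where
  "coord_op A c x a b = (\<lambda>f. if smooth_fun_at A x f
     then (\<Sum>i\<in>Basis. (a \<bullet> i) * partial1 c i f (snd c x)) +
          (\<Sum>i\<in>Basis. \<Sum>j\<in>Basis. b i j * partial2 c i j f (snd c x))
     else 0)"

definition coord_vec ::
  "('m::topological_space, 'e::euclidean_space) atlas \<Rightarrow> ('m, 'e) chart \<Rightarrow> 'm \<Rightarrow> 'e \<Rightarrow> 'm operator"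
  where "coord_vec A c x a = coord_op A c x a (\<lambda>_ _. 0)"

definition tangent_space ::
  "('m::topological_space, 'e::euclidean_space) atlas \<Rightarrow> 'm \<Rightarrow> 'm operator set" where
  "tangent_space A x = {coord_vec A c x a |c a. c \<in> A \<and> x \<in> fst c}"

definition diffusion_space ::
  "('m::topological_space, 'e::euclidean_space) atlas \<Rightarrow> 'm \<Rightarrow> 'm operator set" where
  "diffusion_space A x =
     {coord_op A c x a b |c a b. c \<in> A \<and> x \<in> fst c \<and> (\<forall>i\<in>Basis. \<forall>j\<in>Basis. b i j = b j i)}"

text \<open>In the chart \<open>c\<close>, the symmetric part of \<open>L\<close> is \<open>b\<^sup>i\<^sup>j \<partial>\<^sub>i \<otimes> \<partial>\<^sub>j\<close>.\<close>
definition has_sym_part ::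
  "('m::topological_space, 'e::euclidean_space) atlas \<Rightarrow> ('m, 'e) chart \<Rightarrow> 'm \<Rightarrow>
   'm operator \<Rightarrow> ('e \<Rightarrow> 'e \<Rightarrow> real) \<Rightarrow> bool" where
  "has_sym_part A c x L b \<longleftrightarrow>
     (\<forall>i\<in>Basis. \<forall>j\<in>Basis. b i j = b j i) \<and> (\<exists>a. L = coord_op A c x a b)"

text \<open>For \<open>Y = y\<^sup>i \<partial>\<^sub>i\<close> the tensor \<open>Y \<otimes> Y\<close> has the components \<open>y\<^sup>i y\<^sup>j\<close>.\<close>
definition diffusion_generator ::
  "('m::topological_space, 'e::euclidean_space) atlas \<Rightarrow> ('m \<Rightarrow> 'm operator \<Rightarrow> 'm operator) \<Rightarrow> bool"
  where
  "diffusion_generator A G \<longleftrightarrow> (\<forall>x. \<forall>Y\<in>tangent_space A x.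
     G x Y \<in> diffusion_space A x \<and>
     (\<forall>c\<in>A. \<forall>y. x \<in> fst c \<and> Y = coord_vec A c x y \<longrightarrow>
        has_sym_part A c x (G x Y) (\<lambda>i j. (y \<bullet> i) * (y \<bullet> j))))"

definition smooth_vector_field ::
  "('m::topological_space, 'e::euclidean_space) atlas \<Rightarrow> ('m \<Rightarrow> 'm operator) \<Rightarrow> bool" where
  "smooth_vector_field A s \<longleftrightarrow> (\<forall>x. s x \<in> tangent_space A x) \<and>
     (\<forall>x f. smooth_fun_at A x f \<longrightarrow> smooth_fun_at A x (\<lambda>y. s y f))"

definition pushforward ::
  "('p::topological_space, 'f::euclidean_space) atlas \<Rightarrow> ('m \<Rightarrow> 'p) \<Rightarrow> 'm \<Rightarrow>
   'm operator \<Rightarrow> 'p operator" where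
  "pushforward B h x L = (\<lambda>f. if smooth_fun_at B (h x) f then L (f \<circ> h) else 0)"

definition stratonovich ::
  "('m::topological_space, 'e::euclidean_space) atlas \<Rightarrow> ('m \<Rightarrow> 'm operator) \<Rightarrow> 'm \<Rightarrow> 'm operator"
  where "stratonovich A s x = (\<lambda>f. if smooth_fun_at A x f then s x (\<lambda>y. s y f) else 0)"

text \<open>\<open>\<nabla>\<^sup>G\<^sub>S(s) = G(s) - G\<^sub>S(s)\<close>, for a vector field \<open>s\<close>.\<close>
definition nabla_S ::
  "('m::topological_space, 'e::euclidean_space) atlas \<Rightarrow> ('m \<Rightarrow> 'm operator \<Rightarrow> 'm operator) \<Rightarrow>
   ('m \<Rightarrow> 'm operator) \<Rightarrow> 'm \<Rightarrow> 'm operator" where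
  "nabla_S A G s x = (\<lambda>f. G x (s x) f - stratonovich A s x f)"

text \<open>\<open>G\<^sub>S(Dh s)\<close> on the target manifold, \<open>f \<mapsto> s[s[f \<circ> h]](x)\<close>.\<close>
definition stratonovich_push ::
  "('m::topological_space, 'e::euclidean_space) atlas \<Rightarrow>
   ('p::topological_space, 'f::euclidean_space) atlas \<Rightarrow> ('m \<Rightarrow> 'p) \<Rightarrow>
   ('m \<Rightarrow> 'm operator) \<Rightarrow> 'm \<Rightarrow> 'p operator" where
  "stratonovich_push A B h s x =
     (\<lambda>f. if smooth_fun_at B (h x) f then s x (\<lambda>y. s y (f \<circ> h)) else 0)"

section \<open>Riemannian geometry\<close>

type_synonym 'p metric = "'p \<Rightarrow> 'p operator \<Rightarrow> 'p operator \<Rightarrow> real"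

definition metric_coord ::
  "('p::topological_space, 'e::euclidean_space) atlas \<Rightarrow> 'p metric \<Rightarrow> ('p, 'e) chart \<Rightarrow>
   'e \<Rightarrow> 'e \<Rightarrow> 'e \<Rightarrow> real" where
  "metric_coord A g c y v w =
     (let x = chart_inv c y in g x (coord_vec A c x v) (coord_vec A c x w))"

definition riemannian_metric ::
  "('p::topological_space, 'e::euclidean_space) atlas \<Rightarrow> 'p metric \<Rightarrow> bool" where
  "riemannian_metric A g \<longleftrightarrow>
     (\<forall>x. \<forall>u\<in>tangent_space A x. \<forall>v\<in>tangent_space A x. g x u v = g x v u) \<and>
     (\<forall>x. \<forall>u\<in>tangent_space A x. \<forall>v\<in>tangent_space A x. \<forall>w\<in>tangent_space A x. \<forall>k.
        g x (\<lambda>f. k * u f + v f) w = k * g x u w + g x v w) \<and>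
     (\<forall>x. \<forall>u\<in>tangent_space A x. u \<noteq> (\<lambda>_. 0) \<longrightarrow> 0 < g x u u) \<and>
     (\<forall>c\<in>A. \<forall>v w. smooth_on (snd c ` fst c) (\<lambda>y. metric_coord A g c y v w))"

definition velocity ::
  "('p::topological_space, 'e::euclidean_space) atlas \<Rightarrow> (real \<Rightarrow> 'p) \<Rightarrow> real \<Rightarrow> 'p operator" where
  "velocity A \<gamma> t = (\<lambda>f. if smooth_fun_at A (\<gamma> t) f then deriv (\<lambda>s. f (\<gamma> s)) t else 0)"

text \<open>Continuous and C1 off a finite set, like \<^const>\<open>piecewise_C1_differentiable_on\<close>; the one-sided
  limits of the velocity are not required to exist, which does not change the infimum of the
  lengths.\<close>
definition piecewise_C1_curve ::
  "('p::topological_space, 'e::euclidean_space) atlas \<Rightarrow> (real \<Rightarrow> 'p) \<Rightarrow> bool" where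
  "piecewise_C1_curve A \<gamma> \<longleftrightarrow> continuous_on {0..1} \<gamma> \<and>
     (\<exists>S. finite S \<and> (\<forall>t\<in>{0<..<1} - S. \<exists>c\<in>A. \<exists>e>0.
        \<gamma> ` {t-e<..<t+e} \<subseteq> fst c \<and> (snd c \<circ> \<gamma>) C1_differentiable_on {t-e<..<t+e}))"

definition curve_length ::
  "('p::topological_space, 'e::euclidean_space) atlas \<Rightarrow> 'p metric \<Rightarrow> (real \<Rightarrow> 'p) \<Rightarrow> ennreal" where
  "curve_length A g \<gamma> =
     (\<integral>\<^sup>+ t\<in>{0..1}. ennreal (sqrt (g (\<gamma> t) (velocity A \<gamma> t) (velocity A \<gamma> t))) \<partial>lborel)"

text \<open>The distance is \<open>\<infinity>\<close> between different connected components.\<close>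
definition riem_dist ::
  "('p::topological_space, 'e::euclidean_space) atlas \<Rightarrow> 'p metric \<Rightarrow> 'p \<Rightarrow> 'p \<Rightarrow> ennreal" where
  "riem_dist A g x y =
     (INF \<gamma> \<in> {\<gamma>. piecewise_C1_curve A \<gamma> \<and> \<gamma> 0 = x \<and> \<gamma> 1 = y}. curve_length A g \<gamma>)"

definition dist_sq ::
  "('p::topological_space, 'e::euclidean_space) atlas \<Rightarrow> 'p metric \<Rightarrow> 'p \<Rightarrow> 'p \<Rightarrow> real" where
  "dist_sq A g p z = (enn2real (riem_dist A g p z))\<^sup>2"

text \<open>Christoffel symbols of the first kind, \<open>\<Gamma>\<^sub>k\<^sub>,\<^sub>i\<^sub>j u\<^sup>i v\<^sup>j w\<^sup>k\<close>.\<close>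
definition christoffel ::
  "('p::topological_space, 'e::euclidean_space) atlas \<Rightarrow> 'p metric \<Rightarrow> ('p, 'e) chart \<Rightarrow>
   'e \<Rightarrow> 'e \<Rightarrow> 'e \<Rightarrow> 'e \<Rightarrow> real" where
  "christoffel A g c y u v w =
     (frechet_derivative (\<lambda>z. metric_coord A g c z v w) (at y) u +
      frechet_derivative (\<lambda>z. metric_coord A g c z u w) (at y) v -
      frechet_derivative (\<lambda>z. metric_coord A g c z u v) (at y) w) / 2"

text \<open>The geodesic equation in coordinates, with the index lowered by the metric.\<close>
definition geodesic_on ::
  "('p::topological_space, 'e::euclidean_space) atlas \<Rightarrow> 'p metric \<Rightarrow> real set \<Rightarrow> (real \<Rightarrow> 'p) \<Rightarrow> bool"
  where
  "geodesic_on A g J \<gamma> \<longleftrightarrow> (\<forall>t\<in>J. \<exists>c\<in>A. \<exists>e>0. \<exists>y' y''.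
     \<gamma> ` {t-e<..<t+e} \<subseteq> fst c \<and>
     (\<forall>s\<in>{t-e<..<t+e}. ((snd c \<circ> \<gamma>) has_vector_derivative y' s) (at s)) \<and>
     (y' has_vector_derivative y'') (at t) \<and>
     (\<forall>w. metric_coord A g c (snd c (\<gamma> t)) y'' w +
          christoffel A g c (snd c (\<gamma> t)) (y' t) (y' t) w = 0))"

definition exp_geodesic ::
  "('p::topological_space, 'e::euclidean_space) atlas \<Rightarrow> 'p metric \<Rightarrow> 'p \<Rightarrow> 'p operator \<Rightarrow>
   (real \<Rightarrow> 'p) \<Rightarrow> bool" where
  "exp_geodesic A g p v \<gamma> \<longleftrightarrow>
     (\<exists>J. open J \<and> connected J \<and> {0..1} \<subseteq> J \<and> geodesic_on A g J \<gamma>) \<and>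
     \<gamma> 0 = p \<and> velocity A \<gamma> 0 = v"

definition exp_map ::
  "('p::topological_space, 'e::euclidean_space) atlas \<Rightarrow> 'p metric \<Rightarrow> 'p \<Rightarrow> 'p operator \<Rightarrow> 'p" where
  "exp_map A g p v = (THE q. \<exists>\<gamma>. exp_geodesic A g p v \<gamma> \<and> \<gamma> 1 = q)"

text \<open>\<open>exp\<^sub>p\<close> is defined on the open ball of radius \<open>r\<close> in the tangent space at \<open>p\<close>, and is a
  diffeomorphism from it onto an open set. The tangent space is identified with the model space by
  a chart \<open>c\<close> at \<open>p\<close>.\<close>
definition exp_diffeo_on_ball ::
  "('p::topological_space, 'e::euclidean_space) atlas \<Rightarrow> 'p metric \<Rightarrow> 'p \<Rightarrow> real \<Rightarrow> bool" where
  "exp_diffeo_on_ball A g p r \<longleftrightarrow> (\<exists>c\<in>A. p \<in> fst c \<and>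
     (let D = {\<xi>. metric_coord A g c (snd c p) \<xi> \<xi> < r\<^sup>2};
          E = (\<lambda>\<xi>. exp_map A g p (coord_vec A c p \<xi>))
      in (\<forall>\<xi>\<in>D. \<exists>\<gamma>. exp_geodesic A g p (coord_vec A c p \<xi>) \<gamma>) \<and>
         inj_on E D \<and> open (E ` D) \<and>
         (\<forall>\<xi>\<in>D. smooth_map_at euclidean_atlas A \<xi> E) \<and>
         (\<forall>z\<in>E ` D. smooth_map_at A euclidean_atlas z (inv_into D E))))"

definition injectivity_radius ::
  "('p::topological_space, 'e::euclidean_space) atlas \<Rightarrow> 'p metric \<Rightarrow> 'p \<Rightarrow> ennreal" where
  "injectivity_radius A g p = (SUP r \<in> {r. 0 < r \<and> exp_diffeo_on_ball A g p r}. ennreal r)"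

text \<open>The points \<open>\<gamma>(\<tau>)\<close>, for unit speed geodesics \<open>\<gamma>\<close> from \<open>p\<close>, such that \<open>\<gamma>\<close> minimises the length
  up to the time \<open>\<tau>\<close> and not beyond; \<open>\<gamma>\<close> is minimising on \<open>[0,s]\<close> iff its length \<open>s\<close> there is the
  distance of \<open>p\<close> and \<open>\<gamma>(s)\<close>.\<close>
definition cut_locus ::
  "('p::topological_space, 'e::euclidean_space) atlas \<Rightarrow> 'p metric \<Rightarrow> 'p \<Rightarrow> 'p set" where
  "cut_locus A g p = {\<gamma> \<tau> |\<gamma> \<tau>. \<exists>J. open J \<and> connected J \<and> 0 \<in> J \<and> \<tau> \<in> J \<and> 0 < \<tau> \<and>
     geodesic_on A g J \<gamma> \<and> \<gamma> 0 = p \<and> g p (velocity A \<gamma> 0) (velocity A \<gamma> 0) = 1 \<and>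
     (\<forall>s\<in>J. 0 \<le> s \<longrightarrow> (riem_dist A g p (\<gamma> s) = ennreal s \<longleftrightarrow> s \<le> \<tau>))}"

section \<open>Stochastic calculus\<close>

text \<open>The time set is \<open>[0,\<infinity>)\<close>; the values of \<open>F\<close> at negative times play no role.\<close>
definition stochastic_basis :: "'w measure \<Rightarrow> (real \<Rightarrow> 'w measure) \<Rightarrow> bool" where
  "stochastic_basis Pr F \<longleftrightarrow>
     prob_space Pr \<and> filtration (space Pr) F \<and> (\<forall>t. subalgebra Pr (F t))"

text \<open>The family indexed by \<open>{0..d}\<close> expresses that the past up to \<open>s\<close> and the increments of the
  \<open>d\<close> components are jointly independent.\<close>
definition wiener_process ::
  "'w measure \<Rightarrow> (real \<Rightarrow> 'w measure) \<Rightarrow> nat \<Rightarrow> (nat \<Rightarrow> real \<Rightarrow> 'w \<Rightarrow> real) \<Rightarrow> bool" where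
  "wiener_process Pr F d W \<longleftrightarrow>
     (\<forall>l\<in>{1..d}. (AE \<omega> in Pr. W l 0 \<omega> = 0) \<and>
        (\<forall>\<omega>\<in>space Pr. continuous_on {0..} (\<lambda>t. W l t \<omega>)) \<and>
        (\<forall>t\<ge>0. W l t \<in> borel_measurable (F t)) \<and>
        (\<forall>s t. 0 \<le> s \<and> s < t \<longrightarrow>
           distributed Pr lborel (\<lambda>\<omega>. W l t \<omega> - W l s \<omega>) (normal_density 0 (sqrt (t - s))))) \<and>
     (\<forall>s t. 0 \<le> s \<and> s < t \<longrightarrow>
        prob_space.indep_sets Pr
          (\<lambda>l. if l = 0 then sets (F s)
               else {(\<lambda>\<omega>. W l t \<omega> - W l s \<omega>) -` B \<inter> space Pr |B. B \<in> sets borel})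
          {0..d})"

text \<open>A simple process \<open>(k, \<tau>, \<xi>)\<close> is \<open>\<Sum>i<k. \<xi>\<^sub>i 1(\<tau>\<^sub>i, \<tau>\<^sub>i\<^sub>+\<^sub>1]\<close>.\<close>
type_synonym 'w simple_process = "nat \<times> (nat \<Rightarrow> real) \<times> (nat \<Rightarrow> 'w \<Rightarrow> real)"

definition simple_process ::
  "'w measure \<Rightarrow> (real \<Rightarrow> 'w measure) \<Rightarrow> real \<Rightarrow> 'w simple_process \<Rightarrow> bool" where
  "simple_process Pr F a S = (case S of (k, \<tau>, \<xi>) \<Rightarrow> \<forall>i<k.
     0 \<le> \<tau> i \<and> \<tau> i \<le> \<tau> (Suc i) \<and> \<tau> (Suc i) \<le> a \<and>
     \<xi> i \<in> borel_measurable (F (\<tau> i)) \<and> (\<exists>B. \<forall>\<omega>\<in>space Pr. \<bar>\<xi> i \<omega>\<bar> \<le> B))"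

definition simple_value :: "'w simple_process \<Rightarrow> real \<Rightarrow> 'w \<Rightarrow> real" where
  "simple_value S t \<omega> = (case S of (k, \<tau>, \<xi>) \<Rightarrow>
     (\<Sum>i<k. \<xi> i \<omega> * indicator {\<tau> i<..\<tau> (Suc i)} t))"

definition simple_integral ::
  "(real \<Rightarrow> 'w \<Rightarrow> real) \<Rightarrow> 'w simple_process \<Rightarrow> real \<Rightarrow> 'w \<Rightarrow> real" where
  "simple_integral W S t \<omega> = (case S of (k, \<tau>, \<xi>) \<Rightarrow>
     (\<Sum>i<k. \<xi> i \<omega> * (W (min t (\<tau> (Suc i))) \<omega> - W (min t (\<tau> i)) \<omega>)))"

definition null_in_probability :: "'w measure \<Rightarrow> (nat \<Rightarrow> 'w \<Rightarrow> ennreal) \<Rightarrow> bool" where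
  "null_in_probability Pr Z \<longleftrightarrow>
     (\<forall>e>0. (\<lambda>n. measure Pr {\<omega>\<in>space Pr. Z n \<omega> > ennreal e}) \<longlonglongrightarrow> 0)"

definition progressive ::
  "(real \<Rightarrow> 'w measure) \<Rightarrow> real \<Rightarrow> (real \<Rightarrow> 'w \<Rightarrow> real) \<Rightarrow> bool" where
  "progressive F a H \<longleftrightarrow> (\<forall>t\<in>{0..a}.
     (\<lambda>(s, \<omega>). H s \<omega>) \<in> borel_measurable (restrict_space borel {0..t} \<Otimes>\<^sub>M F t))"

text \<open>\<open>Y t = \<integral>\<^sub>0\<^sup>t H dW\<close> for \<open>t \<in> [0,a]\<close>: the continuous process \<open>Y\<close> is the limit, uniformly on
  \<open>[0,a]\<close> in probability, of the integrals of simple processes that approximate \<open>H\<close> in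
  \<open>L\<^sup>2([0,a])\<close> in probability. It is determined up to indistinguishability.\<close>
definition is_ito_integral ::
  "'w measure \<Rightarrow> (real \<Rightarrow> 'w measure) \<Rightarrow> real \<Rightarrow> (real \<Rightarrow> 'w \<Rightarrow> real) \<Rightarrow>
   (real \<Rightarrow> 'w \<Rightarrow> real) \<Rightarrow> (real \<Rightarrow> 'w \<Rightarrow> real) \<Rightarrow> bool" where
  "is_ito_integral Pr F a W H Y \<longleftrightarrow>
     progressive F a H \<and>
     (AE \<omega> in Pr. (\<integral>\<^sup>+ s\<in>{0..a}. ennreal ((H s \<omega>)\<^sup>2) \<partial>lborel) < \<infinity>) \<and>
     (\<forall>t\<in>{0..a}. Y t \<in> borel_measurable Pr) \<and>
     (\<forall>\<omega>\<in>space Pr. continuous_on {0..a} (\<lambda>t. Y t \<omega>)) \<and>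
     (\<exists>S. (\<forall>n. simple_process Pr F a (S n)) \<and>
        null_in_probability Pr
          (\<lambda>n \<omega>. \<integral>\<^sup>+ s\<in>{0..a}. ennreal ((simple_value (S n) s \<omega> - H s \<omega>)\<^sup>2) \<partial>lborel) \<and>
        null_in_probability Pr
          (\<lambda>n \<omega>. SUP t\<in>{0..a}. ennreal \<bar>simple_integral W (S n) t \<omega> - Y t \<omega>\<bar>))"

definition adapted_continuous ::
  "'w measure \<Rightarrow> (real \<Rightarrow> 'w measure) \<Rightarrow> real \<Rightarrow> (real \<Rightarrow> 'w \<Rightarrow> 'b::topological_space) \<Rightarrow> bool" where
  "adapted_continuous Pr F a Z \<longleftrightarrow> (\<forall>t\<in>{0..a}. Z t \<in> F t \<rightarrow>\<^sub>M borel) \<and>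
     (\<forall>\<omega>\<in>space Pr. continuous_on {0..a} (\<lambda>t. Z t \<omega>))"

definition martingale ::
  "'w measure \<Rightarrow> (real \<Rightarrow> 'w measure) \<Rightarrow> real \<Rightarrow> (real \<Rightarrow> 'w \<Rightarrow> real) \<Rightarrow> bool" where
  "martingale Pr F a Z \<longleftrightarrow>
     (\<forall>t\<in>{0..a}. Z t \<in> borel_measurable (F t) \<and> integrable Pr (Z t)) \<and>
     (\<forall>s t. 0 \<le> s \<and> s \<le> t \<and> t \<le> a \<longrightarrow> (AE \<omega> in Pr. real_cond_exp Pr (F s) (Z t) \<omega> = Z s \<omega>))"

text \<open>As the time set is \<open>[0,a]\<close>, the localising stopping times are eventually equal to \<open>a\<close>.\<close>
definition continuous_local_martingale ::
  "'w measure \<Rightarrow> (real \<Rightarrow> 'w measure) \<Rightarrow> real \<Rightarrow> (real \<Rightarrow> 'w \<Rightarrow> real) \<Rightarrow> bool" where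
  "continuous_local_martingale Pr F a Z \<longleftrightarrow> adapted_continuous Pr F a Z \<and>
     (\<exists>T :: nat \<Rightarrow> 'w \<Rightarrow> real.
        (\<forall>n. stopping_time F (T n) \<and> (\<forall>\<omega>\<in>space Pr. 0 \<le> T n \<omega> \<and> T n \<omega> \<le> a)) \<and>
        (\<forall>n. \<forall>\<omega>\<in>space Pr. T n \<omega> \<le> T (Suc n) \<omega>) \<and>
        (AE \<omega> in Pr. \<exists>n. T n \<omega> = a) \<and>
        (\<forall>n. martingale Pr F a (\<lambda>t \<omega>. Z (min t (T n \<omega>)) \<omega> - Z 0 \<omega>)))"

definition finite_variation :: "real \<Rightarrow> (real \<Rightarrow> real) \<Rightarrow> bool" where
  "finite_variation a f \<longleftrightarrow> (\<exists>B. \<forall>k (\<tau> :: nat \<Rightarrow> real). mono \<tau> \<and> range \<tau> \<subseteq> {0..a} \<longrightarrow>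
     (\<Sum>i<k. \<bar>f (\<tau> (Suc i)) - f (\<tau> i)\<bar>) \<le> B)"

definition real_semimartingale ::
  "'w measure \<Rightarrow> (real \<Rightarrow> 'w measure) \<Rightarrow> real \<Rightarrow> (real \<Rightarrow> 'w \<Rightarrow> real) \<Rightarrow> bool" where
  "real_semimartingale Pr F a Z \<longleftrightarrow> (\<exists>L A.
     continuous_local_martingale Pr F a L \<and> adapted_continuous Pr F a A \<and>
     (\<forall>\<omega>\<in>space Pr. finite_variation a (\<lambda>t. A t \<omega>)) \<and>
     (\<forall>t\<in>{0..a}. \<forall>\<omega>\<in>space Pr. Z t \<omega> = L t \<omega> + A t \<omega>))"

definition semimartingale_in ::
  "('m::topological_space, 'e::euclidean_space) atlas \<Rightarrow> 'w measure \<Rightarrow> (real \<Rightarrow> 'w measure) \<Rightarrow> real \<Rightarrow>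
   (real \<Rightarrow> 'w \<Rightarrow> 'm) \<Rightarrow> bool" where
  "semimartingale_in A Pr F a Z \<longleftrightarrow> adapted_continuous Pr F a Z \<and>
     (\<forall>f. smooth_fun A f \<longrightarrow> real_semimartingale Pr F a (\<lambda>t \<omega>. f (Z t \<omega>)))"

section \<open>The SDAE\<close>

definition sde_drift ::
  "('m \<Rightarrow> 'm operator \<Rightarrow> 'm operator) \<Rightarrow> nat \<Rightarrow> ('m \<Rightarrow> 'n \<Rightarrow> 'm operator) \<Rightarrow>
   (nat \<Rightarrow> 'm \<Rightarrow> 'n \<Rightarrow> 'm operator) \<Rightarrow> 'm \<Rightarrow> 'n \<Rightarrow> 'm operator" where
  "sde_drift G d V \<sigma> x u = (\<lambda>f. V x u f + (\<Sum>l=1..d. G x (\<sigma> l x u) f) / 2)"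

definition solves_sde ::
  "('m::topological_space, 'e::euclidean_space) atlas \<Rightarrow> ('m \<Rightarrow> 'm operator \<Rightarrow> 'm operator) \<Rightarrow>
   nat \<Rightarrow> ('m \<Rightarrow> 'n \<Rightarrow> 'm operator) \<Rightarrow> (nat \<Rightarrow> 'm \<Rightarrow> 'n \<Rightarrow> 'm operator) \<Rightarrow>
   'w measure \<Rightarrow> (real \<Rightarrow> 'w measure) \<Rightarrow> (nat \<Rightarrow> real \<Rightarrow> 'w \<Rightarrow> real) \<Rightarrow> real \<Rightarrow>
   (real \<Rightarrow> 'w \<Rightarrow> 'm) \<Rightarrow> (real \<Rightarrow> 'w \<Rightarrow> 'n) \<Rightarrow> bool" where
  "solves_sde A G d V \<sigma> Pr F W a X U \<longleftrightarrow> (\<forall>f. smooth_fun A f \<longrightarrow>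
     (\<exists>Y. (\<forall>l\<in>{1..d}. is_ito_integral Pr F a (W l) (\<lambda>s \<omega>. \<sigma> l (X s \<omega>) (U s \<omega>) f) (Y l)) \<and>
        (AE \<omega> in Pr. set_integrable lborel {0..a} (\<lambda>s. sde_drift G d V \<sigma> (X s \<omega>) (U s \<omega>) f) \<and>
           (\<forall>t\<in>{0..a}. f (X t \<omega>) = f (X 0 \<omega>)
              + (LBINT s:{0..t}. sde_drift G d V \<sigma> (X s \<omega>) (U s \<omega>) f)
              + (\<Sum>l=1..d. Y l t \<omega>)))))"

text \<open>The mean of a random variable in a Riemannian manifold, as the unique minimiser of the mean
  squared distance.\<close>
definition is_riemannian_mean ::
  "('p::topological_space, 'e::euclidean_space) atlas \<Rightarrow> 'p metric \<Rightarrow> 'w measure \<Rightarrow>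
   ('w \<Rightarrow> 'p) \<Rightarrow> 'p \<Rightarrow> bool" where
  "is_riemannian_mean A g Pr Z p \<longleftrightarrow> Z \<in> Pr \<rightarrow>\<^sub>M borel \<and>
     (\<integral>\<^sup>+ \<omega>. (riem_dist A g p (Z \<omega>))\<^sup>2 \<partial>Pr) < \<infinity> \<and>
     (\<forall>q. q \<noteq> p \<longrightarrow>
        (\<integral>\<^sup>+ \<omega>. (riem_dist A g p (Z \<omega>))\<^sup>2 \<partial>Pr) < (\<integral>\<^sup>+ \<omega>. (riem_dist A g q (Z \<omega>))\<^sup>2 \<partial>Pr))"

definition m_solution ::
  "('m::topological_space, 'e::euclidean_space) atlas \<Rightarrow>
   ('n::topological_space, 'f::euclidean_space) atlas \<Rightarrow>
   ('p::topological_space, 'k::euclidean_space) atlas \<Rightarrow> 'p metric \<Rightarrow> ('m \<Rightarrow> 'p) \<Rightarrow> 'p \<Rightarrow>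
   ('m \<Rightarrow> 'm operator \<Rightarrow> 'm operator) \<Rightarrow>
   nat \<Rightarrow> ('m \<Rightarrow> 'n \<Rightarrow> 'm operator) \<Rightarrow> (nat \<Rightarrow> 'm \<Rightarrow> 'n \<Rightarrow> 'm operator) \<Rightarrow>
   'w measure \<Rightarrow> (real \<Rightarrow> 'w measure) \<Rightarrow> (nat \<Rightarrow> real \<Rightarrow> 'w \<Rightarrow> real) \<Rightarrow> real \<Rightarrow>
   (real \<Rightarrow> 'w \<Rightarrow> 'm) \<Rightarrow> (real \<Rightarrow> 'w \<Rightarrow> 'n) \<Rightarrow> bool" where
  "m_solution AM AN AP g h p G d V \<sigma> Pr F W a X U \<longleftrightarrow>
     semimartingale_in (product_atlas AM AN) Pr F a (\<lambda>t \<omega>. (X t \<omega>, U t \<omega>)) \<and>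
     solves_sde AM G d V \<sigma> Pr F W a X U \<and>
     (\<forall>t\<in>{0..a}. is_riemannian_mean AP g Pr (\<lambda>\<omega>. h (X t \<omega>)) p)"

text \<open>Outer probabilities agree with probabilities on measurable events; they exclude that a bound
  holds only because some set is not measurable.\<close>
definition local_bounded_m_solution ::
  "('m::topological_space, 'e::euclidean_space) atlas \<Rightarrow>
   ('n::topological_space, 'f::euclidean_space) atlas \<Rightarrow>
   ('p::topological_space, 'k::euclidean_space) atlas \<Rightarrow> 'p metric \<Rightarrow> ('m \<Rightarrow> 'p) \<Rightarrow> 'p \<Rightarrow>
   ('m \<Rightarrow> 'm operator \<Rightarrow> 'm operator) \<Rightarrow>
   nat \<Rightarrow> ('m \<Rightarrow> 'n \<Rightarrow> 'm operator) \<Rightarrow> (nat \<Rightarrow> 'm \<Rightarrow> 'n \<Rightarrow> 'm operator) \<Rightarrow>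
   'w measure \<Rightarrow> (real \<Rightarrow> 'w measure) \<Rightarrow> (nat \<Rightarrow> real \<Rightarrow> 'w \<Rightarrow> real) \<Rightarrow> real \<Rightarrow>
   real \<Rightarrow> real \<Rightarrow> (real \<Rightarrow> 'w \<Rightarrow> 'm) \<Rightarrow> (real \<Rightarrow> 'w \<Rightarrow> 'n) \<Rightarrow> bool" where
  "local_bounded_m_solution AM AN AP g h p G d V \<sigma> Pr F W a \<epsilon> \<alpha> X U \<longleftrightarrow>
     m_solution AM AN AP g h p G d V \<sigma> Pr F W a X U \<and>
     (\<forall>t\<in>{0<..a}. outer_measure_of Pr
        {\<omega>\<in>space Pr. (SUP s\<in>{0..t}. riem_dist AP g p (h (X s \<omega>))) > ennreal \<epsilon>} \<le> ennreal \<alpha>)"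

text \<open>The drift
  \<open>D\<^sub>xh V + (1/2) \<Sum>l. D\<^sub>xh \<nabla>\<^sub>S(\<sigma>\<^sub>l) + (1/2) \<Sum>l. G\<^sub>S(D\<^sub>xh \<sigma>\<^sub>l)\<close> of \<open>h(X)\<close>.\<close>
definition image_drift ::
  "('m::topological_space, 'e::euclidean_space) atlas \<Rightarrow>
   ('p::topological_space, 'k::euclidean_space) atlas \<Rightarrow> ('m \<Rightarrow> 'p) \<Rightarrow>
   ('m \<Rightarrow> 'm operator \<Rightarrow> 'm operator) \<Rightarrow>
   nat \<Rightarrow> ('m \<Rightarrow> 'n \<Rightarrow> 'm operator) \<Rightarrow> (nat \<Rightarrow> 'm \<Rightarrow> 'n \<Rightarrow> 'm operator) \<Rightarrow>
   'm \<Rightarrow> 'n \<Rightarrow> 'p operator" where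
  "image_drift AM AP h G d V \<sigma> x u = (\<lambda>f.
     pushforward AP h x (V x u) f
     + (\<Sum>l=1..d. pushforward AP h x (nabla_S AM G (\<lambda>y. \<sigma> l y u) x) f) / 2
     + (\<Sum>l=1..d. stratonovich_push AM AP h (\<lambda>y. \<sigma> l y u) x f) / 2)"

text \<open>Points at which the squared distance is not smooth contribute \<open>0\<close> to this supremum.\<close>
definition noise_bound ::
  "('p::topological_space, 'k::euclidean_space) atlas \<Rightarrow> 'p metric \<Rightarrow> ('m \<Rightarrow> 'p) \<Rightarrow> 'p \<Rightarrow>
   nat \<Rightarrow> (nat \<Rightarrow> 'm \<Rightarrow> 'n \<Rightarrow> 'm operator) \<Rightarrow> 'w measure \<Rightarrow> real \<Rightarrow>
   (real \<Rightarrow> 'w \<Rightarrow> 'm) \<Rightarrow> (real \<Rightarrow> 'w \<Rightarrow> 'n) \<Rightarrow> ennreal" where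
  "noise_bound AP g h p d \<sigma> Pr a X U =
     (SUP (x, u) \<in> {(X t \<omega>, U t \<omega>) |t \<omega>. t \<in> {0<..a} \<and> \<omega> \<in> space Pr}.
        ennreal (\<Sum>l=1..d. (pushforward AP h x (\<sigma> l x u) (dist_sq AP g p))\<^sup>2))"

end

theory Submission
  imports Defs
begin

text \<open>Near \<open>p\<close> the squared distance \<open>\<Delta>\<^sup>2\<close> is smooth by the Gauss lemma. Compose it with a concave
  increasing function that vanishes at \<open>0\<close> and is constant beyond a small radius: the composite
  \<open>\<phi>\<close> is smooth on the whole of \<open>P\<close>, nonnegative, and zero only at \<open>p\<close>. The chain rule for second order
  operators turns the drift hypothesis into a drift \<open>\<le> 0\<close> of \<open>\<phi>(h(X))\<close>, because concavity gives the
  second order term the right sign. Hence \<open>0 \<le> \<phi>(h(X\<^sub>t)) \<le> \<Sum>\<^sub>l \<integral>\<^sub>0\<^sup>t \<sigma>\<^sub>l[\<phi> \<circ> h] dW\<^sup>l\<close>. The integrands are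
  bounded as \<open>\<lambda> < \<infinity>\<close>, so the right hand side has mean \<open>0\<close>, and \<open>h(X\<^sub>t) = p\<close> for all \<open>t\<close> almost surely.
  Both claims are then immediate, as \<open>p\<close> is not in its own cut locus.\<close>

section \<open>Smooth functions between Euclidean spaces\<close>

text \<open>The SDE is an identity for functions smooth on all of \<open>M\<close>, while the drift
  hypothesis concerns \<open>dist_sq\<close>, known to be smooth only near \<open>p\<close>.
  Truncation makes it an admissible test function, so no Ito formula is invoked: the correction term
  comes from the chain rule for \<open>G\<close>. Its sign forces concavity, because a function that
  rises from \<open>0\<close> and levels off has to bend. Two points carry the rest.
  \<open>exp_map\<close> is a definite description, and geodesics are given chart by chart with
  lowered index; so uniqueness of geodesics and invariance of their equation under chart changes
  must precede the identification of rays in the tangent space with geodesics. The Gauss lemma then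
  bounds the growth of the radius along any curve by its speed, which gives \<open>dist_sq\<close>
  near \<open>p\<close> and the positivity of distances that \<open>is_riemannian_mean\<close> asks
  for. Secondly, an Ito integral is only a limit in probability of simple integrals, so mean
  \<open>0\<close> does not pass to it by itself; the approximating processes are stopped before
  their energy exceeds a constant, which bounds the second moments without changing the
  limit.\<close>

lemma frechet_derivative_eq:
  "(f has_derivative f') (at x) \<Longrightarrow> frechet_derivative f (at x) = f'"
  by (rule frechet_derivative_at[symmetric])

text \<open>On an open set, agreeing functions agree near every point and have the same derivatives
  there. \<open>frechet_derivative\<close> is a choice among the derivatives, so the two choices
  coincide even at points where there is none.\<close>

lemma k_smooth_on_cong:
  assumes "open S" "\<And>x. x \<in> S \<Longrightarrow> f x = g x"
  shows "k_smooth_on k S f \<longleftrightarrow> k_smooth_on k S g"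
  using assms(2)
proof (induction k arbitrary: f g)
  case 0
  then show ?case using continuous_on_cong by force
next
  case (Suc k)
  have D: "(f has_derivative F) (at x) \<longleftrightarrow> (g has_derivative F) (at x)" if "x \<in> S" for x F
    using Suc.prems that assms(1) has_derivative_transform_within_open[of f F x UNIV S g]
      has_derivative_transform_within_open[of g F x UNIV S f] by auto
  then have "frechet_derivative f (at x) = frechet_derivative g (at x)" if "x \<in> S" for x
    using that unfolding frechet_derivative_def by simp
  moreover have "f differentiable (at x) \<longleftrightarrow> g differentiable (at x)" if "x \<in> S" for x
    using D that unfolding differentiable_def by blast
  ultimately show ?case
    using Suc.IH[of "\<lambda>x. frechet_derivative f (at x) v" "\<lambda>x. frechet_derivative g (at x) v" for v]
    by simp
qed

lemma k_smooth_on_subset: "k_smooth_on k S f \<Longrightarrow> T \<subseteq> S \<Longrightarrow> k_smooth_on k T f"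
  by (induction k arbitrary: f) (auto intro: continuous_on_subset)

lemma k_smooth_on_SucD: "k_smooth_on (Suc k) S f \<Longrightarrow> k_smooth_on k S f"
proof (induction k arbitrary: f)
  case 0
  then have "\<forall>x\<in>S. isCont f x"
    by (auto intro: differentiable_imp_continuous_within)
  then show ?case by (auto intro: continuous_at_imp_continuous_on)
next
  case (Suc k)
  then show ?case by (auto simp del: k_smooth_on.simps(1) simp add: k_smooth_on.simps(2))
qed

lemma k_smooth_on_add:
  assumes "open S" "k_smooth_on k S f" "k_smooth_on k S g"
  shows "k_smooth_on k S (\<lambda>x. f x + g x)"
  using assms(2,3)
proof (induction k arbitrary: f g)
  case 0
  then show ?case by (auto intro: continuous_intros)
next
  case (Suc k)
  have "frechet_derivative (\<lambda>x. f x + g x) (at x) v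
      = frechet_derivative f (at x) v + frechet_derivative g (at x) v" if "x \<in> S" for x v
    proof -
    have "((\<lambda>x. f x + g x) has_derivative
       (\<lambda>v. frechet_derivative f (at x) v + frechet_derivative g (at x) v)) (at x)"
      using Suc.prems that by (intro has_derivative_add) (auto simp: frechet_derivative_works)
    from frechet_derivative_eq[OF this] show ?thesis by simp
  qed
  then have "k_smooth_on k S (\<lambda>x. frechet_derivative (\<lambda>x. f x + g x) (at x) v)" for v
    using Suc by (subst k_smooth_on_cong[OF assms(1)]) auto
  then show ?case using Suc.prems by auto
qed

lemma k_smooth_on_const: "k_smooth_on k S (\<lambda>x. c)"
  by (induction k arbitrary: c) (auto simp: frechet_derivative_const)

lemma k_smooth_on_sum:
  assumes "open S" "\<And>i. i \<in> I \<Longrightarrow> k_smooth_on k S (f i)"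
  shows "k_smooth_on k S (\<lambda>x. \<Sum>i\<in>I. f i x)"
  using assms(2)
proof (induction I rule: infinite_finite_induct)
  case (insert i I)
  then show ?case by (simp add: k_smooth_on_add[OF assms(1)])
qed (auto simp: k_smooth_on_const)

lemma k_smooth_on_linear:
  assumes "bounded_linear f"
  shows "k_smooth_on k S f"
proof (cases k)
  case 0
  then show ?thesis using assms by (simp add: linear_continuous_on)
next
  case (Suc j)
  have "frechet_derivative f (at x) = f" for x
    by (rule frechet_derivative_eq) (rule bounded_linear_imp_has_derivative[OF assms])
  then show ?thesis using Suc assms
    by (auto simp: k_smooth_on_const bounded_linear_imp_differentiable)
qed

text \<open>By the Leibniz rule a directional derivative is a sum of two terms of the same shape, so
  the induction on \<open>k\<close> runs over all \<open>f\<close> and \<open>g\<close>. The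
  undifferentiated factor is smooth to one order more than required and is weakened by
  \<open>k_smooth_on_SucD\<close>.\<close>

lemma k_smooth_on_bilinear:
  assumes "bounded_bilinear B" "open S" "k_smooth_on k S f" "k_smooth_on k S g"
  shows "k_smooth_on k S (\<lambda>x. B (f x) (g x))"
  using assms(3,4)
proof (induction k arbitrary: f g)
  case 0
  then show ?case by (auto intro: bounded_bilinear.continuous_on[OF assms(1)])
next
  case (Suc k)
  have d: "((\<lambda>x. B (f x) (g x)) has_derivative
       (\<lambda>v. B (f x) (frechet_derivative g (at x) v) + B (frechet_derivative f (at x) v) (g x))) (at x)"
    if "x \<in> S" for x
    using Suc.prems that
    by (intro bounded_bilinear.FDERIV[OF assms(1)]) (auto simp: frechet_derivative_works)
  then have "frechet_derivative (\<lambda>x. B (f x) (g x)) (at x) v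
     = B (f x) (frechet_derivative g (at x) v) + B (frechet_derivative f (at x) v) (g x)"
    if "x \<in> S" for x v
    using frechet_derivative_eq[OF d[OF that]] by simp
  moreover have "k_smooth_on k S
     (\<lambda>x. B (f x) (frechet_derivative g (at x) v) + B (frechet_derivative f (at x) v) (g x))" for v
    using Suc.prems k_smooth_on_SucD[OF Suc.prems(1)] k_smooth_on_SucD[OF Suc.prems(2)]
    by (intro k_smooth_on_add[OF assms(2)] Suc.IH) auto
  ultimately have "k_smooth_on k S (\<lambda>x. frechet_derivative (\<lambda>x. B (f x) (g x)) (at x) v)" for v
    by (subst k_smooth_on_cong[OF assms(2)]) auto
  then show ?case using d by (auto simp: differentiable_def)
qed

text \<open>\<open>k_smooth_on\<close> speaks of derivatives in a fixed direction only, but the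
  chain rule inserts the moving direction \<open>Df(x) v\<close> into the derivative of
  \<open>g\<close>. Expanding that vector in the basis leaves products of scalar functions with
  derivatives of \<open>g\<close> in fixed directions, to which the induction hypothesis
  applies.\<close>

lemma k_smooth_on_compose:
  fixes f :: "'a::euclidean_space \<Rightarrow> 'b::euclidean_space" and g :: "'b \<Rightarrow> 'c::euclidean_space"
  assumes "open S" "open T" "k_smooth_on k S f" "k_smooth_on k T g" "f ` S \<subseteq> T"
  shows "k_smooth_on k S (\<lambda>x. g (f x))"
  using assms(3,4)
proof (induction k arbitrary: g)
  case 0
  then show ?case using assms(5) by (auto intro: continuous_on_compose2)
next
  case (Suc k)
  let ?D = "frechet_derivative"
  have d: "((\<lambda>x. g (f x)) has_derivative (\<lambda>v. ?D g (at (f x)) (?D f (at x) v))) (at x)"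
    if "x \<in> S" for x
    using Suc.prems that assms(5)
    by (intro has_derivative_compose[of f _ _ _ g]) (auto simp: frechet_derivative_works)
  have lin: "linear (?D g (at (f x)))" if "x \<in> S" for x
    using Suc.prems that assms(5) by (auto intro!: linear_frechet_derivative)
  have "?D (\<lambda>x. g (f x)) (at x) v = (\<Sum>i\<in>Basis. (?D f (at x) v \<bullet> i) *\<^sub>R ?D g (at (f x)) i)"
    if "x \<in> S" for x v
  proof -
    have "?D (\<lambda>x. g (f x)) (at x) v = ?D g (at (f x)) (?D f (at x) v)"
      using frechet_derivative_eq[OF d[OF that]] by simp
    also have "\<dots> = ?D g (at (f x)) (\<Sum>i\<in>Basis. (?D f (at x) v \<bullet> i) *\<^sub>R i)"
      by (simp add: euclidean_representation)
    finally show ?thesis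
      using lin[OF that] by (simp add: linear_sum linear_cmul)
  qed
  moreover have "k_smooth_on k S (\<lambda>x. \<Sum>i\<in>Basis. (?D f (at x) v \<bullet> i) *\<^sub>R ?D g (at (f x)) i)" for v
  proof (intro k_smooth_on_sum k_smooth_on_bilinear[OF bounded_bilinear_scaleR] assms(1))
    fix i :: 'b
    show "k_smooth_on k S (\<lambda>x. ?D f (at x) v \<bullet> i)"
      using Suc.prems
      by (intro k_smooth_on_bilinear[OF bounded_bilinear_inner] k_smooth_on_const assms(1)) auto
    show "k_smooth_on k S (\<lambda>x. ?D g (at (f x)) i)"
      using Suc.prems k_smooth_on_SucD by (intro Suc.IH) auto
  qed
  ultimately have "k_smooth_on k S (\<lambda>x. ?D (\<lambda>x. g (f x)) (at x) v)" for v
    by (subst k_smooth_on_cong[OF assms(1)]) auto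
  then show ?case using d by (auto simp: differentiable_def)
qed

lemma smooth_on_subset: "smooth_on S f \<Longrightarrow> T \<subseteq> S \<Longrightarrow> smooth_on T f"
  unfolding smooth_on_def using k_smooth_on_subset by blast

text \<open>Smoothness of the germ at \<open>x\<close>. It composes without side conditions on
  domains, and \<open>smooth_map_at\<close> amounts to it in charts
  (\<open>smooth_map_at_iff\<close>).\<close>

definition smooth_at :: "('a::euclidean_space \<Rightarrow> 'b::euclidean_space) \<Rightarrow> 'a \<Rightarrow> bool" where
  "smooth_at f x \<longleftrightarrow> (\<exists>S. open S \<and> x \<in> S \<and> smooth_on S f)"

lemma smooth_atI: "open S \<Longrightarrow> x \<in> S \<Longrightarrow> smooth_on S f \<Longrightarrow> smooth_at f x"
  unfolding smooth_at_def by blast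

lemma smooth_at_eventually: "smooth_at f x \<Longrightarrow> eventually (smooth_at f) (nhds x)"
  unfolding smooth_at_def eventually_nhds by blast

lemma smooth_at_cong:
  assumes "eventually (\<lambda>y. f y = g y) (nhds x)" "smooth_at f x"
  shows "smooth_at g x"
proof -
  obtain T where T: "open T" "x \<in> T" "\<And>y. y \<in> T \<Longrightarrow> f y = g y"
    using assms(1) unfolding eventually_nhds by blast
  obtain S where S: "open S" "x \<in> S" "smooth_on S f"
    using assms(2) unfolding smooth_at_def by blast
  have "smooth_on (S \<inter> T) f" using S smooth_on_subset by blast
  then have "smooth_on (S \<inter> T) g"
    unfolding smooth_on_def using k_smooth_on_cong[of "S \<inter> T" f g] S T by auto
  then show ?thesis using S T by (intro smooth_atI[of "S \<inter> T"]) auto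
qed

lemma smooth_at_differentiable: "smooth_at f x \<Longrightarrow> f differentiable (at x)"
  unfolding smooth_at_def smooth_on_def by (metis k_smooth_on.simps(2))

lemma smooth_at_has_derivative:
  "smooth_at f x \<Longrightarrow> (f has_derivative frechet_derivative f (at x)) (at x)"
  using smooth_at_differentiable frechet_derivative_works by blast

lemma smooth_at_isCont: "smooth_at f x \<Longrightarrow> isCont f x"
  using smooth_at_differentiable differentiable_imp_continuous_within by blast

lemma smooth_at_frechet_derivative:
  "smooth_at f x \<Longrightarrow> smooth_at (\<lambda>y. frechet_derivative f (at y) v) x"
  unfolding smooth_at_def smooth_on_def by (metis k_smooth_on.simps(2))

lemma smooth_at_const [simp]: "smooth_at (\<lambda>x. c) x"
  by (rule smooth_atI[of UNIV]) (auto simp: smooth_on_def k_smooth_on_const)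

lemma smooth_at_linear: "bounded_linear f \<Longrightarrow> smooth_at f x"
  by (rule smooth_atI[of UNIV]) (auto simp: smooth_on_def k_smooth_on_linear)

lemma smooth_at_ident [simp]: "smooth_at (\<lambda>x. x) x"
  by (rule smooth_at_linear) (rule bounded_linear_ident)

lemma smooth_at_add:
  assumes "smooth_at f x" "smooth_at g x" shows "smooth_at (\<lambda>x. f x + g x) x"
proof -
  obtain S T where "open S" "x \<in> S" "smooth_on S f" "open T" "x \<in> T" "smooth_on T g"
    using assms unfolding smooth_at_def by blast
  then show ?thesis
    by (intro smooth_atI[of "S \<inter> T"])
      (auto simp: smooth_on_def intro!: k_smooth_on_add intro: k_smooth_on_subset)
qed

lemma smooth_at_bilinear:
  assumes "bounded_bilinear B" "smooth_at f x" "smooth_at g x"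
  shows "smooth_at (\<lambda>x. B (f x) (g x)) x"
proof -
  obtain S T where "open S" "x \<in> S" "smooth_on S f" "open T" "x \<in> T" "smooth_on T g"
    using assms unfolding smooth_at_def by blast
  then show ?thesis
    by (intro smooth_atI[of "S \<inter> T"])
      (auto simp: smooth_on_def intro!: k_smooth_on_bilinear[OF assms(1)] intro: k_smooth_on_subset)
qed

lemma smooth_at_mult:
  fixes f g :: "'a::euclidean_space \<Rightarrow> real"
  shows "smooth_at f x \<Longrightarrow> smooth_at g x \<Longrightarrow> smooth_at (\<lambda>x. f x * g x) x"
  by (rule smooth_at_bilinear[OF bounded_bilinear_mult])

lemma smooth_at_inner_left: "smooth_at f x \<Longrightarrow> smooth_at (\<lambda>x. f x \<bullet> b) x"
  by (rule smooth_at_bilinear[OF bounded_bilinear_inner]) auto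

lemma smooth_at_compose:
  assumes "smooth_at f x" "smooth_at g (f x)"
  shows "smooth_at (\<lambda>x. g (f x)) x"
proof -
  obtain S where S: "open S" "x \<in> S" "smooth_on S f" using assms unfolding smooth_at_def by blast
  obtain T where T: "open T" "f x \<in> T" "smooth_on T g" using assms unfolding smooth_at_def by blast
  have "continuous_on S f" using S(3) unfolding smooth_on_def by (metis k_smooth_on.simps(1))
  then have o: "open (S \<inter> f -` T)" using S T continuous_open_preimage by metis
  have "k_smooth_on k (S \<inter> f -` T) (\<lambda>x. g (f x))" for k
  proof (rule k_smooth_on_compose[OF o T(1)])
    show "k_smooth_on k (S \<inter> f -` T) f"
      using S(3) k_smooth_on_subset unfolding smooth_on_def by blast
  qed (use T in \<open>auto simp: smooth_on_def\<close>)
  then show ?thesis using S T o by (intro smooth_atI[OF o]) (auto simp: smooth_on_def)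
qed

lemma smooth_at_uminus:
  fixes f :: "'a::euclidean_space \<Rightarrow> 'b::euclidean_space"
  shows "smooth_at f x \<Longrightarrow> smooth_at (\<lambda>x. - f x) x"
  by (rule smooth_at_compose[of f x uminus])
    (simp_all add: smooth_at_linear bounded_linear_minus[OF bounded_linear_ident])

lemma smooth_at_diff:
  fixes f :: "'a::euclidean_space \<Rightarrow> 'b::euclidean_space"
  shows "smooth_at f x \<Longrightarrow> smooth_at g x \<Longrightarrow> smooth_at (\<lambda>x. f x - g x) x"
  using smooth_at_add[of f x "\<lambda>x. - g x"] smooth_at_uminus[of g x] by simp

text \<open>For the converse, being smooth at every point of \<open>S\<close> implies continuity and
  differentiability and passes to directional derivatives, so induction on the order works although
  the neighbourhoods vary with the point.\<close>

lemma smooth_on_iff_smooth_at: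
  assumes "open S" shows "smooth_on S f \<longleftrightarrow> (\<forall>x\<in>S. smooth_at f x)"
proof
  assume "smooth_on S f" then show "\<forall>x\<in>S. smooth_at f x" using assms smooth_atI by blast
next
  assume *: "\<forall>x\<in>S. smooth_at f x"
  have "k_smooth_on k S g" if "\<forall>x\<in>S. smooth_at g x" for k and g :: "'a \<Rightarrow> 'b"
    using that
  proof (induction k arbitrary: g)
    case 0
    then show ?case by (auto intro!: continuous_at_imp_continuous_on smooth_at_isCont)
  next
    case (Suc k)
    then show ?case by (auto intro: smooth_at_differentiable smooth_at_frechet_derivative)
  qed
  then show "smooth_on S f" using * unfolding smooth_on_def by blast
qed

section \<open>Symmetry of second derivatives\<close>

lemma smooth_at_isCont_derivative:
  "smooth_at f x \<Longrightarrow> isCont (\<lambda>y. frechet_derivative f (at y) v) x"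
  by (intro smooth_at_isCont smooth_at_frechet_derivative)

text \<open>The mean value theorem twice: for the difference in direction \<open>w\<close> as a
  function of the step along \<open>v\<close>, then for the derivative along \<open>v\<close> as a
  function of the step along \<open>w\<close>. The second difference is symmetric in
  \<open>v\<close> and \<open>w\<close>, while the right hand side is one of the two mixed
  derivatives.\<close>

lemma second_difference_mvt:
  fixes f :: "'a::euclidean_space \<Rightarrow> real"
  assumes h: "0 < h"
    and sm: "\<And>s t. s \<in> {0..h} \<Longrightarrow> t \<in> {0..h} \<Longrightarrow> smooth_at f (x + s *\<^sub>R v + t *\<^sub>R w)"
  obtains s t where "s \<in> {0..h}" "t \<in> {0..h}"
    "f (x + h *\<^sub>R v + h *\<^sub>R w) - f (x + h *\<^sub>R v) - f (x + h *\<^sub>R w) + f x =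
     h * h * frechet_derivative (\<lambda>y. frechet_derivative f (at y) v) (at (x + s *\<^sub>R v + t *\<^sub>R w)) w"
proof -
  let ?D = "frechet_derivative"
  let ?g = "\<lambda>s. f (x + s *\<^sub>R v + h *\<^sub>R w) - f (x + s *\<^sub>R v)"
  let ?dg = "\<lambda>s. ?D f (at (x + s *\<^sub>R v + h *\<^sub>R w)) v - ?D f (at (x + s *\<^sub>R v)) v"
  have line: "((\<lambda>s. F (c + s *\<^sub>R u)) has_real_derivative ?D F (at (c + s *\<^sub>R u)) u) (at s)"
    if "smooth_at F (c + s *\<^sub>R u)" for F :: "'a \<Rightarrow> real" and c u s
  proof -
    have "((\<lambda>s. F (c + s *\<^sub>R u)) has_derivative (\<lambda>r. ?D F (at (c + s *\<^sub>R u)) (r *\<^sub>R u))) (at s)"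
      by (rule has_derivative_compose[where g = F and f = "\<lambda>s. c + s *\<^sub>R u" and x = s and s = UNIV,
            OF _ smooth_at_has_derivative[OF that]])
        (auto intro!: derivative_eq_intros)
    moreover have "?D F (at (c + s *\<^sub>R u)) (r *\<^sub>R u) = ?D F (at (c + s *\<^sub>R u)) u * r" for r
      using linear_frechet_derivative[OF smooth_at_differentiable[OF that]]
      by (simp add: linear_cmul)
    ultimately show ?thesis unfolding has_field_derivative_def by simp
  qed
  have d1: "(?g has_real_derivative ?dg s) (at s)" if "s \<in> {0..h}" for s
  proof -
    have "((\<lambda>s. f ((x + h *\<^sub>R w) + s *\<^sub>R v)) has_real_derivative ?D f (at ((x + h *\<^sub>R w) + s *\<^sub>R v)) v) (at s)"
      using sm[of s h] that h by (intro line) (simp add: algebra_simps)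
    moreover have "((\<lambda>s. f (x + s *\<^sub>R v)) has_real_derivative ?D f (at (x + s *\<^sub>R v)) v) (at s)"
      using sm[of s 0] that h by (intro line) simp
    ultimately show ?thesis
      by (simp add: algebra_simps DERIV_diff)
  qed
  obtain s where s: "0 < s" "s < h" "?g h - ?g 0 = (h - 0) * ?dg s"
    using MVT2[of 0 h ?g ?dg] d1 h by auto
  let ?k = "\<lambda>t. ?D f (at (x + s *\<^sub>R v + t *\<^sub>R w)) v"
  let ?dk = "\<lambda>t. ?D (\<lambda>y. ?D f (at y) v) (at (x + s *\<^sub>R v + t *\<^sub>R w)) w"
  have d2: "(?k has_real_derivative ?dk t) (at t)" if "t \<in> {0..h}" for t
    by (rule line) (use sm[of s t] that s in \<open>auto intro: smooth_at_frechet_derivative\<close>)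
  obtain t where t: "0 < t" "t < h" "?k h - ?k 0 = (h - 0) * ?dk t"
    using MVT2[of 0 h ?k ?dk] d2 h by auto
  show ?thesis
    using that[of s t] s t by (simp add: algebra_simps)
qed

text \<open>Evaluating the symmetric second difference in both orders equates the two mixed
  derivatives at two points near \<open>x\<close>; continuity of both then excludes a gap at
  \<open>x\<close>.\<close>

lemma smooth_at_symmetric_real:
  fixes f :: "'a::euclidean_space \<Rightarrow> real"
  assumes "smooth_at f x"
  shows "frechet_derivative (\<lambda>y. frechet_derivative f (at y) v) (at x) w =
         frechet_derivative (\<lambda>y. frechet_derivative f (at y) w) (at x) v"
proof -
  let ?A = "\<lambda>v w y. frechet_derivative (\<lambda>y. frechet_derivative f (at y) v) (at y) w"
  obtain S where S: "open S" "x \<in> S" "\<And>y. y \<in> S \<Longrightarrow> smooth_at f y"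
    using smooth_at_eventually[OF assms] unfolding eventually_nhds by blast
  obtain e where e: "e > 0" "ball x e \<subseteq> S" using S open_contains_ball by blast
  \<comment> \<open>A parallelogram with steps at most \<open>r\<close> stays within
    \<open>N * r\<close> of \<open>x\<close>; the summand \<open>1\<close> makes this strict and
    \<open>N\<close> positive.\<close>
  define N where "N = norm v + norm w + 1"
  have N: "N > 0" by (simp add: N_def add_nonneg_pos)
  have near: "dist (x + s *\<^sub>R v + t *\<^sub>R w) x < N * r \<and> dist (x + t *\<^sub>R w + s *\<^sub>R v) x < N * r"
    if "r > 0" "s \<in> {0..r}" "t \<in> {0..r}" for r s t
  proof -
    have "norm (s *\<^sub>R v + t *\<^sub>R w) \<le> \<bar>s\<bar> * norm v + \<bar>t\<bar> * norm w"
      by (metis norm_scaleR norm_triangle_ineq)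
    also have "\<dots> \<le> r * norm v + r * norm w"
      using that by (intro add_mono mult_right_mono) auto
    also have "\<dots> < N * r" using that by (simp add: N_def algebra_simps)
    finally show ?thesis by (simp add: dist_norm algebra_simps)
  qed
  show ?thesis
  proof (rule ccontr)
    assume ne: "?A v w x \<noteq> ?A w v x"
    \<comment> \<open>Half of the gap: two values within \<open>\<eta>\<close> of the two ends
      cannot be equal.\<close>
    define \<eta> where "\<eta> = \<bar>?A v w x - ?A w v x\<bar> / 2"
    have \<eta>: "\<eta> > 0" using ne by (simp add: \<eta>_def)
    have c: "isCont (?A v w) x" "isCont (?A w v) x"
      using assms by (auto intro!: smooth_at_isCont_derivative smooth_at_frechet_derivative)
    obtain d1 where d1: "d1 > 0" "\<And>y. dist y x < d1 \<Longrightarrow> dist (?A v w y) (?A v w x) < \<eta>"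
      using c(1) \<eta> unfolding continuous_at_eps_delta by meson
    obtain d2 where d2: "d2 > 0" "\<And>y. dist y x < d2 \<Longrightarrow> dist (?A w v y) (?A w v x) < \<eta>"
      using c(2) \<eta> unfolding continuous_at_eps_delta by meson
    define r where "r = min e (min d1 d2) / N"
    have r: "r > 0" "N * r \<le> e" "N * r \<le> d1" "N * r \<le> d2"
      using e d1 d2 N by (auto simp: r_def)
    have sm: "smooth_at f (x + s *\<^sub>R v + t *\<^sub>R w)" "smooth_at f (x + t *\<^sub>R w + s *\<^sub>R v)"
      if "s \<in> {0..r}" "t \<in> {0..r}" for s t
      using near[OF r(1) that] r e S(3) by (auto simp: subset_iff dist_commute)
    obtain s t where st: "s \<in> {0..r}" "t \<in> {0..r}"
      "f (x + r *\<^sub>R v + r *\<^sub>R w) - f (x + r *\<^sub>R v) - f (x + r *\<^sub>R w) + f x =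
       r * r * ?A v w (x + s *\<^sub>R v + t *\<^sub>R w)"
      using second_difference_mvt[OF r(1), of f x v w] sm by blast
    obtain s' t' where st': "s' \<in> {0..r}" "t' \<in> {0..r}"
      "f (x + r *\<^sub>R w + r *\<^sub>R v) - f (x + r *\<^sub>R w) - f (x + r *\<^sub>R v) + f x =
       r * r * ?A w v (x + s' *\<^sub>R w + t' *\<^sub>R v)"
      using second_difference_mvt[OF r(1), of f x w v] sm by blast
    have "r * r * ?A v w (x + s *\<^sub>R v + t *\<^sub>R w) = r * r * ?A w v (x + s' *\<^sub>R w + t' *\<^sub>R v)"
    proof -
      have *: "x + r *\<^sub>R w + r *\<^sub>R v = x + r *\<^sub>R v + r *\<^sub>R w" by (simp add: add_ac)
      show ?thesis using st(3) st'(3) unfolding * by linarith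
    qed
    then have "?A v w (x + s *\<^sub>R v + t *\<^sub>R w) = ?A w v (x + s' *\<^sub>R w + t' *\<^sub>R v)"
      using r(1) by simp
    moreover have "dist (?A v w (x + s *\<^sub>R v + t *\<^sub>R w)) (?A v w x) < \<eta>"
      using near[OF r(1) st(1,2)] r by (intro d1) linarith
    moreover have "dist (?A w v (x + s' *\<^sub>R w + t' *\<^sub>R v)) (?A w v x) < \<eta>"
      using near[OF r(1) st'(2,1)] r by (intro d2) linarith
    ultimately show False unfolding \<eta>_def dist_real_def by argo
  qed
qed

lemma frechet_derivative_inner_left:
  assumes "f differentiable (at x)"
  shows "frechet_derivative (\<lambda>y. f y \<bullet> b) (at x) v = frechet_derivative f (at x) v \<bullet> b"
proof -
  have "((\<lambda>y. f y \<bullet> b) has_derivative (\<lambda>v. frechet_derivative f (at x) v \<bullet> b)) (at x)"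
    using assms by (intro has_derivative_inner_left) (simp add: frechet_derivative_works)
  from frechet_derivative_eq[OF this] show ?thesis by simp
qed

lemma frechet_derivative_cong_eventually:
  assumes "eventually (\<lambda>y. f y = g y) (nhds x)"
  shows "frechet_derivative f (at x) = frechet_derivative g (at x)"
proof -
  obtain S where S: "open S" "x \<in> S" "\<And>y. y \<in> S \<Longrightarrow> f y = g y"
    using assms unfolding eventually_nhds by blast
  have "(f has_derivative F) (at x) \<longleftrightarrow> (g has_derivative F) (at x)" for F
    using S has_derivative_transform_within_open[of f F x UNIV S g]
      has_derivative_transform_within_open[of g F x UNIV S f] by auto
  then show ?thesis unfolding frechet_derivative_def by simp
qed

lemma smooth_at_symmetric:
  assumes "smooth_at f x"
  shows "frechet_derivative (\<lambda>y. frechet_derivative f (at y) v) (at x) w =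
         frechet_derivative (\<lambda>y. frechet_derivative f (at y) w) (at x) v"
proof (rule euclidean_eqI)
  fix b :: 'b
  have *: "frechet_derivative (\<lambda>y. frechet_derivative f (at y) v) (at x) w \<bullet> b =
     frechet_derivative (\<lambda>y. frechet_derivative (\<lambda>y. f y \<bullet> b) (at y) v) (at x) w" for v w
  proof -
    have ev: "eventually (\<lambda>y. frechet_derivative f (at y) v \<bullet> b = frechet_derivative (\<lambda>y. f y \<bullet> b) (at y) v) (nhds x)"
      using smooth_at_eventually[OF assms]
      by eventually_elim (simp add: frechet_derivative_inner_left smooth_at_differentiable)
    have "frechet_derivative (\<lambda>y. frechet_derivative f (at y) v) (at x) w \<bullet> b
       = frechet_derivative (\<lambda>y. frechet_derivative f (at y) v \<bullet> b) (at x) w"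
      using assms by (simp add: frechet_derivative_inner_left smooth_at_differentiable
          smooth_at_frechet_derivative)
    then show ?thesis using frechet_derivative_cong_eventually[OF ev] by simp
  qed
  show "frechet_derivative (\<lambda>y. frechet_derivative f (at y) v) (at x) w \<bullet> b =
        frechet_derivative (\<lambda>y. frechet_derivative f (at y) w) (at x) v \<bullet> b"
    unfolding * using assms by (intro smooth_at_symmetric_real smooth_at_inner_left)
qed


subsection \<open>A flat function\<close>

text \<open>The functions \<open>P(1/x) exp(-1/x)\<close>, extended by \<open>0\<close>, form a
  family that contains the classical flat function (\<open>P = 1\<close>) and is closed under
  differentiation, so that smoothness at \<open>0\<close> needs no formula for higher
  derivatives.\<close>

definition flat_fun :: "real poly \<Rightarrow> real \<Rightarrow> real" where
  "flat_fun P x = (if x \<le> 0 then 0 else poly P (1 / x) * exp (- (1 / x)))"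

lemma poly_times_exp_minus_tendsto_0:
  fixes P :: "real poly"
  shows "((\<lambda>y. poly P y * exp (- y)) \<longlongrightarrow> 0) at_top"
proof -
  have "((\<lambda>y. \<Sum>i\<le>degree P. coeff P i * (y ^ i / exp y)) \<longlongrightarrow> (\<Sum>i\<le>degree P. coeff P i * 0)) at_top"
    by (intro tendsto_sum tendsto_mult_left tendsto_power_div_exp_0)
  then show ?thesis
    by (simp add: poly_altdef sum_divide_distrib exp_minus field_simps)
qed

lemma flat_fun_tendsto_0: "(flat_fun P \<longlongrightarrow> 0) (at 0)"
proof -
  have "((\<lambda>x. poly P (1 / x) * exp (- (1 / x))) \<longlongrightarrow> 0) (at_right 0)"
    using filterlim_compose[OF poly_times_exp_minus_tendsto_0[of P] filterlim_inverse_at_top_right]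
    by (simp add: inverse_eq_divide)
  then have "(flat_fun P \<longlongrightarrow> 0) (at_right 0)"
    by (rule Lim_transform_eventually)
      (auto simp: flat_fun_def eventually_at_filter)
  moreover have "((\<lambda>x. 0) \<longlongrightarrow> 0) (at_left (0::real))" by simp
  then have "(flat_fun P \<longlongrightarrow> 0) (at_left 0)"
    by (rule Lim_transform_eventually)
      (auto simp: flat_fun_def eventually_at_filter)
  ultimately show ?thesis by (rule filterlim_split_at[rotated])
qed

text \<open>With \<open>y = 1/x\<close>, differentiation in \<open>x\<close> turns
  \<open>P(y) exp(-y)\<close> into \<open>y\<^sup>2 (P(y) - P'(y)) exp(-y)\<close>.\<close>

definition flat_deriv :: "real poly \<Rightarrow> real poly" where
  "flat_deriv P = [:0, 0, 1:] * (P - pderiv P)"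

lemma flat_fun_has_derivative:
  "(flat_fun P has_real_derivative flat_fun (flat_deriv P) x) (at x)"
proof -
  consider "x < 0" | "x = 0" | "x > 0" by linarith
  then show ?thesis
  proof cases
    case 1
    have "((\<lambda>x. 0) has_real_derivative 0) (at x)" by simp
    then have "(flat_fun P has_real_derivative 0) (at x)"
      by (rule has_field_derivative_transform_within_open[where S = "{..<0}"])
        (use 1 in \<open>auto simp: flat_fun_def\<close>)
    then show ?thesis using 1 by (simp add: flat_fun_def)
  next
    case 2
    \<comment> \<open>The difference quotient at \<open>0\<close> is again a flat function: division
      by \<open>h\<close> multiplies the polynomial by its variable.\<close>
    have "(flat_fun (pCons 0 P) \<longlongrightarrow> 0) (at 0)" by (rule flat_fun_tendsto_0)
    then have "((\<lambda>h. (flat_fun P (0 + h) - flat_fun P 0) / h) \<longlongrightarrow> 0) (at 0)"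
      by (rule Lim_transform_eventually) (auto simp: flat_fun_def eventually_at_filter)
    then show ?thesis using 2 by (simp add: DERIV_def flat_fun_def)
  next
    case 3
    have "((\<lambda>x. poly P (1 / x) * exp (- (1 / x))) has_real_derivative
        flat_fun (flat_deriv P) x) (at x)"
      using 3 by (auto simp: flat_fun_def flat_deriv_def power2_eq_square field_simps
          intro!: derivative_eq_intros poly_DERIV DERIV_chain2[where f = "poly P"])
    then show ?thesis
      by (rule has_field_derivative_transform_within_open[where S = "{0<..}"])
        (use 3 in \<open>auto simp: flat_fun_def\<close>)
  qed
qed

lemma smooth_at_flat_fun: "smooth_at (flat_fun P) x"
proof -
  have "k_smooth_on k UNIV (flat_fun P)" for k
  proof (induction k arbitrary: P)
    case 0
    show ?case
      by (auto intro!: continuous_at_imp_continuous_on DERIV_isCont[OF flat_fun_has_derivative])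
  next
    case (Suc k)
    have d: "(flat_fun P has_derivative (\<lambda>v. flat_fun (flat_deriv P) x * v)) (at x)" for x
      using flat_fun_has_derivative unfolding has_field_derivative_def by blast
    have "k_smooth_on k UNIV (\<lambda>x. flat_fun (flat_deriv P) x * v)" for v
      by (intro k_smooth_on_bilinear[OF bounded_bilinear_mult] Suc.IH k_smooth_on_const) simp
    then show ?case using frechet_derivative_eq[OF d] d by (auto simp: differentiable_def)
  qed
  then show ?thesis by (intro smooth_atI[of UNIV]) (auto simp: smooth_on_def)
qed

text \<open>A concave increasing function on \<open>[0,\<infinity>)\<close> that vanishes at \<open>0\<close> and is constant from \<open>\<kappa>\<close> on;
  concavity comes from the convexity of \<open>x \<mapsto> exp (-1/x)\<close> on \<open>[0,1/2]\<close>.\<close>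
definition cap :: "real \<Rightarrow> real \<Rightarrow> real" where
  "cap \<kappa> s = flat_fun 1 \<kappa> - flat_fun 1 (\<kappa> - s)"

definition cap' :: "real \<Rightarrow> real \<Rightarrow> real" where
  "cap' \<kappa> s = flat_fun (flat_deriv 1) (\<kappa> - s)"

definition cap'' :: "real \<Rightarrow> real \<Rightarrow> real" where
  "cap'' \<kappa> s = - flat_fun (flat_deriv (flat_deriv 1)) (\<kappa> - s)"

lemma cap_has_derivative: "(cap \<kappa> has_real_derivative cap' \<kappa> s) (at s)"
proof -
  have "((\<lambda>s. flat_fun 1 (\<kappa> - s)) has_real_derivative cap' \<kappa> s * (- 1)) (at s)"
    unfolding cap'_def by (rule DERIV_chain2[OF flat_fun_has_derivative]) (auto intro!: derivative_eq_intros)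
  from DERIV_diff[OF DERIV_const[of "flat_fun 1 \<kappa>"] this] show ?thesis
    unfolding cap_def by simp
qed

lemma cap'_has_derivative: "(cap' \<kappa> has_real_derivative cap'' \<kappa> s) (at s)"
proof -
  have "((\<lambda>s. flat_fun (flat_deriv 1) (\<kappa> - s)) has_real_derivative
      flat_fun (flat_deriv (flat_deriv 1)) (\<kappa> - s) * (- 1)) (at s)"
    by (rule DERIV_chain2[OF flat_fun_has_derivative]) (auto intro!: derivative_eq_intros)
  then show ?thesis unfolding cap'_def cap''_def by simp
qed

lemma smooth_at_cap: "smooth_at (cap \<kappa>) s"
  unfolding cap_def
  by (intro smooth_at_diff smooth_at_compose[of "\<lambda>s. \<kappa> - s" _ "flat_fun 1"] smooth_at_flat_fun) auto

lemma cap_0 [simp]: "cap \<kappa> 0 = 0"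
  by (simp add: cap_def)

lemma cap_pos: "0 < s \<Longrightarrow> 0 < \<kappa> \<Longrightarrow> 0 < cap \<kappa> s"
  by (auto simp: cap_def flat_fun_def field_simps)

lemma cap_const: "\<kappa> \<le> s \<Longrightarrow> cap \<kappa> s = cap \<kappa> \<kappa>"
  by (simp add: cap_def flat_fun_def)

lemma cap'_nonneg: "0 \<le> cap' \<kappa> s"
  by (auto simp: cap'_def flat_fun_def flat_deriv_def)

text \<open>In terms of \<open>y = 1/(\<kappa> - s)\<close> the derivative is
  \<open>y\<^sup>2 exp(-y)\<close>, so it is bounded independently of \<open>\<kappa>\<close>. This
  converts the noise bound into a bound for the integrands of the truncated function, at the price
  of the factor \<open>16 = 4\<^sup>2\<close>.\<close>

lemma cap'_le_4: "cap' \<kappa> s \<le> 4"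
proof -
  have *: "y\<^sup>2 * exp (- y) \<le> 4" if "0 < y" for y :: real
  proof -
    have "(1 + y / 2)\<^sup>2 \<le> (exp (y / 2))\<^sup>2"
      using that exp_ge_add_one_self[of "y / 2"] by (intro power_mono) auto
    also have "\<dots> = exp y" by (simp add: power2_eq_square flip: exp_add)
    finally have "(1 + y / 2)\<^sup>2 \<le> exp y" .
    moreover have "y\<^sup>2 \<le> 4 * (1 + y / 2)\<^sup>2"
      using that by (simp add: power2_eq_square algebra_simps)
    ultimately have "y\<^sup>2 \<le> 4 * exp y" by linarith
    then show ?thesis by (simp add: exp_minus field_simps)
  qed
  show ?thesis
    using *[of "1 / (\<kappa> - s)"]
    by (auto simp: cap'_def flat_fun_def flat_deriv_def power2_eq_square)
qed

text \<open>With \<open>y = 1/(\<kappa> - s)\<close> the second derivative is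
  \<open>- y\<^sup>3 (y - 2) exp(-y)\<close>, and for \<open>s < \<kappa>\<close> the two hypotheses
  give \<open>y \<ge> 2\<close>.\<close>

lemma cap''_nonpos:
  assumes "\<kappa> \<le> 1 / 2" "0 \<le> s"
  shows "cap'' \<kappa> s \<le> 0"
proof (cases "\<kappa> - s \<le> 0")
  case False
  define y where "y = 1 / (\<kappa> - s)"
  have "2 \<le> y" using False assms by (simp add: y_def field_simps)
  then have "0 \<le> poly (flat_deriv (flat_deriv 1)) y"
    by (simp add: flat_deriv_def pderiv_mult pderiv_pCons algebra_simps)
  then show ?thesis using False by (simp add: cap''_def flat_fun_def y_def)
qed (simp add: cap''_def flat_fun_def)

section \<open>Charts and smooth maps\<close>

locale manifold =
  fixes A :: "('m::{t2_space,second_countable_topology}, 'e::euclidean_space) atlas"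
  assumes smooth_manifold: "smooth_manifold A"
begin

lemma ex_chart: obtains c where "c \<in> A" "x \<in> fst c"
  using smooth_manifold unfolding smooth_manifold_def by blast

lemma chart_open [simp]: "c \<in> A \<Longrightarrow> open (fst c)"
  and chart_image_open [simp]: "c \<in> A \<Longrightarrow> open (snd c ` fst c)"
  and chart_inj: "c \<in> A \<Longrightarrow> inj_on (snd c) (fst c)"
  and chart_homeo: "c \<in> A \<Longrightarrow> homeomorphism (fst c) (snd c ` fst c) (snd c) (chart_inv c)"
  and transition_smooth_on: "c \<in> A \<Longrightarrow> c' \<in> A \<Longrightarrow>
    smooth_on (snd c ` (fst c \<inter> fst c')) (snd c' \<circ> chart_inv c)"
  using smooth_manifold unfolding smooth_manifold_def by blast+

lemma chart_inv_chart [simp]: "c \<in> A \<Longrightarrow> x \<in> fst c \<Longrightarrow> chart_inv c (snd c x) = x"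
  using chart_inj by (simp add: inv_into_f_f)

lemma chart_continuous: "c \<in> A \<Longrightarrow> continuous_on (fst c) (snd c)"
  and chart_inv_continuous: "c \<in> A \<Longrightarrow> continuous_on (snd c ` fst c) (chart_inv c)"
  using chart_homeo unfolding homeomorphism_def by blast+

lemma chart_isCont: "c \<in> A \<Longrightarrow> x \<in> fst c \<Longrightarrow> isCont (snd c) x"
  using chart_continuous chart_open continuous_on_eq_continuous_at by blast

lemma chart_inv_isCont: "c \<in> A \<Longrightarrow> x \<in> fst c \<Longrightarrow> isCont (chart_inv c) (snd c x)"
  using chart_inv_continuous chart_image_open continuous_on_eq_continuous_at by blast

lemma chart_image_open_subset:
  assumes "c \<in> A" "open U" "U \<subseteq> fst c"
  shows "open (snd c ` U)"
proof -
  have "snd c ` U = snd c ` fst c \<inter> chart_inv c -` U"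
    using assms by (force simp: chart_inv_chart)
  then show ?thesis
    using continuous_open_preimage[OF chart_inv_continuous[OF assms(1)] _ assms(2)] assms(1) by simp
qed

lemma eventually_chart: "c \<in> A \<Longrightarrow> x \<in> fst c \<Longrightarrow> eventually (\<lambda>y. y \<in> fst c) (nhds x)"
  using chart_open eventually_nhds_in_open by blast

lemma eventually_chart_image:
  "c \<in> A \<Longrightarrow> x \<in> fst c \<Longrightarrow> eventually (\<lambda>y. y \<in> snd c ` fst c) (nhds (snd c x))"
  using eventually_nhds_in_open[of "snd c ` fst c" "snd c x"] by auto

lemma transition_smooth_at:
  assumes "c \<in> A" "c' \<in> A" "x \<in> fst c" "x \<in> fst c'"
  shows "smooth_at (snd c' \<circ> chart_inv c) (snd c x)"
proof (rule smooth_atI)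
  show "open (snd c ` (fst c \<inter> fst c'))"
    using assms by (intro chart_image_open_subset) auto
  show "smooth_on (snd c ` (fst c \<inter> fst c')) (snd c' \<circ> chart_inv c)"
    using assms transition_smooth_on by blast
qed (use assms in auto)

lemma eventually_chart_inv:
  assumes "c \<in> A" "x \<in> fst c" "eventually P (nhds x)"
  shows "eventually (\<lambda>y. P (chart_inv c y)) (nhds (snd c x))"
proof -
  have "filterlim (chart_inv c) (nhds x) (nhds (snd c x))"
    using chart_inv_isCont[OF assms(1,2)] assms(1,2)
    by (metis chart_inv_chart continuous_at filterlim_def tendsto_at_iff_tendsto_nhds)
  then show ?thesis using assms(3) by (rule eventually_compose_filterlim[rotated])
qed

lemma eventually_chart_comp:
  assumes "c \<in> A" "x \<in> fst c" "eventually P (nhds (snd c x))"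
  shows "eventually (\<lambda>y. P (snd c y)) (nhds x)"
proof -
  have "filterlim (snd c) (nhds (snd c x)) (nhds x)"
    using chart_isCont[OF assms(1,2)] by (metis continuous_at tendsto_at_iff_tendsto_nhds)
  then show ?thesis using assms(3) by (rule eventually_compose_filterlim[rotated])
qed

end

lemma manifold_euclidean: "manifold (euclidean_atlas :: ('e::euclidean_space, 'e) atlas)"
proof
  have *: "inv_into UNIV (\<lambda>x::'e. x) = (\<lambda>x. x)" by (simp add: fun_eq_iff inv_into_f_eq)
  have "smooth_on UNIV (\<lambda>x::'e. x)" by (simp add: smooth_on_iff_smooth_at)
  then show "smooth_manifold (euclidean_atlas :: ('e, 'e) atlas)"
    unfolding smooth_manifold_def euclidean_atlas_def
    by (auto simp: * comp_def intro: homeomorphism_ident)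
qed

lemma euclidean_chart_inv [simp]: "inv_into UNIV (\<lambda>x. x) = (\<lambda>x. x)"
  by (simp add: fun_eq_iff inv_into_f_eq)

lemma filterlim_nhds_iff_isCont: "filterlim f (nhds (f x)) (nhds x) \<longleftrightarrow> isCont f x"
  by (simp add: continuous_at tendsto_at_iff_tendsto_nhds)

lemma isCont_comp: "isCont f x \<Longrightarrow> isCont g (f x) \<Longrightarrow> isCont (g \<circ> f) x"
  unfolding filterlim_nhds_iff_isCont[symmetric] comp_def by (rule filterlim_compose)

text \<open>Continuity is not written into \<open>smooth_map_at\<close>; it is recovered by
  factoring \<open>h\<close> near \<open>x\<close> through a chart, the smooth coordinate expression
  and an inverse chart.\<close>

lemma smooth_map_at_isCont:
  assumes "manifold A" "manifold B" "smooth_map_at A B x h"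
  shows "isCont h x"
proof -
  interpret A: manifold A by fact
  interpret B: manifold B by fact
  obtain c c' S where S: "c \<in> A" "c' \<in> B" "open S" "x \<in> S" "S \<subseteq> fst c" "h ` S \<subseteq> fst c'"
    "smooth_on (snd c ` S) (snd c' \<circ> h \<circ> chart_inv c)"
    using assms(3) unfolding smooth_map_at_def by blast
  let ?k = "snd c' \<circ> h \<circ> chart_inv c"
  have x: "x \<in> fst c" "h x \<in> fst c'" using S by auto
  have "open (snd c ` S)" using S A.chart_image_open_subset by blast
  then have "isCont ?k (snd c x)" using S smooth_atI smooth_at_isCont by blast
  moreover have "?k (snd c x) = snd c' (h x)" using S x by simp
  ultimately have "isCont (chart_inv c' \<circ> ?k) (snd c x)"
    using B.chart_inv_isCont[OF S(2) x(2)] isCont_comp[of "snd c x" ?k "chart_inv c'"] by argo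
  then have "isCont ((chart_inv c' \<circ> ?k) \<circ> snd c) x"
    by (rule isCont_comp[OF A.chart_isCont[OF S(1) x(1)]])
  moreover have "eventually (\<lambda>y. ((chart_inv c' \<circ> ?k) \<circ> snd c) y = h y) (nhds x)"
    using eventually_nhds_in_open[OF S(3,4)] 
  proof eventually_elim
    case (elim y)
    then have "y \<in> fst c" "h y \<in> fst c'" using S(5,6) by auto
    then show ?case using S(1,2) by simp
  qed
  ultimately show ?thesis using isCont_cong[of "(chart_inv c' \<circ> ?k) \<circ> snd c" h x] by simp
qed

text \<open>The definition asks for some pair of charts; composing with transition maps on both
  sides shows that every pair will do. The first conjunct has to be stated: a chart map has
  arbitrary values outside its domain, so a smooth coordinate expression alone does not keep
  \<open>h\<close> inside \<open>fst c'\<close>.\<close>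

lemma smooth_map_at_iff:
  assumes "manifold A" "manifold B" "c \<in> A" "x \<in> fst c" "c' \<in> B" "h x \<in> fst c'"
  shows "smooth_map_at A B x h \<longleftrightarrow>
    eventually (\<lambda>y. h y \<in> fst c') (nhds x) \<and> smooth_at (snd c' \<circ> h \<circ> chart_inv c) (snd c x)"
    (is "?L \<longleftrightarrow> ?R")
proof
  interpret A: manifold A by fact
  interpret B: manifold B by fact
  {
    assume L: ?L
    have "isCont h x" using L assms smooth_map_at_isCont by blast
    then have *: "filterlim h (nhds (h x)) (nhds x)" by (simp add: filterlim_nhds_iff_isCont)
    obtain c1 c1' S where S: "c1 \<in> A" "c1' \<in> B" "open S" "x \<in> S" "S \<subseteq> fst c1" "h ` S \<subseteq> fst c1'"
      "smooth_on (snd c1 ` S) (snd c1' \<circ> h \<circ> chart_inv c1)"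
      using L unfolding smooth_map_at_def by blast
    have x: "x \<in> fst c1" "h x \<in> fst c1'" using S by auto
    have ev: "eventually (\<lambda>y. h y \<in> fst c') (nhds x)"
      using * B.eventually_chart[OF assms(5,6)] by (rule eventually_compose_filterlim[rotated])
    have s1: "smooth_at (snd c1 \<circ> chart_inv c) (snd c x)"
      using A.transition_smooth_at[of c c1 x] assms(3,4) S(1) x(1) by blast
    have s2: "smooth_at (snd c1' \<circ> h \<circ> chart_inv c1) ((snd c1 \<circ> chart_inv c) (snd c x))"
      using smooth_atI[OF A.chart_image_open_subset[OF S(1,3,5)] _ S(7)] S(4) assms(3,4) by simp
    have s3: "smooth_at (snd c' \<circ> chart_inv c1')
        ((snd c1' \<circ> h \<circ> chart_inv c1) ((snd c1 \<circ> chart_inv c) (snd c x)))"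
      using B.transition_smooth_at[of c1' c' "h x"] assms S(1,2) x by simp
    have "smooth_at (\<lambda>y. (snd c' \<circ> chart_inv c1') ((snd c1' \<circ> h \<circ> chart_inv c1) 
        ((snd c1 \<circ> chart_inv c) y))) (snd c x)"
      using smooth_at_compose[OF smooth_at_compose[OF s1 s2] s3] .
    moreover have "eventually (\<lambda>y. y \<in> S) (nhds x)" using S(3,4) eventually_nhds_in_open by blast
    then have "eventually (\<lambda>y. chart_inv c y \<in> S) (nhds (snd c x))"
      using A.eventually_chart_inv[OF assms(3,4), of "\<lambda>y. y \<in> S"] by blast
    then have "eventually (\<lambda>y. (snd c' \<circ> chart_inv c1') ((snd c1' \<circ> h \<circ> chart_inv c1) 
        ((snd c1 \<circ> chart_inv c) y)) = (snd c' \<circ> h \<circ> chart_inv c) y) (nhds (snd c x))"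
    proof eventually_elim
      case (elim y)
      then have "chart_inv c y \<in> fst c1" "h (chart_inv c y) \<in> fst c1'" using S(5,6) by auto
      then show ?case using S(1,2) by simp
    qed
    ultimately have "smooth_at (snd c' \<circ> h \<circ> chart_inv c) (snd c x)"
      by (rule smooth_at_cong[rotated])
    then show ?R using ev by blast
  }
  assume R: ?R
  obtain T where T: "open T" "snd c x \<in> T" "smooth_on T (snd c' \<circ> h \<circ> chart_inv c)"
    using R unfolding smooth_at_def by blast
  have "eventually (\<lambda>y. h y \<in> fst c' \<and> y \<in> fst c \<and> snd c y \<in> T) (nhds x)"
    using R A.eventually_chart[OF assms(3,4)]
      A.eventually_chart_comp[OF assms(3,4) eventually_nhds_in_open[OF T(1,2)]]
    by (auto intro: eventually_conj)
  then obtain S where S: "open S" "x \<in> S" "\<And>y. y \<in> S \<Longrightarrow> h y \<in> fst c' \<and> y \<in> fst c \<and> snd c y \<in> T"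
    unfolding eventually_nhds by blast
  have "smooth_on (snd c ` S) (snd c' \<circ> h \<circ> chart_inv c)"
    by (rule smooth_on_subset[OF T(3)]) (use S in auto)
  then show ?L unfolding smooth_map_at_def using S assms by blast
qed

lemma smooth_map_at_compose:
  assumes "manifold A" "manifold B" "manifold C"
    and "smooth_map_at A B x h" "smooth_map_at B C (h x) k"
  shows "smooth_map_at A C x (\<lambda>y. k (h y))"
proof -
  interpret A: manifold A by fact
  interpret B: manifold B by fact
  interpret C: manifold C by fact
  obtain c where c: "c \<in> A" "x \<in> fst c" using A.ex_chart by blast
  obtain c' where c': "c' \<in> B" "h x \<in> fst c'" using B.ex_chart by blast
  obtain c'' where c'': "c'' \<in> C" "k (h x) \<in> fst c''" using C.ex_chart by blast
  have h: "eventually (\<lambda>y. h y \<in> fst c') (nhds x)" "smooth_at (snd c' \<circ> h \<circ> chart_inv c) (snd c x)"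
    using assms(4) smooth_map_at_iff[where h = h, OF assms(1,2) c c'] by blast+
  have k: "eventually (\<lambda>y. k y \<in> fst c'') (nhds (h x))"
     "smooth_at (snd c'' \<circ> k \<circ> chart_inv c') (snd c' (h x))"
    using assms(5) smooth_map_at_iff[where h = k, OF assms(2,3) c' c''] by blast+
  have "isCont h x" using smooth_map_at_isCont assms by blast
  then have "eventually (\<lambda>y. k (h y) \<in> fst c'') (nhds x)"
    using k(1) by (auto simp flip: filterlim_nhds_iff_isCont intro: eventually_compose_filterlim)
  moreover have "smooth_at (\<lambda>y. (snd c'' \<circ> k \<circ> chart_inv c') ((snd c' \<circ> h \<circ> chart_inv c) y)) (snd c x)"
    by (rule smooth_at_compose[OF h(2)]) (use k(2) c in \<open>simp add: comp_def\<close>)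
  then have "smooth_at (snd c'' \<circ> (\<lambda>y. k (h y)) \<circ> chart_inv c) (snd c x)"
  proof (rule smooth_at_cong[rotated])
    show "\<forall>\<^sub>F y in nhds (snd c x). (snd c'' \<circ> k \<circ> chart_inv c') ((snd c' \<circ> h \<circ> chart_inv c) y)
       = (snd c'' \<circ> (\<lambda>y. k (h y)) \<circ> chart_inv c) y"
      using A.eventually_chart_inv[OF c h(1)] by eventually_elim (use c' in simp)
  qed
  ultimately show ?thesis using smooth_map_at_iff[where h = "\<lambda>y. k (h y)", OF assms(1,3) c c''] by blast
qed

context manifold
begin

lemma smooth_fun_at_iff:
  assumes "c \<in> A" "x \<in> fst c"
  shows "smooth_fun_at A x f \<longleftrightarrow> smooth_at (f \<circ> chart_inv c) (snd c x)"
proof -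
  have E: "(UNIV, \<lambda>x. x) \<in> (euclidean_atlas :: (real, real) atlas)" by (simp add: euclidean_atlas_def)
  have "(\<lambda>x. x) \<circ> f = f" by (simp add: fun_eq_iff)
  then show ?thesis
    using smooth_map_at_iff[where h = f, OF manifold_axioms manifold_euclidean assms E]
    unfolding smooth_fun_at_def by simp
qed

lemma smooth_fun_at_real_compose:
  assumes "smooth_fun_at A x f" "smooth_at \<psi> (f x)"
  shows "smooth_fun_at A x (\<lambda>y. \<psi> (f y))"
proof -
  obtain c where c: "c \<in> A" "x \<in> fst c" using ex_chart by blast
  have "smooth_at (\<lambda>y. \<psi> ((f \<circ> chart_inv c) y)) (snd c x)"
    by (rule smooth_at_compose[where f = "f \<circ> chart_inv c"])
      (use assms c smooth_fun_at_iff[OF c] in auto)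
  then show ?thesis using smooth_fun_at_iff[OF c] by (simp add: comp_def)
qed

lemma smooth_fun_at_cong:
  assumes "smooth_fun_at A x f" "eventually (\<lambda>y. f y = f' y) (nhds x)"
  shows "smooth_fun_at A x f'"
proof -
  obtain c where c: "c \<in> A" "x \<in> fst c" using ex_chart by blast
  have "eventually (\<lambda>y. (f \<circ> chart_inv c) y = (f' \<circ> chart_inv c) y) (nhds (snd c x))"
    using eventually_chart_inv[OF c assms(2)] by simp
  then show ?thesis using assms(1) smooth_at_cong smooth_fun_at_iff[OF c] by blast
qed

lemma smooth_fun_at_const: "smooth_fun_at A x (\<lambda>y. k)"
proof -
  obtain c where c: "c \<in> A" "x \<in> fst c" using ex_chart by blast
  then show ?thesis using smooth_fun_at_iff[OF c] by (simp add: comp_def)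
qed

lemma smooth_fun_at_chart:
  assumes "c \<in> A" "x \<in> fst c"
  shows "smooth_fun_at A x (\<lambda>y. snd c y \<bullet> b)"
proof -
  have "smooth_at ((\<lambda>y. snd c y \<bullet> b) \<circ> chart_inv c) (snd c x)"
  proof (rule smooth_at_cong)
    show "\<forall>\<^sub>F y in nhds (snd c x). y \<bullet> b = ((\<lambda>y. snd c y \<bullet> b) \<circ> chart_inv c) y"
      using eventually_chart_image[OF assms] by eventually_elim (auto simp: f_inv_into_f)
  qed (auto intro: smooth_at_inner_left)
  then show ?thesis using smooth_fun_at_iff[OF assms] by blast
qed

subsection \<open>Tangent vectors\<close>

lemma coord_vec_eq:
  assumes "c \<in> A" "x \<in> fst c"
  shows "coord_vec A c x a f =
    (if smooth_fun_at A x f then frechet_derivative (f \<circ> chart_inv c) (at (snd c x)) a else 0)"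
proof (cases "smooth_fun_at A x f")
  case True
  let ?D = "frechet_derivative (f \<circ> chart_inv c) (at (snd c x))"
  have "smooth_at (f \<circ> chart_inv c) (snd c x)" using True smooth_fun_at_iff[OF assms] by blast
  then have lin: "linear ?D" using smooth_at_differentiable linear_frechet_derivative by blast
  have "?D a = ?D (\<Sum>i\<in>Basis. (a \<bullet> i) *\<^sub>R i)" by (simp add: euclidean_representation)
  also have "\<dots> = (\<Sum>i\<in>Basis. (a \<bullet> i) * ?D i)" using lin by (simp add: linear_sum linear_cmul)
  finally show ?thesis using True by (simp add: coord_vec_def coord_op_def partial1_def)
qed (simp add: coord_vec_def coord_op_def)

lemma coord_vec_linear:
  "coord_vec A c x (k *\<^sub>R u + v) = (\<lambda>f. k * coord_vec A c x u f + coord_vec A c x v f)"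
proof
  fix f
  show "coord_vec A c x (k *\<^sub>R u + v) f = k * coord_vec A c x u f + coord_vec A c x v f"
    by (simp add: coord_vec_def coord_op_def inner_add_left distrib_right
      sum.distrib sum_distrib_left mult.assoc)
qed

text \<open>Evaluation at the coordinate functions reads off the components. These are smooth only
  near \<open>x\<close>, which suffices because operators act on locally smooth functions.\<close>

lemma coord_vec_inject:
  assumes "c \<in> A" "x \<in> fst c" "coord_vec A c x u = coord_vec A c x v"
  shows "u = v"
proof (rule euclidean_eqI)
  fix b :: 'e
  have "coord_vec A c x w (\<lambda>y. snd c y \<bullet> b) = w \<bullet> b" for w
  proof -
    have ev: "eventually (\<lambda>y. ((\<lambda>y. snd c y \<bullet> b) \<circ> chart_inv c) y = y \<bullet> b) (nhds (snd c x))"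
      using eventually_chart_image[OF assms(1,2)] by eventually_elim (auto simp: f_inv_into_f)
    have "((\<lambda>y. y \<bullet> b) has_derivative (\<lambda>v. v \<bullet> b)) (at (snd c x))"
      by (auto intro!: derivative_eq_intros)
    then show ?thesis
      unfolding coord_vec_eq[OF assms(1,2)] frechet_derivative_cong_eventually[OF ev]
      using smooth_fun_at_chart[OF assms(1,2)] by (simp add: frechet_derivative_eq)
  qed
  then show "u \<bullet> b = v \<bullet> b" using assms(3) by metis
qed

lemma coord_vec_in_tangent_space: "c \<in> A \<Longrightarrow> x \<in> fst c \<Longrightarrow> coord_vec A c x v \<in> tangent_space A x"
  unfolding tangent_space_def by blast

lemma coord_vec_change:
  assumes "c \<in> A" "x \<in> fst c" "c' \<in> A" "x \<in> fst c'"
  shows "coord_vec A c x v =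
    coord_vec A c' x (frechet_derivative (snd c' \<circ> chart_inv c) (at (snd c x)) v)"
proof
  fix f
  let ?T = "snd c' \<circ> chart_inv c"
  show "coord_vec A c x v f = coord_vec A c' x (frechet_derivative ?T (at (snd c x)) v) f"
  proof (cases "smooth_fun_at A x f")
    case True
    have "((\<lambda>y. (f \<circ> chart_inv c') (?T y)) has_derivative
       (\<lambda>w. frechet_derivative (f \<circ> chart_inv c') (at (?T (snd c x)))
          (frechet_derivative ?T (at (snd c x)) w))) (at (snd c x))"
      by (rule has_derivative_compose[of ?T _ _ UNIV "f \<circ> chart_inv c'"])
        (use True smooth_fun_at_iff[OF assms(3,4)] transition_smooth_at[OF assms(1,3,2,4)] assms
          in \<open>auto simp: comp_def intro!: smooth_at_has_derivative\<close>)
    moreover have ev: "eventually (\<lambda>y. (f \<circ> chart_inv c') (?T y) = (f \<circ> chart_inv c) y) (nhds (snd c x))"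
      using eventually_chart_inv[OF assms(1,2) eventually_chart[OF assms(3,4)]]
      by eventually_elim (use assms in auto)
    ultimately have "frechet_derivative (f \<circ> chart_inv c) (at (snd c x)) v =
        frechet_derivative (f \<circ> chart_inv c') (at (?T (snd c x))) (frechet_derivative ?T (at (snd c x)) v)"
      unfolding frechet_derivative_cong_eventually[OF ev, symmetric] by (simp add: frechet_derivative_eq)
    then show ?thesis using True assms by (simp add: coord_vec_eq)
  qed (simp add: coord_vec_def coord_op_def)
qed

text \<open>\<open>velocity\<close> is defined through \<open>deriv\<close> and
  \<open>coord_vec\<close> through partial derivatives. The chain rule relates them on smooth
  functions, and on all others both are \<open>0\<close> by convention.\<close>

lemma velocity_eq:
  assumes "c \<in> A" "\<gamma> t \<in> fst c"
    and ev: "eventually (\<lambda>s. \<gamma> s \<in> fst c) (nhds t)"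
    and d: "((snd c \<circ> \<gamma>) has_vector_derivative y') (at t)"
  shows "velocity A \<gamma> t = coord_vec A c (\<gamma> t) y'"
proof
  fix f
  show "velocity A \<gamma> t f = coord_vec A c (\<gamma> t) y' f"
  proof (cases "smooth_fun_at A (\<gamma> t) f")
    case True
    have s: "smooth_at (f \<circ> chart_inv c) (snd c (\<gamma> t))" using True smooth_fun_at_iff assms(1,2) by blast
    have "((\<lambda>s. (f \<circ> chart_inv c) ((snd c \<circ> \<gamma>) s)) has_derivative
        (\<lambda>r. frechet_derivative (f \<circ> chart_inv c) (at (snd c (\<gamma> t))) (r *\<^sub>R y'))) (at t)"
      using d unfolding has_vector_derivative_def
      by (rule has_derivative_compose) (use smooth_at_has_derivative[OF s] in \<open>simp add: comp_def\<close>)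
    moreover have "frechet_derivative (f \<circ> chart_inv c) (at (snd c (\<gamma> t))) (r *\<^sub>R y')
       = frechet_derivative (f \<circ> chart_inv c) (at (snd c (\<gamma> t))) y' * r" for r
      using linear_frechet_derivative[OF smooth_at_differentiable[OF s]] by (simp add: linear_cmul)
    ultimately have "((\<lambda>s. (f \<circ> chart_inv c) ((snd c \<circ> \<gamma>) s)) has_real_derivative
         frechet_derivative (f \<circ> chart_inv c) (at (snd c (\<gamma> t))) y') (at t)"
      unfolding has_field_derivative_def by simp
    moreover have "eventually (\<lambda>s. (f \<circ> chart_inv c) ((snd c \<circ> \<gamma>) s) = f (\<gamma> s)) (nhds t)"
      using ev by eventually_elim (use assms(1) in simp)
    from this DERIV_cong_ev[OF refl this refl] calculation have "((\<lambda>s. f (\<gamma> s)) has_real_derivative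
         frechet_derivative (f \<circ> chart_inv c) (at (snd c (\<gamma> t))) y') (at t)"
      by blast
    then show ?thesis using True assms(1,2) by (simp add: velocity_def coord_vec_eq DERIV_imp_deriv)
  next
    case False
    then show ?thesis by (simp add: velocity_def coord_vec_def coord_op_def)
  qed
qed

end

section \<open>Metrics and geodesics in coordinates\<close>

lemma linear_basis_sum:
  fixes f :: "'e::euclidean_space \<Rightarrow> real"
  assumes "linear f" shows "f v = (\<Sum>i\<in>Basis. (v \<bullet> i) * f i)"
proof -
  have "f v = f (\<Sum>i\<in>Basis. (v \<bullet> i) *\<^sub>R i)" by (simp add: euclidean_representation)
  then show ?thesis using assms by (simp add: linear_sum linear_cmul)
qed

text \<open>This and the bilinear and trilinear analogues turn bounds for finitely many coefficients
  into bounds uniform in the vectors. The crude constant, a sum over the basis, is good enough for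
  the estimates on balls below.\<close>

lemma linear_bound_basis:
  fixes f :: "'e::euclidean_space \<Rightarrow> real"
  assumes "linear f" "\<And>i. i \<in> Basis \<Longrightarrow> \<bar>f i\<bar> \<le> b i"
  shows "\<bar>f v\<bar> \<le> (\<Sum>i\<in>Basis. b i) * norm v"
proof -
  have "\<bar>f v\<bar> \<le> (\<Sum>i\<in>Basis. \<bar>(v \<bullet> i) * f i\<bar>)"
    unfolding linear_basis_sum[OF assms(1), of v] by (rule sum_abs)
  also have "\<dots> \<le> (\<Sum>i\<in>Basis. b i * norm v)"
  proof (rule sum_mono)
    fix i :: 'e assume "i \<in> Basis"
    then have "\<bar>v \<bullet> i\<bar> * \<bar>f i\<bar> \<le> norm v * b i"
      using assms(2) Basis_le_norm[of i v] by (intro mult_mono) auto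
    then show "\<bar>(v \<bullet> i) * f i\<bar> \<le> b i * norm v" by (simp add: abs_mult mult.commute)
  qed
  finally show ?thesis by (simp add: sum_distrib_right)
qed

lemma bilinear_bound_basis:
  fixes f :: "'e::euclidean_space \<Rightarrow> 'e \<Rightarrow> real"
  assumes "\<And>w. linear (\<lambda>v. f v w)" "\<And>v. linear (f v)"
    "\<And>i j. i \<in> Basis \<Longrightarrow> j \<in> Basis \<Longrightarrow> \<bar>f i j\<bar> \<le> b i j"
  shows "\<bar>f v w\<bar> \<le> (\<Sum>i\<in>Basis. \<Sum>j\<in>Basis. b i j) * norm v * norm w"
proof -
  have "\<bar>f v w\<bar> \<le> (\<Sum>i\<in>Basis. (\<Sum>j\<in>Basis. b i j) * norm w) * norm v"
    by (intro linear_bound_basis[OF assms(1)] linear_bound_basis[OF assms(2)] assms(3))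
  then show ?thesis unfolding sum_distrib_right[symmetric] by (simp add: mult_ac)
qed

lemma trilinear_bound_basis:
  fixes f :: "'e::euclidean_space \<Rightarrow> 'e \<Rightarrow> 'e \<Rightarrow> real"
  assumes "\<And>v w. linear (\<lambda>u. f u v w)" "\<And>u w. linear (\<lambda>v. f u v w)" "\<And>u v. linear (f u v)"
    "\<And>i j k. i \<in> Basis \<Longrightarrow> j \<in> Basis \<Longrightarrow> k \<in> Basis \<Longrightarrow> \<bar>f i j k\<bar> \<le> b i j k"
  shows "\<bar>f u v w\<bar> \<le> (\<Sum>i\<in>Basis. \<Sum>j\<in>Basis. \<Sum>k\<in>Basis. b i j k) * norm u * norm v * norm w"
proof -
  have "\<bar>f u v w\<bar> \<le> (\<Sum>i\<in>Basis. (\<Sum>j\<in>Basis. \<Sum>k\<in>Basis. b i j k) * norm v * norm w) * norm u"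
    by (intro linear_bound_basis[OF assms(1)] bilinear_bound_basis[OF assms(2,3)] assms(4))
  then show ?thesis unfolding sum_distrib_right[symmetric] by (simp add: mult_ac)
qed

text \<open>The basis components of the derivative are bounded on the compact ball, and convexity
  admits the mean value inequality.\<close>

lemma smooth_lipschitz_cball:
  fixes f :: "'e::euclidean_space \<Rightarrow> real"
  assumes "\<And>y. y \<in> cball y0 r \<Longrightarrow> smooth_at f y"
  obtains L where "L \<ge> 0" "\<And>y z. y \<in> cball y0 r \<Longrightarrow> z \<in> cball y0 r \<Longrightarrow> \<bar>f y - f z\<bar> \<le> L * norm (y - z)"
proof -
  have "\<exists>b. \<forall>y\<in>cball y0 r. \<bar>frechet_derivative f (at y) i\<bar> \<le> b" for i
  proof -
    have "continuous_on (cball y0 r) (\<lambda>y. frechet_derivative f (at y) i)"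
      using assms by (intro continuous_at_imp_continuous_on ballI smooth_at_isCont_derivative)
    then have "compact ((\<lambda>y. frechet_derivative f (at y) i) ` cball y0 r)"
      by (intro compact_continuous_image compact_cball)
    then obtain b where "\<forall>z\<in>(\<lambda>y. frechet_derivative f (at y) i) ` cball y0 r. norm z \<le> b"
      using compact_imp_bounded bounded_iff by metis
    then show ?thesis by auto
  qed
  then obtain b where b: "\<And>i y. y \<in> cball y0 r \<Longrightarrow> \<bar>frechet_derivative f (at y) i\<bar> \<le> b i" by metis
  define L where "L = (\<Sum>i\<in>Basis. \<bar>b i\<bar>)"
  have d: "onorm (frechet_derivative f (at y)) \<le> L" if "y \<in> cball y0 r" for y
  proof (rule onorm_bound)
    have lin: "linear (frechet_derivative f (at y))"
      using assms[OF that] smooth_at_differentiable linear_frechet_derivative by blast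
    show "norm (frechet_derivative f (at y) x) \<le> L * norm x" for x
      unfolding L_def real_norm_def
      by (rule linear_bound_basis[OF lin]) (use b[OF that] in \<open>meson abs_ge_self order_trans\<close>)
  qed (simp add: L_def sum_nonneg)
  show ?thesis
  proof (rule that)
    show "L \<ge> 0" by (simp add: L_def sum_nonneg)
    fix y z assume "y \<in> cball y0 r" "z \<in> cball y0 r"
    then have "norm (f y - f z) \<le> L * norm (y - z)"
      using assms d
      by (intro differentiable_bound[OF convex_cball, of y0 r f "\<lambda>y. frechet_derivative f (at y)"])
        (auto intro: has_derivative_at_withinI smooth_at_has_derivative)
    then show "\<bar>f y - f z\<bar> \<le> L * norm (y - z)" by simp
  qed
qed

text \<open>A Riemannian metric written in one chart: a smooth field of inner products over an open
  subset of the model space. Uniqueness of geodesics and the Gauss lemma rest on computations at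
  this level, where vectors at different points can be compared.\<close>

locale metric_field =
  fixes \<Omega> :: "'e::euclidean_space set" and m :: "'e \<Rightarrow> 'e \<Rightarrow> 'e \<Rightarrow> real"
  assumes open_dom: "open \<Omega>"
    and sym: "y \<in> \<Omega> \<Longrightarrow> m y v w = m y w v"
    and left_linear: "y \<in> \<Omega> \<Longrightarrow> m y (k *\<^sub>R u + v) w = k * m y u w + m y v w"
    and pos: "y \<in> \<Omega> \<Longrightarrow> v \<noteq> 0 \<Longrightarrow> 0 < m y v v"
    and smooth: "y \<in> \<Omega> \<Longrightarrow> smooth_at (\<lambda>y. m y v w) y"
begin

lemma linear_left: "y \<in> \<Omega> \<Longrightarrow> linear (\<lambda>v. m y v w)"
  using left_linear[of y 1] left_linear[of y _ _ 0] left_linear[of y 1 0 0]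
  by (intro linearI) auto

lemma linear_right: "y \<in> \<Omega> \<Longrightarrow> linear (m y v)"
  using linear_left[of y v] sym[of y v] by presburger

lemma bounded_bilinear: "y \<in> \<Omega> \<Longrightarrow> bounded_bilinear (m y)"
  unfolding bilinear_conv_bounded_bilinear[symmetric] bilinear_def
  using linear_left linear_right by blast

lemma expand:
  assumes "y \<in> \<Omega>"
  shows "m y v w = (\<Sum>i\<in>Basis. \<Sum>j\<in>Basis. (v \<bullet> i) * (w \<bullet> j) * m y i j)"
proof -
  have "m y v w = (\<Sum>i\<in>Basis. (v \<bullet> i) * (\<Sum>j\<in>Basis. (w \<bullet> j) * m y i j))"
    unfolding linear_basis_sum[OF linear_left[OF assms], of v w]
    by (intro sum.cong refl arg_cong2[where f = "(*)"] linear_basis_sum linear_right assms)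
  then show ?thesis by (simp add: sum_distrib_left mult.assoc)
qed

lemma nonneg: "y \<in> \<Omega> \<Longrightarrow> 0 \<le> m y v v"
  using pos[of y v] linear_0[OF linear_left[of y 0]] by (cases "v = 0") auto

definition dm :: "'e \<Rightarrow> 'e \<Rightarrow> 'e \<Rightarrow> 'e \<Rightarrow> real" where
  "dm y u v w = frechet_derivative (\<lambda>z. m z v w) (at y) u"

definition chr :: "'e \<Rightarrow> 'e \<Rightarrow> 'e \<Rightarrow> 'e \<Rightarrow> real" where
  "chr y u v w = (dm y u v w + dm y v u w - dm y w u v) / 2"

lemma eventually_dom: "y \<in> \<Omega> \<Longrightarrow> eventually (\<lambda>z. z \<in> \<Omega>) (nhds y)"
  using open_dom eventually_nhds_in_open by blast

lemma dm_has_derivative: "y \<in> \<Omega> \<Longrightarrow> ((\<lambda>z. m z v w) has_derivative (\<lambda>u. dm y u v w)) (at y)"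
  unfolding dm_def using smooth_at_has_derivative[OF smooth] by simp

lemma dm_sym: assumes "y \<in> \<Omega>" shows "dm y u v w = dm y u w v"
proof -
  have "eventually (\<lambda>z. m z v w = m z w v) (nhds y)"
    using eventually_dom[OF assms] by eventually_elim (rule sym)
  then show ?thesis unfolding dm_def by (simp add: frechet_derivative_cong_eventually)
qed

lemma dm_linear1: "y \<in> \<Omega> \<Longrightarrow> linear (\<lambda>u. dm y u v w)"
  using dm_has_derivative has_derivative_linear by blast

lemma dm_linear2: assumes "y \<in> \<Omega>" shows "linear (\<lambda>v. dm y u v w)"
proof -
  have *: "dm y u (k *\<^sub>R v + v') w = k * dm y u v w + dm y u v' w" for k v v'
  proof -
    have ev: "eventually (\<lambda>z. m z (k *\<^sub>R v + v') w = k * m z v w + m z v' w) (nhds y)"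
      using eventually_dom[OF assms] by eventually_elim (rule left_linear)
    have "((\<lambda>z. k * m z v w + m z v' w) has_derivative (\<lambda>u. k * dm y u v w + dm y u v' w)) (at y)"
      using assms by (intro derivative_intros dm_has_derivative)
    then show ?thesis
      using frechet_derivative_cong_eventually[OF ev] by (simp add: dm_def frechet_derivative_eq)
  qed
  show ?thesis using *[of 1] *[of _ _ 0] *[of 1 0 0] by (intro linearI) auto
qed

lemma dm_linear3: "y \<in> \<Omega> \<Longrightarrow> linear (\<lambda>w. dm y u v w)"
  using dm_linear2[of y u v] dm_sym[of y u v] by presburger

lemma chr_linear1: "y \<in> \<Omega> \<Longrightarrow> linear (\<lambda>u. chr y u v w)"
  and chr_linear2: "y \<in> \<Omega> \<Longrightarrow> linear (\<lambda>v. chr y u v w)"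
  and chr_linear3: "y \<in> \<Omega> \<Longrightarrow> linear (\<lambda>w. chr y u v w)"
  by (auto intro!: linearI simp: chr_def linear_add[OF dm_linear1] linear_add[OF dm_linear2]
      linear_add[OF dm_linear3] linear_cmul[OF dm_linear1] linear_cmul[OF dm_linear2]
      linear_cmul[OF dm_linear3] field_simps)

lemma dm_smooth: "y \<in> \<Omega> \<Longrightarrow> smooth_at (\<lambda>y. dm y u v w) y"
  unfolding dm_def by (intro smooth_at_frechet_derivative smooth)

lemma chr_smooth: "y \<in> \<Omega> \<Longrightarrow> smooth_at (\<lambda>y. chr y u v w) y"
  unfolding chr_def divide_inverse
  by (intro smooth_at_mult smooth_at_diff smooth_at_add dm_smooth smooth_at_const)

text \<open>Smoothness of \<open>m\<close> is known for fixed vectors only, so the form is expanded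
  into the coefficients \<open>m y i j\<close> before the product rule is applied, and reassembled
  by linearity of \<open>dm\<close>.\<close>

lemma has_derivative_along:
  assumes y: "(y has_vector_derivative y') (at t)" "y t \<in> \<Omega>"
    and v: "(v has_vector_derivative v') (at t)" and w: "(w has_vector_derivative w') (at t)"
  shows "((\<lambda>s. m (y s) (v s) (w s)) has_real_derivative
    dm (y t) y' (v t) (w t) + m (y t) v' (w t) + m (y t) (v t) w') (at t)"
proof -
  have comp: "((\<lambda>s. m (y s) a b) has_real_derivative dm (y t) y' a b) (at t)" for a b
  proof -
    have "((\<lambda>s. m (y s) a b) has_derivative (\<lambda>r. dm (y t) (r *\<^sub>R y') a b)) (at t)"
      using y(1) unfolding has_vector_derivative_def
      by (rule has_derivative_compose[where f = y and g = "\<lambda>z. m z a b" and x = t and s = UNIV,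
            OF _ dm_has_derivative[OF y(2)]])
    moreover have "(\<lambda>r. dm (y t) (r *\<^sub>R y') a b) = (*) (dm (y t) y' a b)"
      using linear_cmul[OF dm_linear1[OF y(2)]] by (simp add: fun_eq_iff mult.commute)
    ultimately show ?thesis by (simp add: has_field_derivative_def)
  qed
  have inn: "((\<lambda>s. f s \<bullet> i) has_real_derivative f' \<bullet> i) (at t)"
    if "(f has_vector_derivative f') (at t)" for f f' and i :: 'e
    using bounded_linear.has_vector_derivative[OF bounded_linear_inner_left that, of i]
    by (simp add: has_real_derivative_iff_has_vector_derivative)
  let ?D = "\<Sum>i\<in>Basis. \<Sum>j\<in>Basis. (v t \<bullet> i) * (w t \<bullet> j) * dm (y t) y' i j +
     (v' \<bullet> i) * (w t \<bullet> j) * m (y t) i j + (v t \<bullet> i) * (w' \<bullet> j) * m (y t) i j"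
  have d: "((\<lambda>s. \<Sum>i\<in>Basis. \<Sum>j\<in>Basis. (v s \<bullet> i) * (w s \<bullet> j) * m (y s) i j) has_real_derivative ?D) (at t)"
    by (intro DERIV_sum) (auto intro!: derivative_eq_intros comp inn[OF v] inn[OF w] simp: algebra_simps)
  have "isCont y t" using y(1) has_vector_derivative_continuous by blast
  then have "eventually (\<lambda>s. y s \<in> \<Omega>) (nhds t)"
    using eventually_dom[OF y(2)] filterlim_nhds_iff_isCont[of y t] eventually_compose_filterlim by blast
  then have ev: "eventually (\<lambda>s. (\<Sum>i\<in>Basis. \<Sum>j\<in>Basis. (v s \<bullet> i) * (w s \<bullet> j) * m (y s) i j) = m (y s) (v s) (w s)) (nhds t)"
    by eventually_elim (simp add: expand)
  have "dm (y t) y' (v t) (w t) = (\<Sum>i\<in>Basis. \<Sum>j\<in>Basis. (v t \<bullet> i) * (w t \<bullet> j) * dm (y t) y' i j)"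
  proof -
    have "dm (y t) y' (v t) (w t) = (\<Sum>i\<in>Basis. (v t \<bullet> i) * (\<Sum>j\<in>Basis. (w t \<bullet> j) * dm (y t) y' i j))"
      unfolding linear_basis_sum[OF dm_linear2[OF y(2)], of y' "v t"]
      by (intro sum.cong refl arg_cong2[where f = "(*)"] linear_basis_sum dm_linear3 y)
    then show ?thesis by (simp add: sum_distrib_left mult.assoc)
  qed
  then have "?D = dm (y t) y' (v t) (w t) + m (y t) v' (w t) + m (y t) (v t) w'"
    using expand[OF y(2), of v' "w t"] expand[OF y(2), of "v t" w'] by (simp add: sum.distrib)
  then show ?thesis using d DERIV_cong_ev[OF refl ev refl] by simp
qed

lemma lower_bound:
  assumes "cball y0 r \<subseteq> \<Omega>" "0 \<le> r"
  obtains l where "l > 0" "\<And>y v. y \<in> cball y0 r \<Longrightarrow> l * (norm v)\<^sup>2 \<le> m y v v"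
proof -
  let ?K = "cball y0 r \<times> sphere (0::'e) 1"
  have cont: "continuous_on ?K (\<lambda>(y, v). m y v v)"
  proof -
    have "continuous_on ?K (\<lambda>z. m (fst z) i j)" for i j
    proof (rule continuous_on_compose2[of "cball y0 r" "\<lambda>y. m y i j"])
      show "continuous_on (cball y0 r) (\<lambda>y. m y i j)"
        using assms(1) smooth by (auto intro!: continuous_at_imp_continuous_on smooth_at_isCont)
    qed (auto intro: continuous_intros)
    then have "continuous_on ?K (\<lambda>z. \<Sum>i\<in>Basis. \<Sum>j\<in>Basis. (snd z \<bullet> i) * (snd z \<bullet> j) * m (fst z) i j)"
      by (intro continuous_intros)
    then show ?thesis
      by (rule continuous_on_cong[THEN iffD1, rotated -1]) (use assms(1) in \<open>auto simp: expand[symmetric] subset_iff\<close>)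
  qed
  obtain i :: 'e where "i \<in> Basis" using nonempty_Basis by blast
  then have ne: "?K \<noteq> {}" using assms(2) by (auto intro: exI[of _ i])
  obtain z where z: "z \<in> ?K" "\<And>y. y \<in> ?K \<Longrightarrow> (\<lambda>(y, v). m y v v) z \<le> (\<lambda>(y, v). m y v v) y"
    using continuous_attains_inf[OF _ ne cont] compact_Times[OF compact_cball compact_sphere] by blast
  define l where "l = m (fst z) (snd z) (snd z)"
  show ?thesis
  proof (rule that)
    show "l > 0" using z(1) assms(1) unfolding l_def by (intro pos) auto
    fix y v assume y: "y \<in> cball y0 r"
    then have y': "y \<in> \<Omega>" using assms by blast
    show "l * (norm v)\<^sup>2 \<le> m y v v"
    proof (cases "v = 0")
      case True then show ?thesis using nonneg[OF y'] by simp
    next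
      case False
      let ?u = "(1 / norm v) *\<^sub>R v"
      have "l \<le> m y ?u ?u" using z(2)[of "(y, ?u)"] y False by (simp add: l_def split_beta)
      moreover have "m y v v = (norm v)\<^sup>2 * m y ?u ?u"
        using False linear_cmul[OF linear_left[OF y']] linear_cmul[OF linear_right[OF y']]
        by (simp add: power2_eq_square)
      ultimately show ?thesis
        using mult_right_mono[of l "m y ?u ?u" "(norm v)\<^sup>2"] by (simp add: mult.commute)
    qed
  qed
qed

text \<open>A single constant serves all three estimates. The size of \<open>chr\<close> on the ball
  comes from its value at the centre and its Lipschitz bound.\<close>

lemma lipschitz:
  assumes "cball y0 r \<subseteq> \<Omega>"
  obtains C where "C \<ge> 0"
    "\<And>y z v w. y \<in> cball y0 r \<Longrightarrow> z \<in> cball y0 r \<Longrightarrow>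
       \<bar>m y v w - m z v w\<bar> \<le> C * norm (y - z) * norm v * norm w"
    "\<And>y z u v w. y \<in> cball y0 r \<Longrightarrow> z \<in> cball y0 r \<Longrightarrow>
       \<bar>chr y u v w - chr z u v w\<bar> \<le> C * norm (y - z) * norm u * norm v * norm w"
    "\<And>y u v w. y \<in> cball y0 r \<Longrightarrow> \<bar>chr y u v w\<bar> \<le> C * norm u * norm v * norm w"
proof -
  have "\<exists>L. L \<ge> 0 \<and> (\<forall>y z. y \<in> cball y0 r \<longrightarrow> z \<in> cball y0 r \<longrightarrow> \<bar>m y i j - m z i j\<bar> \<le> L * norm (y - z))" for i j
    using smooth_lipschitz_cball[of y0 r "\<lambda>y. m y i j"] smooth assms by (metis subsetD)
  then obtain L where L: "\<And>i j. L i j \<ge> 0" "\<And>i j y z. y \<in> cball y0 r \<Longrightarrow> z \<in> cball y0 r \<Longrightarrow> \<bar>m y i j - m z i j\<bar> \<le> L i j * norm (y - z)"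
    by metis
  have "\<exists>L. L \<ge> 0 \<and> (\<forall>y z. y \<in> cball y0 r \<longrightarrow> z \<in> cball y0 r \<longrightarrow> \<bar>chr y i j k - chr z i j k\<bar> \<le> L * norm (y - z))" for i j k
    using smooth_lipschitz_cball[of y0 r "\<lambda>y. chr y i j k"] chr_smooth assms by (metis subsetD)
  then obtain L' where L': "\<And>i j k. L' i j k \<ge> 0"
    "\<And>i j k y z. y \<in> cball y0 r \<Longrightarrow> z \<in> cball y0 r \<Longrightarrow> \<bar>chr y i j k - chr z i j k\<bar> \<le> L' i j k * norm (y - z)"
    by metis
  define C1 where "C1 = (\<Sum>i\<in>Basis. \<Sum>j\<in>Basis. L i j)"
  define C2 where "C2 = (\<Sum>i\<in>Basis. \<Sum>j\<in>Basis. \<Sum>k\<in>Basis. L' i j k)"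
  define C3 where "C3 = (\<Sum>i\<in>Basis. \<Sum>j\<in>Basis. \<Sum>k\<in>Basis. \<bar>chr y0 i j k\<bar> + L' i j k * r)"
  define C where "C = max C1 (max C2 \<bar>C3\<bar>)"
  have C1: "0 \<le> C1" unfolding C1_def using L by (intro sum_nonneg) auto
  have in\<Omega>: "y \<in> \<Omega>" if "y \<in> cball y0 r" for y using assms that by blast
  show ?thesis
  proof (rule that[of C])
    show "C \<ge> 0" using C1 by (simp add: C_def)
  next
    fix y z v w assume yz: "y \<in> cball y0 r" "z \<in> cball y0 r"
    have "\<bar>m y v w - m z v w\<bar> \<le> (\<Sum>i\<in>Basis. \<Sum>j\<in>Basis. L i j * norm (y - z)) * norm v * norm w"
      using linear_left linear_right in\<Omega> yz L(2)
      by (intro bilinear_bound_basis[of "\<lambda>v w. m y v w - m z v w"] linear_compose_sub) auto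
    also have "\<dots> = C1 * (norm (y - z) * norm v * norm w)"
      unfolding C1_def sum_distrib_right[symmetric] by (simp add: mult_ac)
    also have "\<dots> \<le> C * (norm (y - z) * norm v * norm w)"
      by (intro mult_right_mono) (auto simp: C_def)
    finally show "\<bar>m y v w - m z v w\<bar> \<le> C * norm (y - z) * norm v * norm w" by (simp add: mult_ac)
  next
    fix y z u v w assume yz: "y \<in> cball y0 r" "z \<in> cball y0 r"
    have "\<bar>chr y u v w - chr z u v w\<bar> \<le> (\<Sum>i\<in>Basis. \<Sum>j\<in>Basis. \<Sum>k\<in>Basis. L' i j k * norm (y - z)) * norm u * norm v * norm w"
      using chr_linear1 chr_linear2 chr_linear3 in\<Omega> yz L'(2)
      by (intro trilinear_bound_basis[of "\<lambda>u v w. chr y u v w - chr z u v w"] linear_compose_sub) auto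
    also have "\<dots> = C2 * (norm (y - z) * norm u * norm v * norm w)"
      unfolding C2_def sum_distrib_right[symmetric] by (simp add: mult_ac)
    also have "\<dots> \<le> C * (norm (y - z) * norm u * norm v * norm w)"
      by (intro mult_right_mono) (auto simp: C_def)
    finally show "\<bar>chr y u v w - chr z u v w\<bar> \<le> C * norm (y - z) * norm u * norm v * norm w"
      by (simp add: mult_ac)
  next
    fix y u v w assume y: "y \<in> cball y0 r"
    have r: "0 \<le> r" using y by (metis cball_eq_empty empty_iff not_le)
    have "\<bar>chr y i j k\<bar> \<le> \<bar>chr y0 i j k\<bar> + L' i j k * r" for i j k
    proof -
      have "L' i j k * norm (y - y0) \<le> L' i j k * r"
        using y L'(1) by (intro mult_left_mono) (auto simp: dist_norm norm_minus_commute)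
      then show ?thesis using L'(2)[OF y, of y0 i j k] r by simp
    qed
    then have "\<bar>chr y u v w\<bar> \<le> C3 * norm u * norm v * norm w"
      unfolding C3_def using chr_linear1 chr_linear2 chr_linear3 in\<Omega>[OF y]
      by (intro trilinear_bound_basis[of "\<lambda>u v w. chr y u v w"]) auto
    also have "\<dots> = C3 * (norm u * norm v * norm w)" by (simp add: mult_ac)
    also have "\<dots> \<le> C * (norm u * norm v * norm w)"
      by (intro mult_right_mono) (auto simp: C_def)
    finally show "\<bar>chr y u v w\<bar> \<le> C * norm u * norm v * norm w" by (simp add: mult_ac)
  qed
qed

text \<open>Gronwall's argument for the squared difference of positions and velocities. The equation
  has a lowered index and is not solved for the acceleration, so the difference of the accelerations
  is estimated by testing both equations with that difference and using the lower bound of the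
  metric.\<close>

lemma geodesic_local_unique:
  assumes e: "0 < e" and init: "y1 t0 = y2 t0" "v1 t0 = v2 t0" "y1 t0 \<in> \<Omega>"
    and d: "\<And>s. s \<in> {t0..t0 + e} \<Longrightarrow> (y1 has_vector_derivative v1 s) (at s)"
      "\<And>s. s \<in> {t0..t0 + e} \<Longrightarrow> (y2 has_vector_derivative v2 s) (at s)"
      "\<And>s. s \<in> {t0..t0 + e} \<Longrightarrow> (v1 has_vector_derivative a1 s) (at s)"
      "\<And>s. s \<in> {t0..t0 + e} \<Longrightarrow> (v2 has_vector_derivative a2 s) (at s)"
    and eq: "\<And>s w. s \<in> {t0..t0 + e} \<Longrightarrow> m (y1 s) (a1 s) w + chr (y1 s) (v1 s) (v1 s) w = 0"
      "\<And>s w. s \<in> {t0..t0 + e} \<Longrightarrow> m (y2 s) (a2 s) w + chr (y2 s) (v2 s) (v2 s) w = 0"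
  shows "\<exists>e'>0. e' \<le> e \<and> (\<forall>s\<in>{t0..t0 + e'}. y1 s = y2 s)"
proof -
  obtain r where r: "r > 0" "cball (y1 t0) r \<subseteq> \<Omega>"
    using open_dom init(3) open_contains_cball by blast
  \<comment> \<open>A bound for both speeds on a short interval: they start equal and change by at
    most \<open>1\<close>.\<close>
  define B where "B = norm (v1 t0) + 1"
  have B: "B > 0" by (simp add: B_def add_nonneg_pos)
  obtain l where l: "l > 0" "\<And>y v. y \<in> cball (y1 t0) r \<Longrightarrow> l * (norm v)\<^sup>2 \<le> m y v v"
    using lower_bound[OF r(2)] r(1) by (metis less_imp_le)
  obtain C where C: "C \<ge> 0"
    "\<And>y z v w. y \<in> cball (y1 t0) r \<Longrightarrow> z \<in> cball (y1 t0) r \<Longrightarrow>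
       \<bar>m y v w - m z v w\<bar> \<le> C * norm (y - z) * norm v * norm w"
    "\<And>y z u v w. y \<in> cball (y1 t0) r \<Longrightarrow> z \<in> cball (y1 t0) r \<Longrightarrow>
       \<bar>chr y u v w - chr z u v w\<bar> \<le> C * norm (y - z) * norm u * norm v * norm w"
    "\<And>y u v w. y \<in> cball (y1 t0) r \<Longrightarrow> \<bar>chr y u v w\<bar> \<le> C * norm u * norm v * norm w"
    using lipschitz[OF r(2)] by metis
  have near: "\<exists>d>0. \<forall>s. \<bar>s - t0\<bar> < d \<longrightarrow> norm (f s - f t0) \<le> \<rho>"
    if "(f has_vector_derivative f') (at t0)" "\<rho> > 0" for f f' and \<rho> :: real
  proof -
    have "isCont f t0" using that(1) has_vector_derivative_continuous by blast
    then show ?thesis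
      using that(2) unfolding continuous_at_eps_delta dist_norm real_norm_def by (meson less_imp_le)
  qed
  have t0: "t0 \<in> {t0..t0 + e}" using e by simp
  obtain d1 where d1: "d1 > 0" "\<And>s. \<bar>s - t0\<bar> < d1 \<Longrightarrow> norm (y1 s - y1 t0) \<le> r"
    using near[OF d(1)[OF t0] r(1)] by blast
  obtain d2 where d2: "d2 > 0" "\<And>s. \<bar>s - t0\<bar> < d2 \<Longrightarrow> norm (y2 s - y2 t0) \<le> r"
    using near[OF d(2)[OF t0] r(1)] by blast
  obtain d3 where d3: "d3 > 0" "\<And>s. \<bar>s - t0\<bar> < d3 \<Longrightarrow> norm (v1 s - v1 t0) \<le> 1"
    using near[OF d(3)[OF t0] zero_less_one] by blast
  obtain d4 where d4: "d4 > 0" "\<And>s. \<bar>s - t0\<bar> < d4 \<Longrightarrow> norm (v2 s - v2 t0) \<le> 1"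
    using near[OF d(4)[OF t0] zero_less_one] by blast
  define e' where "e' = min e (min (min d1 d2) (min d3 d4) / 2)"
  have e': "0 < e'" "e' \<le> e" using e d1 d2 d3 d4 by (auto simp: e'_def)
  have bd: "y1 s \<in> cball (y1 t0) r" "y2 s \<in> cball (y1 t0) r" "norm (v1 s) \<le> B" "norm (v2 s) \<le> B"
    if "s \<in> {t0..t0 + e'}" for s
  proof -
    have s: "\<bar>s - t0\<bar> < d1" "\<bar>s - t0\<bar> < d2" "\<bar>s - t0\<bar> < d3" "\<bar>s - t0\<bar> < d4"
      using that d1(1) d2(1) d3(1) d4(1) by (auto simp: e'_def)
    show "y1 s \<in> cball (y1 t0) r" "y2 s \<in> cball (y1 t0) r"
      using d1(2)[OF s(1)] d2(2)[OF s(2)] init by (auto simp: dist_norm norm_minus_commute)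
    show "norm (v1 s) \<le> B" "norm (v2 s) \<le> B"
      using d3(2)[OF s(3)] d4(2)[OF s(4)] init norm_triangle_sub[of "v1 s" "v1 t0"]
        norm_triangle_sub[of "v2 s" "v2 t0"] by (auto simp: B_def)
  qed
  \<comment> \<open>The numerator collects the variation of \<open>chr\<close> with the position,
    its dependence on the two velocity slots, and the variation of \<open>m\<close> with the
    position. The inner \<open>C * B\<^sup>2 / l\<close> bounds the acceleration of the second
    geodesic; the outer division by \<open>l\<close> is the lower bound of the metric.\<close>
  define K where "K = (C * B\<^sup>2 + 2 * C * B + C * (C * B\<^sup>2 / l)) / l"
  have K: "K \<ge> 0" using C(1) B l(1) by (simp add: K_def)
  have acc: "norm (a1 s - a2 s) \<le> K * (norm (y1 s - y2 s) + norm (v1 s - v2 s))"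
    if s: "s \<in> {t0..t0 + e'}" for s
  proof -
    have s': "s \<in> {t0..t0 + e}" using s e' by auto
    have in\<Omega>: "y1 s \<in> \<Omega>" "y2 s \<in> \<Omega>" using bd[OF s] r by auto
    let ?w = "a1 s - a2 s" and ?dy = "norm (y1 s - y2 s)" and ?dv = "norm (v1 s - v2 s)"
    have a2: "norm (a2 s) \<le> C * B\<^sup>2 / l"
    proof (cases "a2 s = 0")
      case False
      have "l * (norm (a2 s))\<^sup>2 \<le> m (y2 s) (a2 s) (a2 s)" by (rule l(2)[OF bd(2)[OF s]])
      also have "\<dots> \<le> \<bar>chr (y2 s) (v2 s) (v2 s) (a2 s)\<bar>" using eq(2)[OF s', of "a2 s"] by linarith
      also have "\<dots> \<le> C * norm (v2 s) * norm (v2 s) * norm (a2 s)" by (rule C(4)[OF bd(2)[OF s]])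
      also have "\<dots> \<le> C * B * B * norm (a2 s)"
        using bd(4)[OF s] C(1) B by (intro mult_right_mono mult_mono) auto
      finally have "(l * norm (a2 s)) * norm (a2 s) \<le> (C * B\<^sup>2) * norm (a2 s)"
        by (simp add: power2_eq_square mult_ac)
      then have "l * norm (a2 s) \<le> C * B\<^sup>2" using False by simp
      then show ?thesis using l(1) by (simp add: field_simps)
    qed (use C(1) l(1) in simp)
    have "l * (norm ?w)\<^sup>2 \<le> m (y1 s) ?w ?w" by (rule l(2)[OF bd(1)[OF s]])
    also have "\<dots> = m (y1 s) (a1 s) ?w - m (y1 s) (a2 s) ?w"
      using linear_diff[OF linear_left[OF in\<Omega>(1)]] by simp
    \<comment> \<open>One argument is changed at a time, so that each bracket falls under one of the
      estimates with the constant \<open>C\<close>.\<close>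
    also have "\<dots> = (chr (y2 s) (v2 s) (v2 s) ?w - chr (y1 s) (v2 s) (v2 s) ?w)
        - (chr (y1 s) (v1 s) (v1 s) ?w - chr (y1 s) (v2 s) (v1 s) ?w)
        - (chr (y1 s) (v2 s) (v1 s) ?w - chr (y1 s) (v2 s) (v2 s) ?w)
        + (m (y2 s) (a2 s) ?w - m (y1 s) (a2 s) ?w)"
      using eq(1)[OF s', of ?w] eq(2)[OF s', of ?w] by linarith
    also have "\<dots> = (chr (y2 s) (v2 s) (v2 s) ?w - chr (y1 s) (v2 s) (v2 s) ?w)
        - chr (y1 s) (v1 s - v2 s) (v1 s) ?w - chr (y1 s) (v2 s) (v1 s - v2 s) ?w
        + (m (y2 s) (a2 s) ?w - m (y1 s) (a2 s) ?w)"
      using linear_diff[OF chr_linear1[OF in\<Omega>(1)]] linear_diff[OF chr_linear2[OF in\<Omega>(1)]] by simp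
    also have "\<dots> \<le> C * ?dy * norm (v2 s) * norm (v2 s) * norm ?w
       + C * ?dv * norm (v1 s) * norm ?w + C * norm (v2 s) * ?dv * norm ?w
       + C * ?dy * norm (a2 s) * norm ?w"
      using C(3)[OF bd(2,1)[OF s], of "v2 s" "v2 s" ?w] C(4)[OF bd(1)[OF s], of "v1 s - v2 s" "v1 s" ?w]
        C(4)[OF bd(1)[OF s], of "v2 s" "v1 s - v2 s" ?w] C(2)[OF bd(2,1)[OF s], of "a2 s" ?w]
      by (simp add: norm_minus_commute[of "y2 s"])
    also have "\<dots> \<le> C * ?dy * B * B * norm ?w + C * ?dv * B * norm ?w + C * B * ?dv * norm ?w
       + C * ?dy * (C * B\<^sup>2 / l) * norm ?w"
      using bd(3,4)[OF s] a2 C(1) B by (intro add_mono mult_right_mono mult_left_mono mult_mono) auto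
    also have "\<dots> = ((C * B\<^sup>2 + C * (C * B\<^sup>2 / l)) * ?dy + 2 * C * B * ?dv) * norm ?w"
      by (simp add: algebra_simps power2_eq_square)
    also have "\<dots> \<le> (l * K * (?dy + ?dv)) * norm ?w"
    proof (rule mult_right_mono)
      have "l * K = C * B\<^sup>2 + 2 * C * B + C * (C * B\<^sup>2 / l)" using l(1) by (simp add: K_def)
      moreover have "0 \<le> 2 * C * B * ?dy" "0 \<le> (C * B\<^sup>2 + C * (C * B\<^sup>2 / l)) * ?dv"
        using C(1) B l(1) by auto
      ultimately show "(C * B\<^sup>2 + C * (C * B\<^sup>2 / l)) * ?dy + 2 * C * B * ?dv \<le> l * K * (?dy + ?dv)"
        by (simp add: algebra_simps)
    qed simp
    finally have "norm ?w * (l * norm ?w) \<le> norm ?w * (l * (K * (?dy + ?dv)))"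
      by (simp add: power2_eq_square mult_ac)
    then show ?thesis using l(1) K by (cases "?w = 0") auto
  qed
  let ?u = "\<lambda>s. (y1 s - y2 s) \<bullet> (y1 s - y2 s) + (v1 s - v2 s) \<bullet> (v1 s - v2 s)"
  \<comment> \<open>Relative to the sum of the two squares, \<open>1\<close> absorbs twice the
    product of the position and velocity differences, and \<open>3 * K\<close> absorbs twice that of
    the velocity and acceleration differences. With the weight \<open>exp (- M * (s - t0))\<close>
    the quantity therefore cannot increase from its initial value \<open>0\<close>.\<close>
  define M where "M = 1 + 3 * K"
  have "y1 s = y2 s" if s: "s \<in> {t0..t0 + e'}" for s
  proof -
    have "?u s * exp (- M * (s - t0)) \<le> ?u t0 * exp (- M * (t0 - t0))"
    proof (rule DERIV_nonpos_imp_nonincreasing[of t0 s])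
      show "t0 \<le> s" using s by simp
      fix x assume x: "t0 \<le> x" "x \<le> s"
      then have x': "x \<in> {t0..t0 + e'}" "x \<in> {t0..t0 + e}" using s e' by auto
      let ?dy = "y1 x - y2 x" and ?dv = "v1 x - v2 x" and ?da = "a1 x - a2 x"
      have v1: "((\<lambda>s. y1 s - y2 s) has_vector_derivative ?dv) (at x)"
        "((\<lambda>s. v1 s - v2 s) has_vector_derivative ?da) (at x)"
        using d x'(2) by (auto intro!: has_vector_derivative_diff)
      have sq: "((\<lambda>s. f s \<bullet> f s) has_real_derivative 2 * (f x \<bullet> f')) (at x)"
        if "(f has_vector_derivative f') (at x)" for f f'
        using bounded_bilinear.has_vector_derivative[OF bounded_bilinear_inner that that]
        by (simp add: has_real_derivative_iff_has_vector_derivative inner_commute)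
      have du: "(?u has_real_derivative 2 * (?dy \<bullet> ?dv) + 2 * (?dv \<bullet> ?da)) (at x)"
        using DERIV_add[OF sq[OF v1(1)] sq[OF v1(2)]] .
      have de: "((\<lambda>s. exp (- M * (s - t0))) has_real_derivative exp (- M * (x - t0)) * (- M)) (at x)"
        by (auto intro!: derivative_eq_intros)
      have "((\<lambda>s. ?u s * exp (- M * (s - t0))) has_real_derivative
         (2 * (?dy \<bullet> ?dv) + 2 * (?dv \<bullet> ?da)) * exp (- M * (x - t0))
          + exp (- M * (x - t0)) * (- M) * ?u x) (at x)"
        by (rule DERIV_mult[OF du de])
      moreover have "(2 * (?dy \<bullet> ?dv) + 2 * (?dv \<bullet> ?da)) * exp (- M * (x - t0))
          + exp (- M * (x - t0)) * (- M) * ?u x \<le> 0"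
      proof -
        let ?N = "(norm ?dy)\<^sup>2 + (norm ?dv)\<^sup>2"
        have 1: "?dy \<bullet> ?dv \<le> norm ?dy * norm ?dv" by (rule norm_cauchy_schwarz)
        have 2: "?dv \<bullet> ?da \<le> norm ?dv * (K * (norm ?dy + norm ?dv))"
          using norm_cauchy_schwarz[of ?dv ?da] mult_left_mono[OF acc[OF x'(1)], of "norm ?dv"]
          by simp
        have 3: "2 * (norm ?dy * norm ?dv) \<le> ?N"
          using sum_squares_bound[of "norm ?dy" "norm ?dv"] by (simp add: mult.assoc)
        have 4: "2 * (norm ?dv * (K * (norm ?dy + norm ?dv)))
            = K * (2 * (norm ?dy * norm ?dv) + 2 * (norm ?dv)\<^sup>2)"
          by (simp add: algebra_simps power2_eq_square)
        have 5: "\<dots> \<le> K * (3 * ?N)"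
        proof (rule mult_left_mono[OF _ K])
          have "2 * p \<le> q + r \<Longrightarrow> 0 \<le> q \<Longrightarrow> 2 * p + 2 * r \<le> 3 * (q + r)" for p q r :: real by argo
          from this[OF 3 zero_le_power2]
          show "2 * (norm ?dy * norm ?dv) + 2 * (norm ?dv)\<^sup>2 \<le> 3 * ?N" .
        qed
        have 6: "M * ?u x = ?N + K * (3 * ?N)"
          by (simp add: M_def algebra_simps power2_norm_eq_inner)
        have "A \<le> P \<Longrightarrow> B \<le> Q \<Longrightarrow> 2 * P \<le> N \<Longrightarrow> 2 * Q = R \<Longrightarrow> R \<le> R' \<Longrightarrow> U = N + R' \<Longrightarrow>
          2 * A + 2 * B - U \<le> 0" for A B P Q N R R' U :: real by linarith
        from this[OF 1 2 3 4 5 6]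
        have "2 * (?dy \<bullet> ?dv) + 2 * (?dv \<bullet> ?da) - M * ?u x \<le> 0" .
        then have "exp (- M * (x - t0)) * (2 * (?dy \<bullet> ?dv) + 2 * (?dv \<bullet> ?da) - M * ?u x) \<le> 0"
          by (simp add: mult_nonneg_nonpos)
        then show ?thesis by (simp add: algebra_simps)
      qed
      ultimately show "\<exists>y. ((\<lambda>s. ?u s * exp (- M * (s - t0))) has_real_derivative y) (at x) \<and> y \<le> 0"
        by blast
    qed
    then have "?u s \<le> 0" using init by (simp add: mult_le_0_iff)
    moreover have "0 \<le> (y1 s - y2 s) \<bullet> (y1 s - y2 s)" "0 \<le> (v1 s - v2 s) \<bullet> (v1 s - v2 s)" by auto
    ultimately have "(y1 s - y2 s) \<bullet> (y1 s - y2 s) = 0" by linarith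
    then show ?thesis by simp
  qed
  then show ?thesis using e' by blast
qed

end

section \<open>Change of coordinates for curves and for the geodesic equation\<close>

lemma has_vector_derivative_smooth_compose:
  assumes "(y has_vector_derivative v) (at s)" "smooth_at T (y s)"
  shows "((\<lambda>s. T (y s)) has_vector_derivative frechet_derivative T (at (y s)) v) (at s)"
proof -
  have "((\<lambda>s. T (y s)) has_derivative (\<lambda>r. frechet_derivative T (at (y s)) (r *\<^sub>R v))) (at s)"
    using assms(1) unfolding has_vector_derivative_def
    by (rule has_derivative_compose[where f = y and g = T and x = s and s = UNIV,
          OF _ smooth_at_has_derivative[OF assms(2)]])
  then show ?thesis
    using linear_cmul[OF linear_frechet_derivative[OF smooth_at_differentiable[OF assms(2)]]]
    by (simp add: has_vector_derivative_def)
qed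

lemma frechet_derivative_basis_sum:
  assumes "f differentiable (at x)"
  shows "frechet_derivative f (at x) v = (\<Sum>i\<in>Basis. (v \<bullet> i) *\<^sub>R frechet_derivative f (at x) i)"
proof -
  have "frechet_derivative f (at x) v = frechet_derivative f (at x) (\<Sum>i\<in>Basis. (v \<bullet> i) *\<^sub>R i)"
    by (simp add: euclidean_representation)
  then show ?thesis using linear_frechet_derivative[OF assms] by (simp add: linear_sum linear_cmul)
qed

text \<open>The second derivative of \<open>T\<close> enters because the base point moves.
  Differentiability is available only for derivatives in fixed directions, hence the expansion of
  \<open>v s\<close> in the basis.\<close>

lemma has_vector_derivative_frechet_along:
  assumes y: "(y has_vector_derivative y') (at t)" and v: "(v has_vector_derivative a) (at t)"
    and T: "smooth_at T (y t)"
  shows "((\<lambda>s. frechet_derivative T (at (y s)) (v s)) has_vector_derivative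
     frechet_derivative T (at (y t)) a
       + frechet_derivative (\<lambda>z. frechet_derivative T (at z) (v t)) (at (y t)) y') (at t)"
proof -
  let ?D = "\<lambda>z. frechet_derivative T (at z)"
  let ?D2 = "\<lambda>i. frechet_derivative (\<lambda>z. ?D z i) (at (y t)) y'"
  have "isCont y t" using y has_vector_derivative_continuous by blast
  then have ev: "eventually (\<lambda>s. smooth_at T (y s)) (nhds t)"
    using smooth_at_eventually[OF T] filterlim_nhds_iff_isCont[of y t] eventually_compose_filterlim by blast
  have inn: "((\<lambda>s. v s \<bullet> i) has_vector_derivative a \<bullet> i) (at t)" for i
    by (rule bounded_linear.has_vector_derivative[OF bounded_linear_inner_left v])
  have summand: "((\<lambda>s. (v s \<bullet> i) *\<^sub>R ?D (y s) i) has_vector_derivative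
      (v t \<bullet> i) *\<^sub>R ?D2 i + (a \<bullet> i) *\<^sub>R ?D (y t) i) (at t)" for i
    by (rule bounded_bilinear.has_vector_derivative[OF bounded_bilinear_scaleR inn
          has_vector_derivative_smooth_compose[OF y smooth_at_frechet_derivative[OF T]]])
  have d: "((\<lambda>s. \<Sum>i\<in>Basis. (v s \<bullet> i) *\<^sub>R ?D (y s) i) has_vector_derivative
     (\<Sum>i\<in>Basis. (v t \<bullet> i) *\<^sub>R ?D2 i + (a \<bullet> i) *\<^sub>R ?D (y t) i)) (at t)"
    by (rule has_vector_derivative_sum) (rule summand)
  have e: "eventually (\<lambda>s. (\<Sum>i\<in>Basis. (v s \<bullet> i) *\<^sub>R ?D (y s) i) = ?D (y s) (v s)) (nhds t)"
    using ev
  proof eventually_elim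
    case (elim s)
    show ?case by (rule frechet_derivative_basis_sum[symmetric]) (rule smooth_at_differentiable[OF elim])
  qed
  have D2: "frechet_derivative (\<lambda>z. ?D z (v t)) (at (y t)) y' = (\<Sum>i\<in>Basis. (v t \<bullet> i) *\<^sub>R ?D2 i)"
  proof -
    have "eventually (\<lambda>z. ?D z (v t) = (\<Sum>i\<in>Basis. (v t \<bullet> i) *\<^sub>R ?D z i)) (nhds (y t))"
      using smooth_at_eventually[OF T]
      by eventually_elim (rule frechet_derivative_basis_sum[OF smooth_at_differentiable])
    then have "frechet_derivative (\<lambda>z. ?D z (v t)) (at (y t)) =
       frechet_derivative (\<lambda>z. \<Sum>i\<in>Basis. (v t \<bullet> i) *\<^sub>R ?D z i) (at (y t))"
      by (rule frechet_derivative_cong_eventually)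
    also have "\<dots> = (\<lambda>u. \<Sum>i\<in>Basis. (v t \<bullet> i) *\<^sub>R frechet_derivative (\<lambda>z. ?D z i) (at (y t)) u)"
      by (rule frechet_derivative_eq)
        (intro has_derivative_sum has_derivative_scaleR_right smooth_at_has_derivative
          smooth_at_frechet_derivative T)
    finally show ?thesis by simp
  qed
  have "(\<Sum>i\<in>Basis. (v t \<bullet> i) *\<^sub>R ?D2 i + (a \<bullet> i) *\<^sub>R ?D (y t) i)
      = ?D (y t) a + frechet_derivative (\<lambda>z. ?D z (v t)) (at (y t)) y'"
    unfolding D2 frechet_derivative_basis_sum[OF smooth_at_differentiable[OF T], of a]
    by (simp add: sum.distrib)
  moreover have "eventually (\<lambda>s. s \<in> UNIV \<longrightarrow> (\<Sum>i\<in>Basis. (v s \<bullet> i) *\<^sub>R ?D (y s) i) = ?D (y s) (v s)) (nhds t)"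
    using e by simp
  ultimately show ?thesis
    using d has_vector_derivative_cong_ev[where x = t and S = UNIV and f = "\<lambda>s. \<Sum>i\<in>Basis. (v s \<bullet> i) *\<^sub>R ?D (y s) i"
        and g = "\<lambda>s. ?D (y s) (v s)"] eventually_nhds_x_imp_x[OF e] by simp
qed

lemma isCont_eventually: "isCont f x \<Longrightarrow> eventually P (nhds (f x)) \<Longrightarrow> eventually (\<lambda>y. P (f y)) (nhds x)"
  using eventually_compose_filterlim filterlim_nhds_iff_isCont by blast

text \<open>Differentiating the pullback identity gives \<open>dm\<close> up to terms with the
  second derivative of \<open>T\<close>. In \<open>chr\<close> these cancel, by the symmetry of that
  derivative and of \<open>m'\<close>, except for the one term that the acceleration picks up under
  \<open>T\<close>.\<close>

lemma geodesic_equation_transform: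
  assumes m: "metric_field \<Omega> m" and m': "metric_field \<Omega>' m'"
    and y: "y \<in> \<Omega>" and z: "T y \<in> \<Omega>'" and T: "smooth_at T y"
    and pull: "eventually (\<lambda>y. \<forall>v w. m y v w =
       m' (T y) (frechet_derivative T (at y) v) (frechet_derivative T (at y) w)) (nhds y)"
  shows "m y a w + metric_field.chr m y v v w =
    m' (T y) (frechet_derivative T (at y) a
          + frechet_derivative (\<lambda>z. frechet_derivative T (at z) v) (at y) v)
        (frechet_derivative T (at y) w)
    + metric_field.chr m' (T y) (frechet_derivative T (at y) v) (frechet_derivative T (at y) v)
        (frechet_derivative T (at y) w)"
proof -
  interpret m: metric_field \<Omega> m by fact
  interpret m': metric_field \<Omega>' m' by fact
  let ?D = "\<lambda>y. frechet_derivative T (at y)"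
  let ?D2 = "\<lambda>v u. frechet_derivative (\<lambda>z. ?D z v) (at y) u"
  have D2_sym: "?D2 v u = ?D2 u v" for u v by (rule smooth_at_symmetric[OF T])
  have dm: "m.dm y u v w = m'.dm (T y) (?D y u) (?D y v) (?D y w)
      + m' (T y) (?D2 v u) (?D y w) + m' (T y) (?D y v) (?D2 w u)" for u v w
  proof -
    have line: "((\<lambda>s. y + s *\<^sub>R u) has_vector_derivative u) (at 0)"
      by (auto intro!: derivative_eq_intros)
    have T': "smooth_at T (y + 0 *\<^sub>R u)" "smooth_at (\<lambda>z. ?D z b) (y + 0 *\<^sub>R u)" for b
      using T smooth_at_frechet_derivative by auto
    have d': "((\<lambda>s. m' (T (y + s *\<^sub>R u)) (?D (y + s *\<^sub>R u) v) (?D (y + s *\<^sub>R u) w)) has_real_derivative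
        m'.dm (T (y + 0 *\<^sub>R u)) (?D (y + 0 *\<^sub>R u) u) (?D (y + 0 *\<^sub>R u) v) (?D (y + 0 *\<^sub>R u) w)
      + m' (T (y + 0 *\<^sub>R u)) (frechet_derivative (\<lambda>z. ?D z v) (at (y + 0 *\<^sub>R u)) u) (?D (y + 0 *\<^sub>R u) w)
      + m' (T (y + 0 *\<^sub>R u)) (?D (y + 0 *\<^sub>R u) v) (frechet_derivative (\<lambda>z. ?D z w) (at (y + 0 *\<^sub>R u)) u)) (at 0)"
      by (rule m'.has_derivative_along; (rule has_vector_derivative_smooth_compose[OF line])?)
        (use T' z in simp_all)
    have d: "((\<lambda>s. m (y + s *\<^sub>R u) v w) has_real_derivative m.dm (y + 0 *\<^sub>R u) u v w
        + m (y + 0 *\<^sub>R u) 0 w + m (y + 0 *\<^sub>R u) v 0) (at 0)"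
      by (rule m.has_derivative_along[OF line]) (use y in auto)
    have ev: "eventually (\<lambda>s. m (y + s *\<^sub>R u) v w =
       m' (T (y + s *\<^sub>R u)) (?D (y + s *\<^sub>R u) v) (?D (y + s *\<^sub>R u) w)) (nhds 0)"
    proof -
      have "isCont (\<lambda>s. y + s *\<^sub>R u) (0::real)" by (intro continuous_intros)
      then have "filterlim (\<lambda>s. y + s *\<^sub>R u) (nhds (y + 0 *\<^sub>R u)) (nhds (0::real))"
        by (rule filterlim_nhds_iff_isCont[THEN iffD2])
      then have "eventually (\<lambda>s. \<forall>v w. m (y + s *\<^sub>R u) v w =
          m' (T (y + s *\<^sub>R u)) (?D (y + s *\<^sub>R u) v) (?D (y + s *\<^sub>R u) w)) (nhds 0)"
        by (rule eventually_compose_filterlim[rotated]) (use pull in simp)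
      then show ?thesis by eventually_elim blast
    qed
    have "m.dm (y + 0 *\<^sub>R u) u v w + m (y + 0 *\<^sub>R u) 0 w + m (y + 0 *\<^sub>R u) v 0 =
        m'.dm (T (y + 0 *\<^sub>R u)) (?D (y + 0 *\<^sub>R u) u) (?D (y + 0 *\<^sub>R u) v) (?D (y + 0 *\<^sub>R u) w)
      + m' (T (y + 0 *\<^sub>R u)) (frechet_derivative (\<lambda>z. ?D z v) (at (y + 0 *\<^sub>R u)) u) (?D (y + 0 *\<^sub>R u) w)
      + m' (T (y + 0 *\<^sub>R u)) (?D (y + 0 *\<^sub>R u) v) (frechet_derivative (\<lambda>z. ?D z w) (at (y + 0 *\<^sub>R u)) u)"
      by (rule DERIV_unique[OF d[THEN DERIV_cong_ev[OF refl ev refl, THEN iffD1]] d'])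
    then show ?thesis
      using linear_0[OF m.linear_left[OF y, of w]] linear_0[OF m.linear_right[OF y, of v]] by simp
  qed
  have "m y a w = m' (T y) (?D y a) (?D y w)"
    using eventually_nhds_x_imp_x[OF pull] by blast
  moreover have "m.chr y v v w = m'.chr (T y) (?D y v) (?D y v) (?D y w) + m' (T y) (?D2 v v) (?D y w)"
    unfolding m.chr_def m'.chr_def dm using m'.sym[OF z] D2_sym[of v w] by (simp add: field_simps)
  ultimately show ?thesis
    using linear_add[OF m'.linear_left[OF z, of "?D y w"]] by simp
qed

section \<open>Geodesics in a Riemannian manifold\<close>

locale riemannian = manifold A
  for A :: "('m::{t2_space,second_countable_topology}, 'e::euclidean_space) atlas" +
  fixes g :: "'m metric"
  assumes riemannian_metric: "riemannian_metric A g"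
begin

lemma metric_sym: "u \<in> tangent_space A x \<Longrightarrow> v \<in> tangent_space A x \<Longrightarrow> g x u v = g x v u"
  and metric_linear: "u \<in> tangent_space A x \<Longrightarrow> v \<in> tangent_space A x \<Longrightarrow> w \<in> tangent_space A x \<Longrightarrow>
    g x (\<lambda>f. k * u f + v f) w = k * g x u w + g x v w"
  and metric_pos: "u \<in> tangent_space A x \<Longrightarrow> u \<noteq> (\<lambda>_. 0) \<Longrightarrow> 0 < g x u u"
  using riemannian_metric unfolding riemannian_metric_def by blast+

lemma metric_smooth: "c \<in> A \<Longrightarrow> smooth_on (snd c ` fst c) (\<lambda>y. metric_coord A g c y v w)"
  using riemannian_metric unfolding riemannian_metric_def by blast+

lemma coord_vec_0: "coord_vec A c x 0 = (\<lambda>_. 0)"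
  by (simp add: coord_vec_def coord_op_def fun_eq_iff)

lemma metric_coord_chart:
  "c \<in> A \<Longrightarrow> x \<in> fst c \<Longrightarrow> metric_coord A g c (snd c x) v w = g x (coord_vec A c x v) (coord_vec A c x w)"
  by (simp add: metric_coord_def)

lemma metric_field: assumes c: "c \<in> A" shows "metric_field (snd c ` fst c) (metric_coord A g c)"
proof
  fix y u v w k assume "y \<in> snd c ` fst c"
  then obtain x where x: "x \<in> fst c" "y = snd c x" by blast
  note t = coord_vec_in_tangent_space[OF c x(1)]
  show "metric_coord A g c y v w = metric_coord A g c y w v"
    unfolding x(2) metric_coord_chart[OF c x(1)] by (rule metric_sym[OF t t])
  show "metric_coord A g c y (k *\<^sub>R u + v) w = k * metric_coord A g c y u w + metric_coord A g c y v w"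
    unfolding x(2) metric_coord_chart[OF c x(1)] coord_vec_linear by (rule metric_linear[OF t t t])
  show "0 < metric_coord A g c y v v" if "v \<noteq> 0"
    unfolding x(2) metric_coord_chart[OF c x(1)]
    using coord_vec_inject[OF c x(1), of v 0] that by (intro metric_pos[OF t]) (auto simp: coord_vec_0)
  show "smooth_at (\<lambda>y. metric_coord A g c y v w) y"
    using metric_smooth[OF c] smooth_on_iff_smooth_at[OF chart_image_open[OF c]] x c by blast
qed (use c in simp)

lemma christoffel_eq_chr: "c \<in> A \<Longrightarrow> christoffel A g c = metric_field.chr (metric_coord A g c)"
  by (simp add: fun_eq_iff christoffel_def metric_field.chr_def[OF metric_field]
      metric_field.dm_def[OF metric_field])

lemma metric_coord_change:
  assumes "c \<in> A" "c' \<in> A" "x \<in> fst c" "x \<in> fst c'"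
  defines "T \<equiv> snd c' \<circ> chart_inv c"
  shows "metric_coord A g c (snd c x) v w = metric_coord A g c' (T (snd c x))
    (frechet_derivative T (at (snd c x)) v) (frechet_derivative T (at (snd c x)) w)"
proof -
  have "T (snd c x) = snd c' x" using assms by simp
  then show ?thesis
    using coord_vec_change[OF assms(1,3,2,4)] metric_coord_chart assms(1-4) unfolding T_def by simp
qed

text \<open>One instance of the existential statement in \<open>geodesic_on\<close>, with its
  witnesses as parameters so that they can be transported between charts.\<close>

definition geodesic_at :: "('m, 'e) chart \<Rightarrow> (real \<Rightarrow> 'm) \<Rightarrow> real \<Rightarrow> real \<Rightarrow> (real \<Rightarrow> 'e) \<Rightarrow> 'e \<Rightarrow> bool" where
  "geodesic_at c \<gamma> t e y' y'' \<longleftrightarrow> 0 < e \<and> \<gamma> ` {t-e<..<t+e} \<subseteq> fst c \<and>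
     (\<forall>s\<in>{t-e<..<t+e}. ((snd c \<circ> \<gamma>) has_vector_derivative y' s) (at s)) \<and>
     (y' has_vector_derivative y'') (at t) \<and>
     (\<forall>w. metric_coord A g c (snd c (\<gamma> t)) y'' w +
          metric_field.chr (metric_coord A g c) (snd c (\<gamma> t)) (y' t) (y' t) w = 0)"

lemma geodesic_on_iff:
  "geodesic_on A g J \<gamma> \<longleftrightarrow> (\<forall>t\<in>J. \<exists>c\<in>A. \<exists>e y' y''. geodesic_at c \<gamma> t e y' y'')"
  unfolding geodesic_on_def geodesic_at_def using christoffel_eq_chr by (auto; metis)

lemma geodesic_at_isCont:
  assumes "c \<in> A" "geodesic_at c \<gamma> t e y' y''"
  shows "isCont \<gamma> t"
proof -
  have t: "t \<in> {t-e<..<t+e}" using assms(2) by (auto simp: geodesic_at_def)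
  then have x: "\<gamma> t \<in> fst c" using assms(2) by (auto simp: geodesic_at_def)
  have "isCont (snd c \<circ> \<gamma>) t"
    using assms(2) t has_vector_derivative_continuous unfolding geodesic_at_def by blast
  moreover have "isCont (chart_inv c) ((snd c \<circ> \<gamma>) t)" using chart_inv_isCont[OF assms(1) x] by simp
  ultimately have "isCont (chart_inv c \<circ> (snd c \<circ> \<gamma>)) t" by (rule isCont_comp)
  moreover have "eventually (\<lambda>s. (chart_inv c \<circ> (snd c \<circ> \<gamma>)) s = \<gamma> s) (nhds t)"
    using eventually_nhds_in_open[OF open_greaterThanLessThan t]
  proof eventually_elim
    case (elim s)
    then have "\<gamma> s \<in> fst c" using assms(2) by (auto simp: geodesic_at_def)
    then show ?case using assms(1) by simp
  qed
  ultimately show ?thesis using isCont_cong[of "chart_inv c \<circ> (snd c \<circ> \<gamma>)" \<gamma> t] by simp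
qed

text \<open>\<open>geodesic_on\<close> picks its own chart at each time. To pass to a given chart
  \<open>c\<close>, the curve is carried over by the transition map \<open>T\<close>; the inverse
  transition \<open>S\<close> carries the new derivatives back to the old ones, so the
  transformation law for \<open>S\<close> reduces the equation in \<open>c\<close> to the one in
  \<open>c1\<close>.\<close>

lemma geodesic_at_change_chart:
  assumes c: "c \<in> A" "\<gamma> t \<in> fst c" and c1: "c1 \<in> A" "geodesic_at c1 \<gamma> t e1 y1' y1''"
  shows "\<exists>e y' y''. geodesic_at c \<gamma> t e y' y''"
proof -
  have t1: "t \<in> {t-e1<..<t+e1}" using c1(2) by (auto simp: geodesic_at_def)
  have x1: "\<gamma> t \<in> fst c1" using c1(2) t1 by (auto simp: geodesic_at_def)
  have cont: "isCont \<gamma> t" by (rule geodesic_at_isCont[OF c1])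
  define T where "T = snd c \<circ> chart_inv c1"
  define S where "S = snd c1 \<circ> chart_inv c"
  define z where "z = snd c1 \<circ> \<gamma>"
  define y' where "y' s = frechet_derivative T (at (z s)) (y1' s)" for s
  define y'' where "y'' = frechet_derivative T (at (z t)) y1''
     + frechet_derivative (\<lambda>x. frechet_derivative T (at x) (y1' t)) (at (z t)) (y1' t)"
  have "eventually (\<lambda>s. \<gamma> s \<in> fst c) (nhds t)"
    using cont eventually_chart[OF c] filterlim_nhds_iff_isCont[of \<gamma> t] eventually_compose_filterlim by blast
  then have "eventually (\<lambda>s. \<gamma> s \<in> fst c \<and> s \<in> {t-e1<..<t+e1}) (nhds t)"
    using eventually_nhds_in_open[OF open_greaterThanLessThan t1] by (rule eventually_conj)
  then obtain e where e: "e > 0" "\<And>s. dist s t < e \<Longrightarrow> \<gamma> s \<in> fst c \<and> s \<in> {t-e1<..<t+e1}"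
    unfolding eventually_nhds_metric by blast
  have near: "\<gamma> s \<in> fst c" "\<gamma> s \<in> fst c1" "(z has_vector_derivative y1' s) (at s)" "smooth_at T (z s)"
    if "s \<in> {t-e<..<t+e}" for s
  proof -
    have "dist s t < e" using that by (auto simp: dist_real_def)
    then have s: "\<gamma> s \<in> fst c" "s \<in> {t-e1<..<t+e1}" using e(2) by blast+
    then show 1: "\<gamma> s \<in> fst c" "\<gamma> s \<in> fst c1" "(z has_vector_derivative y1' s) (at s)"
      using c1(2) by (auto simp: geodesic_at_def z_def)
    show "smooth_at T (z s)"
      unfolding T_def z_def using transition_smooth_at[OF c1(1) c(1) 1(2,1)] by simp
  qed
  have t: "t \<in> {t-e<..<t+e}" using e by simp
  have y1'': "(y1' has_vector_derivative y1'') (at t)" using c1(2) by (simp add: geodesic_at_def)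
  have d1: "((snd c \<circ> \<gamma>) has_vector_derivative y' s) (at s)" if s: "s \<in> {t-e<..<t+e}" for s
  proof (rule has_vector_derivative_transform_within_open)
    show "((\<lambda>s. T (z s)) has_vector_derivative y' s) (at s)"
      unfolding y'_def by (rule has_vector_derivative_smooth_compose[OF near(3,4)[OF s]])
    show "T (z r) = (snd c \<circ> \<gamma>) r" if "r \<in> {t-e<..<t+e}" for r
      using near[OF that] c1(1) by (simp add: T_def z_def)
  qed (use s in auto)
  have d2: "(y' has_vector_derivative y'') (at t)"
    unfolding y'_def y''_def by (rule has_vector_derivative_frechet_along[OF near(3)[OF t] y1'' near(4)[OF t]])
  let ?y = "snd c (\<gamma> t)"
  have Sy: "S ?y = snd c1 (\<gamma> t)" using c by (simp add: S_def)
  have S: "smooth_at S ?y" unfolding S_def by (rule transition_smooth_at[OF c(1) c1(1) c(2) x1])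
  have y_cont: "isCont (snd c \<circ> \<gamma>) t" using d1[OF t] has_vector_derivative_continuous by blast
  have evS: "eventually (\<lambda>s. smooth_at S ((snd c \<circ> \<gamma>) s)) (nhds t)"
    using y_cont smooth_at_eventually[OF S] filterlim_nhds_iff_isCont[of "snd c \<circ> \<gamma>" t]
      eventually_compose_filterlim by fastforce
  have DS: "frechet_derivative S (at ((snd c \<circ> \<gamma>) s)) (y' s) = y1' s"
    if s: "s \<in> {t-e<..<t+e}" "smooth_at S ((snd c \<circ> \<gamma>) s)" for s
  proof -
    have "(z has_vector_derivative frechet_derivative S (at ((snd c \<circ> \<gamma>) s)) (y' s)) (at s)"
    proof (rule has_vector_derivative_transform_within_open)
      show "((\<lambda>s. S ((snd c \<circ> \<gamma>) s)) has_vector_derivative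
          frechet_derivative S (at ((snd c \<circ> \<gamma>) s)) (y' s)) (at s)"
        by (rule has_vector_derivative_smooth_compose[OF d1[OF s(1)] s(2)])
      show "S ((snd c \<circ> \<gamma>) r) = z r" if "r \<in> {t-e<..<t+e}" for r
        using near[OF that] c(1) by (simp add: S_def z_def)
    qed (use s in auto)
    then show ?thesis using near(3)[OF s(1)] vector_derivative_unique_at by blast
  qed
  have DS_ev: "eventually (\<lambda>s. frechet_derivative S (at ((snd c \<circ> \<gamma>) s)) (y' s) = y1' s) (nhds t)"
    using evS eventually_nhds_in_open[OF open_greaterThanLessThan t] by eventually_elim (rule DS)
  have DSt: "frechet_derivative S (at ?y) (y' t) = y1' t"
    using eventually_nhds_x_imp_x[OF DS_ev] by simp
  have "((\<lambda>s. frechet_derivative S (at ((snd c \<circ> \<gamma>) s)) (y' s)) has_vector_derivative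
     frechet_derivative S (at ?y) y''
       + frechet_derivative (\<lambda>x. frechet_derivative S (at x) (y' t)) (at ?y) (y' t)) (at t)"
    using has_vector_derivative_frechet_along[OF d1[OF t] d2, of S] S by simp
  moreover have "((\<lambda>s. frechet_derivative S (at ((snd c \<circ> \<gamma>) s)) (y' s)) has_vector_derivative y1'') (at t)"
    using y1'' has_vector_derivative_cong_ev[where x = t and S = UNIV and f = y1'
        and g = "\<lambda>s. frechet_derivative S (at ((snd c \<circ> \<gamma>) s)) (y' s)"]
      DS_ev DSt by (simp add: eq_commute)
  ultimately have DS2: "frechet_derivative S (at ?y) y''
       + frechet_derivative (\<lambda>x. frechet_derivative S (at x) (y' t)) (at ?y) (y' t) = y1''"
    using vector_derivative_unique_at by blast
  have pull: "eventually (\<lambda>y. \<forall>v w. metric_coord A g c y v w = metric_coord A g c1 (S y)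
      (frechet_derivative S (at y) v) (frechet_derivative S (at y) w)) (nhds ?y)"
    using eventually_chart_image[OF c] eventually_chart_inv[OF c eventually_chart[OF c1(1) x1]]
  proof eventually_elim
    case (elim y)
    then obtain x where x: "x \<in> fst c" "y = snd c x" by blast
    have "x \<in> fst c1" using elim(2) x c by simp
    then show ?case using metric_coord_change[OF c(1) c1(1) x(1)] x(2) unfolding S_def by blast
  qed
  have "metric_coord A g c ?y y'' w + metric_field.chr (metric_coord A g c) ?y (y' t) (y' t) w = 0" for w
    using geodesic_equation_transform[OF metric_field[OF c(1)] metric_field[OF c1(1)] _ _ S pull,
        of y'' w "y' t"] c x1 c1(2)
    unfolding DS2 DSt Sy by (simp add: geodesic_at_def)
  then show ?thesis
    using near d1 d2 e(1) unfolding geodesic_at_def by blast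
qed

lemma geodesic_in_chart:
  assumes "geodesic_on A g J \<gamma>" "t \<in> J" "c \<in> A" "\<gamma> t \<in> fst c"
  obtains e y' y'' where "geodesic_at c \<gamma> t e y' y''"
  using assms geodesic_at_change_chart unfolding geodesic_on_iff by blast

lemma geodesic_isCont:
  assumes "geodesic_on A g J \<gamma>" "t \<in> J" shows "isCont \<gamma> t"
  using assms geodesic_at_isCont unfolding geodesic_on_iff by blast

text \<open>A function of all times that agrees with the local witnesses of
  \<open>geodesic_at\<close> where \<open>c\<close> covers the curve, so that the velocity can
  itself be differentiated.\<close>

definition chart_vel :: "('m, 'e) chart \<Rightarrow> (real \<Rightarrow> 'm) \<Rightarrow> real \<Rightarrow> 'e" where
  "chart_vel c \<gamma> t = vector_derivative (snd c \<circ> \<gamma>) (at t)"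

definition chart_acc :: "('m, 'e) chart \<Rightarrow> (real \<Rightarrow> 'm) \<Rightarrow> real \<Rightarrow> 'e" where
  "chart_acc c \<gamma> t = vector_derivative (chart_vel c \<gamma>) (at t)"

lemma geodesic_chart_derivatives:
  assumes \<gamma>: "geodesic_on A g J \<gamma>" "t \<in> J" and c: "c \<in> A" "\<gamma> t \<in> fst c"
  shows "((snd c \<circ> \<gamma>) has_vector_derivative chart_vel c \<gamma> t) (at t)"
    and "(chart_vel c \<gamma> has_vector_derivative chart_acc c \<gamma> t) (at t)"
    and "metric_coord A g c (snd c (\<gamma> t)) (chart_acc c \<gamma> t) w +
      metric_field.chr (metric_coord A g c) (snd c (\<gamma> t)) (chart_vel c \<gamma> t) (chart_vel c \<gamma> t) w = 0"
    and "velocity A \<gamma> t = coord_vec A c (\<gamma> t) (chart_vel c \<gamma> t)"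
proof -
  obtain e y' y'' where ge: "geodesic_at c \<gamma> t e y' y''" by (rule geodesic_in_chart[OF \<gamma> c])
  have t: "t \<in> {t-e<..<t+e}" using ge by (simp add: geodesic_at_def)
  have v: "chart_vel c \<gamma> s = y' s" if "s \<in> {t-e<..<t+e}" for s
    unfolding chart_vel_def by (rule vector_derivative_at) (use ge that in \<open>simp add: geodesic_at_def\<close>)
  show 1: "((snd c \<circ> \<gamma>) has_vector_derivative chart_vel c \<gamma> t) (at t)"
    using ge t v[OF t] by (simp add: geodesic_at_def)
  have d: "(chart_vel c \<gamma> has_vector_derivative y'') (at t)"
    by (rule has_vector_derivative_transform_within_open[of y' _ _ "{t-e<..<t+e}"])
      (use ge t v in \<open>auto simp: geodesic_at_def\<close>)
  then have a: "chart_acc c \<gamma> t = y''" unfolding chart_acc_def by (rule vector_derivative_at)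
  then show "(chart_vel c \<gamma> has_vector_derivative chart_acc c \<gamma> t) (at t)" using d by simp
  show "metric_coord A g c (snd c (\<gamma> t)) (chart_acc c \<gamma> t) w +
      metric_field.chr (metric_coord A g c) (snd c (\<gamma> t)) (chart_vel c \<gamma> t) (chart_vel c \<gamma> t) w = 0"
    using ge v[OF t] a by (simp add: geodesic_at_def)
  have "eventually (\<lambda>s. \<gamma> s \<in> fst c) (nhds t)"
    using eventually_nhds_in_open[OF open_greaterThanLessThan t]
    by eventually_elim (use ge in \<open>auto simp: geodesic_at_def\<close>)
  then show "velocity A \<gamma> t = coord_vec A c (\<gamma> t) (chart_vel c \<gamma> t)"
    by (rule velocity_eq[OF c _ 1])
qed

text \<open>Let \<open>\<tau>\<close> be the supremum of the times up to which the curves agree.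
  Positions and velocities agree at \<open>\<tau>\<close> by passing to the limit from the left, and
  local uniqueness would carry the agreement beyond \<open>\<tau>\<close> if
  \<open>\<tau> < 1\<close>.\<close>

lemma geodesic_unique:
  assumes J1: "open J1" "{0..1} \<subseteq> J1" "geodesic_on A g J1 \<gamma>1"
    and J2: "open J2" "{0..1} \<subseteq> J2" "geodesic_on A g J2 \<gamma>2"
    and init: "\<gamma>1 0 = \<gamma>2 0" "velocity A \<gamma>1 0 = velocity A \<gamma>2 0"
    and t: "t \<in> {0..1}"
  shows "\<gamma>1 t = \<gamma>2 t"
proof -
  define S where "S = {s \<in> {0..1}. \<forall>r\<in>{0..s}. \<gamma>1 r = \<gamma>2 r}"
  have S0: "0 \<in> S" using init by (simp add: S_def)
  define \<tau> where "\<tau> = Sup S"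
  have bdd: "bdd_above S" unfolding S_def by (rule bdd_aboveI[of _ 1]) auto
  have "\<And>s. s \<in> S \<Longrightarrow> s \<le> 1" by (simp add: S_def)
  then have \<tau>: "0 \<le> \<tau>" "\<tau> \<le> 1"
    unfolding \<tau>_def using S0 cSup_upper[OF S0 bdd] cSup_least[of S 1] by auto
  have J\<tau>: "\<tau> \<in> J1" "\<tau> \<in> J2" using J1 J2 \<tau> by auto
  have below: "\<gamma>1 r = \<gamma>2 r" if "0 \<le> r" "r < \<tau>" for r
  proof -
    have "\<exists>s\<in>S. r < s" using that S0 less_cSup_iff[of S r] bdd unfolding \<tau>_def by blast
    then show ?thesis using that by (auto simp: S_def)
  qed
  have cont: "isCont \<gamma>1 \<tau>" "isCont \<gamma>2 \<tau>" using geodesic_isCont J1 J2 J\<tau> by blast+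
  have eq\<tau>: "\<gamma>1 \<tau> = \<gamma>2 \<tau>"
  proof (cases "\<tau> = 0")
    case False
    have "(\<gamma>1 \<longlongrightarrow> \<gamma>1 \<tau>) (at_left \<tau>)" "(\<gamma>2 \<longlongrightarrow> \<gamma>2 \<tau>) (at_left \<tau>)"
      using cont by (auto simp: isCont_def filterlim_at_split)
    then have lim: "(\<gamma>1 \<longlongrightarrow> \<gamma>1 \<tau>) (at_left \<tau>)" "(\<gamma>2 \<longlongrightarrow> \<gamma>2 \<tau>) (at_left \<tau>)" .
    have "eventually (\<lambda>r. r \<in> {0<..<\<tau>}) (at_left \<tau>)"
      using False \<tau> eventually_at_left_real[of 0 \<tau>] by simp
    then have "eventually (\<lambda>r. \<gamma>1 r = \<gamma>2 r) (at_left \<tau>)"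
      by eventually_elim (use below in auto)
    from tendsto_cong[OF this] lim(2) have "(\<gamma>1 \<longlongrightarrow> \<gamma>2 \<tau>) (at_left \<tau>)" by blast
    then show ?thesis by (rule tendsto_unique[OF trivial_limit_at_left_real lim(1)])
  qed (use init in simp)
  obtain c where c: "c \<in> A" "\<gamma>1 \<tau> \<in> fst c" using ex_chart by blast
  then have c2: "\<gamma>2 \<tau> \<in> fst c" using eq\<tau> by simp
  note g1 = geodesic_chart_derivatives[OF J1(3) _ c(1)] and g2 = geodesic_chart_derivatives[OF J2(3) _ c(1)]
  \<comment> \<open>At \<open>\<tau> = 0\<close> this is the hypothesis on the initial velocities.
    For \<open>\<tau> > 0\<close> the curves agree on \<open>{0..\<tau>}\<close>, and a derivative
    within that interval is unique.\<close>
  have vel: "chart_vel c \<gamma>1 \<tau> = chart_vel c \<gamma>2 \<tau>"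
  proof (cases "\<tau> = 0")
    case True
    then have "coord_vec A c (\<gamma>1 \<tau>) (chart_vel c \<gamma>1 \<tau>) = coord_vec A c (\<gamma>1 \<tau>) (chart_vel c \<gamma>2 \<tau>)"
      using g1(4)[OF J\<tau>(1) c(2)] g2(4)[OF J\<tau>(2) c2] init eq\<tau> by simp
    then show ?thesis by (rule coord_vec_inject[OF c])
  next
    case False
    have d1: "((snd c \<circ> \<gamma>1) has_vector_derivative chart_vel c \<gamma>1 \<tau>) (at \<tau> within {0..\<tau>})"
      using g1(1)[OF J\<tau>(1) c(2)] by (rule has_vector_derivative_at_within)
    have "((snd c \<circ> \<gamma>1) has_vector_derivative chart_vel c \<gamma>2 \<tau>) (at \<tau> within {0..\<tau>})"
    proof (rule has_vector_derivative_transform[where f = "snd c \<circ> \<gamma>2"])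
      show "((snd c \<circ> \<gamma>2) has_vector_derivative chart_vel c \<gamma>2 \<tau>) (at \<tau> within {0..\<tau>})"
        using g2(1)[OF J\<tau>(2) c2] by (rule has_vector_derivative_at_within)
      show "(snd c \<circ> \<gamma>1) r = (snd c \<circ> \<gamma>2) r" if "r \<in> {0..\<tau>}" for r
        using below[of r] eq\<tau> that by (cases "r = \<tau>") auto
    qed (use \<tau> in auto)
    then show ?thesis
      using vector_derivative_unique_within_closed_interval[of 0 \<tau> \<tau>] d1 False \<tau> by (simp add: cbox_interval)
  qed
  have "\<tau> = 1"
  proof (rule ccontr)
    assume "\<tau> \<noteq> 1"
    have ev: "eventually (\<lambda>s. s \<in> J1 \<and> s \<in> J2 \<and> \<gamma>1 s \<in> fst c \<and> \<gamma>2 s \<in> fst c) (nhds \<tau>)"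
      using J\<tau> J1(1) J2(1)
      by (intro eventually_conj eventually_nhds_in_open isCont_eventually[OF cont(1) eventually_chart[OF c]]
          isCont_eventually[OF cont(2) eventually_chart[OF c(1) c2]])
    then obtain e0 where e0: "e0 > 0"
      "\<And>s. dist s \<tau> < e0 \<Longrightarrow> s \<in> J1 \<and> s \<in> J2 \<and> \<gamma>1 s \<in> fst c \<and> \<gamma>2 s \<in> fst c"
      unfolding eventually_nhds_metric by blast
    \<comment> \<open>Half of \<open>e0\<close> keeps the closed interval inside the open one;
      \<open>1 - \<tau>\<close> keeps it inside \<open>{0..1}\<close>, so that its points count for
      \<open>S\<close>.\<close>
    define e where "e = min (e0 / 2) (1 - \<tau>)"
    have e: "0 < e" "\<tau> + e \<le> 1" using e0 \<open>\<tau> \<noteq> 1\<close> \<tau> by (auto simp: e_def)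
    have near: "s \<in> J1" "s \<in> J2" "\<gamma>1 s \<in> fst c" "\<gamma>2 s \<in> fst c" if "s \<in> {\<tau>..\<tau> + e}" for s
      using e0(2)[of s] that e0(1) by (auto simp: dist_real_def e_def)
    have "\<exists>e'>0. e' \<le> e \<and> (\<forall>s\<in>{\<tau>..\<tau> + e'}. (snd c \<circ> \<gamma>1) s = (snd c \<circ> \<gamma>2) s)"
      by (rule metric_field.geodesic_local_unique[where ?v1.0 = "chart_vel c \<gamma>1" and
            ?v2.0 = "chart_vel c \<gamma>2" and ?t0.0 = \<tau>, OF metric_field[OF c(1)] e(1) _ vel,
            where ?a1.0 = "chart_acc c \<gamma>1" and ?a2.0 = "chart_acc c \<gamma>2"])
        (use near g1(1-3) g2(1-3) eq\<tau> c in \<open>auto simp: comp_def\<close>)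
    then obtain e' where e': "e' > 0" "e' \<le> e" "\<And>s. s \<in> {\<tau>..\<tau> + e'} \<Longrightarrow> snd c (\<gamma>1 s) = snd c (\<gamma>2 s)"
      by auto
    have eq: "\<gamma>1 s = \<gamma>2 s" if s: "s \<in> {\<tau>..\<tau> + e'}" for s
    proof -
      have "s \<in> {\<tau>..\<tau> + e}" using s e' by auto
      then show ?thesis using near e'(3)[OF s] chart_inj[OF c(1)] by (meson inj_onD)
    qed
    have "\<gamma>1 r = \<gamma>2 r" if "r \<in> {0..\<tau> + e'}" for r
      using below[of r] eq[of r] that by (cases "r < \<tau>") auto
    then have "\<tau> + e' \<in> S"
      unfolding S_def using \<tau> e e' by auto
    then have "\<tau> + e' \<le> \<tau>" unfolding \<tau>_def by (rule cSup_upper[OF _ bdd])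
    then show False using e' by simp
  qed
  then show ?thesis using below[of t] eq\<tau> t by (cases "t = 1") auto
qed

end

section \<open>The exponential map\<close>

locale pointed_riemannian = riemannian A g
  for A :: "('m::{t2_space,second_countable_topology}, 'e::euclidean_space) atlas" and g +
  fixes p :: 'm and c :: "('m, 'e) chart"
  assumes c: "c \<in> A" "p \<in> fst c"
begin

text \<open>The inner product of the tangent space at \<open>p\<close> in the coordinates of
  \<open>c\<close>. Together with \<open>D\<close> and \<open>E\<close> it names the ingredients of
  \<open>exp_diffeo_on_ball\<close> for this chart.\<close>

definition G :: "'e \<Rightarrow> 'e \<Rightarrow> real" where
  "G = metric_coord A g c (snd c p)"

definition D :: "real \<Rightarrow> 'e set" where
  "D s = {\<xi>. G \<xi> \<xi> < s\<^sup>2}"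

definition E :: "'e \<Rightarrow> 'm" where
  "E \<xi> = exp_map A g p (coord_vec A c p \<xi>)"

sublocale m: metric_field "snd c ` fst c" "metric_coord A g c"
  by (rule metric_field[OF c(1)])

lemma p_in: "snd c p \<in> snd c ` fst c"
  using c by blast

lemma G_bounded_bilinear: "bounded_bilinear G"
  unfolding G_def by (rule m.bounded_bilinear[OF p_in])

lemmas G_simps = bounded_bilinear.zero_left[OF G_bounded_bilinear]
  bounded_bilinear.scaleR_left[OF G_bounded_bilinear]
  bounded_bilinear.scaleR_right[OF G_bounded_bilinear]

lemma G_sym: "G \<xi> \<eta> = G \<eta> \<xi>"
  unfolding G_def by (rule m.sym[OF p_in])

lemma G_nonneg: "0 \<le> G \<xi> \<xi>"
  unfolding G_def by (rule m.nonneg[OF p_in])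

lemma G_eq_0_iff: "G \<xi> \<xi> = 0 \<longleftrightarrow> \<xi> = 0"
  using m.pos[OF p_in, of \<xi>] G_simps(1) unfolding G_def by (metis less_irrefl)

lemma G_lower: obtains l where "l > 0" "\<And>\<xi>. l * (norm \<xi>)\<^sup>2 \<le> G \<xi> \<xi>"
proof -
  obtain l where "l > 0" "\<And>y v. y \<in> cball (snd c p) 0 \<Longrightarrow> l * (norm v)\<^sup>2 \<le> metric_coord A g c y v v"
    using m.lower_bound[of "snd c p" 0] p_in by auto
  then show ?thesis using that unfolding G_def by simp
qed

lemma G_continuous: "continuous_on UNIV (\<lambda>\<xi>. G \<xi> \<xi>)"
  by (intro bounded_bilinear.continuous_on[OF G_bounded_bilinear] continuous_intros)

lemma open_D: "open (D s)"
  unfolding D_def using G_continuous by (intro open_Collect_less) (auto intro: continuous_intros)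

lemma D_0: "0 < s \<Longrightarrow> 0 \<in> D s"
  by (simp add: D_def G_simps)

lemma D_scale: "\<xi> \<in> D s \<Longrightarrow> t \<in> {0..1} \<Longrightarrow> t *\<^sub>R \<xi> \<in> D s"
proof -
  assume "\<xi> \<in> D s" "t \<in> {0..1}"
  then have "t * t * G \<xi> \<xi> \<le> 1 * G \<xi> \<xi>"
    using G_nonneg[of \<xi>] by (intro mult_right_mono mult_le_one) auto
  then show "t *\<^sub>R \<xi> \<in> D s" using \<open>\<xi> \<in> D s\<close> by (simp add: D_def G_simps mult.assoc)
qed

lemma D_mono: "0 \<le> s \<Longrightarrow> s \<le> s' \<Longrightarrow> D s \<subseteq> D s'"
  unfolding D_def by (auto intro: order_less_le_trans power_mono)

text \<open>Both terms of the geodesic equation are multiplied by \<open>t\<^sup>2\<close> when a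
  geodesic is run through at \<open>t\<close> times its speed, the equation being quadratic in the
  velocity. The time domain becomes \<open>J / t\<close>, which is why \<open>t = 0\<close> is
  excluded.\<close>

lemma exp_geodesic_scale:
  assumes \<gamma>: "exp_geodesic A g p (coord_vec A c p \<xi>) \<gamma>" and t: "t \<in> {0<..1}"
  shows "exp_geodesic A g p (coord_vec A c p (t *\<^sub>R \<xi>)) (\<lambda>s. \<gamma> (t * s))"
proof -
  obtain J where J: "open J" "connected J" "{0..1} \<subseteq> J" "geodesic_on A g J \<gamma>"
    and init: "\<gamma> 0 = p" "velocity A \<gamma> 0 = coord_vec A c p \<xi>"
    using \<gamma> unfolding exp_geodesic_def by blast
  have t0: "t > 0" using t by simp
  define J' where "J' = {s. t * s \<in> J}"
  have J'_eq: "J' = (\<lambda>x. x / t) ` J"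
    using t0 by (auto simp: J'_def image_def intro!: bexI[of _ "t * _"])
  have J': "open J'" "connected J'" "{0..1} \<subseteq> J'"
  proof -
    have "open ((\<lambda>s. t * s) -` J)" by (intro open_vimage J continuous_intros)
    then show "open J'" by (simp add: J'_def vimage_def)
    show "connected J'"
      unfolding J'_eq using t0 by (intro connected_continuous_image J continuous_intros) auto
    show "{0..1} \<subseteq> J'" using J(3) t by (auto simp: J'_def subset_iff mult_le_one)
  qed
  have geo: "geodesic_on A g J' (\<lambda>s. \<gamma> (t * s))"
    unfolding geodesic_on_iff
  proof
    fix s assume "s \<in> J'"
    then obtain c1 e y' y'' where c1: "c1 \<in> A" and ge: "geodesic_at c1 \<gamma> (t * s) e y' y''"
      using J(4) unfolding geodesic_on_iff J'_def by blast
    interpret m1: metric_field "snd c1 ` fst c1" "metric_coord A g c1" by (rule metric_field[OF c1])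
    have e: "e > 0" using ge by (simp add: geodesic_at_def)
    have in_int: "t * r \<in> {t * s - e<..<t * s + e}" if "r \<in> {s - e / t<..<s + e / t}" for r
      using that t0 by (auto simp: field_simps)
    have "geodesic_at c1 (\<lambda>s. \<gamma> (t * s)) s (e / t) (\<lambda>s. t *\<^sub>R y' (t * s)) (t\<^sup>2 *\<^sub>R y'')"
      unfolding geodesic_at_def
    proof (intro conjI ballI allI)
      show "0 < e / t" using e t0 by simp
      show "(\<lambda>s. \<gamma> (t * s)) ` {s - e / t<..<s + e / t} \<subseteq> fst c1"
        using ge in_int unfolding geodesic_at_def by blast
      have inner: "((\<lambda>s. t * s) has_vector_derivative t) (at r)" for r
        by (auto intro!: derivative_eq_intros)
      show "(snd c1 \<circ> (\<lambda>s. \<gamma> (t * s)) has_vector_derivative t *\<^sub>R y' (t * r)) (at r)"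
        if "r \<in> {s - e / t<..<s + e / t}" for r
      proof -
        have "((snd c1 \<circ> \<gamma>) has_vector_derivative y' (t * r)) (at (t * r))"
          using ge in_int[OF that] unfolding geodesic_at_def by blast
        then have "((snd c1 \<circ> \<gamma>) \<circ> (\<lambda>s. t * s) has_vector_derivative t *\<^sub>R y' (t * r)) (at r)"
          by (rule vector_diff_chain_at[OF inner])
        then show ?thesis by (simp add: comp_def)
      qed
      have "(y' has_vector_derivative y'') (at (t * s))" using ge by (simp add: geodesic_at_def)
      then have "(y' \<circ> (\<lambda>s. t * s) has_vector_derivative t *\<^sub>R y'') (at s)"
        by (rule vector_diff_chain_at[OF inner])
      then have "((\<lambda>s. t *\<^sub>R y' (t * s)) has_vector_derivative t *\<^sub>R (t *\<^sub>R y'')) (at s)"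
        unfolding comp_def by (rule bounded_linear.has_vector_derivative[OF bounded_linear_scaleR_right])
      then show "((\<lambda>s. t *\<^sub>R y' (t * s)) has_vector_derivative t\<^sup>2 *\<^sub>R y'') (at s)"
        by (simp add: power2_eq_square)
      fix w
      have "\<gamma> (t * s) \<in> fst c1" using ge e by (auto simp: geodesic_at_def)
      then have y: "snd c1 (\<gamma> (t * s)) \<in> snd c1 ` fst c1" by blast
      have "metric_coord A g c1 (snd c1 (\<gamma> (t * s))) y'' w +
          m1.chr (snd c1 (\<gamma> (t * s))) (y' (t * s)) (y' (t * s)) w = 0"
        using ge by (simp add: geodesic_at_def)
      then have "t\<^sup>2 * (metric_coord A g c1 (snd c1 (\<gamma> (t * s))) y'' w +
          m1.chr (snd c1 (\<gamma> (t * s))) (y' (t * s)) (y' (t * s)) w) = 0" by simp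
      then show "metric_coord A g c1 (snd c1 (\<gamma> (t * s))) (t\<^sup>2 *\<^sub>R y'') w +
          m1.chr (snd c1 (\<gamma> (t * s))) (t *\<^sub>R y' (t * s)) (t *\<^sub>R y' (t * s)) w = 0"
        by (simp only: linear_cmul[OF m1.linear_left[OF y]] linear_cmul[OF m1.chr_linear1[OF y]]
          linear_cmul[OF m1.chr_linear2[OF y]] distrib_left power2_eq_square real_scaleR_def mult.assoc)
    qed
    then show "\<exists>c\<in>A. \<exists>e y' y''. geodesic_at c (\<lambda>s. \<gamma> (t * s)) s e y' y''" using c1 by blast
  qed
  have 0: "0 \<in> J" "0 \<in> J'" using J J' by auto
  have px: "\<gamma> 0 \<in> fst c" using init c by simp
  have v: "chart_vel c \<gamma> 0 = \<xi>"
    using geodesic_chart_derivatives(4)[OF J(4) 0(1) c(1) px] init coord_vec_inject[OF c] by metis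
  have "((snd c \<circ> \<gamma>) has_vector_derivative \<xi>) (at (t * 0))"
    using geodesic_chart_derivatives(1)[OF J(4) 0(1) c(1) px] v by simp
  then have "((snd c \<circ> \<gamma>) \<circ> (\<lambda>s. t * s) has_vector_derivative t *\<^sub>R \<xi>) (at 0)"
    by (rule vector_diff_chain_at[rotated]) (auto intro!: derivative_eq_intros)
  then have d: "(snd c \<circ> (\<lambda>s. \<gamma> (t * s)) has_vector_derivative t *\<^sub>R \<xi>) (at 0)"
    by (simp add: comp_def)
  have "velocity A (\<lambda>s. \<gamma> (t * s)) 0 = coord_vec A c (\<gamma> (t * 0)) (t *\<^sub>R \<xi>)"
  proof (rule velocity_eq[OF c(1) _ _ d])
    show "\<forall>\<^sub>F s in nhds 0. \<gamma> (t * s) \<in> fst c"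
      using isCont_eventually[OF geodesic_isCont[OF geo 0(2)], of "\<lambda>x. x \<in> fst c"]
        eventually_chart[OF c] init by simp
  qed (use px in simp)
  then show ?thesis
    unfolding exp_geodesic_def using J' geo init by auto
qed

text \<open>Uniqueness of geodesics makes the definite description in \<open>exp_map\<close>
  meaningful; existence is supplied by \<open>\<gamma>\<close>.\<close>

lemma exp_map_eq:
  assumes "exp_geodesic A g p v \<gamma>"
  shows "exp_map A g p v = \<gamma> 1"
  unfolding exp_map_def
proof (rule the_equality)
  show "\<exists>\<gamma>'. exp_geodesic A g p v \<gamma>' \<and> \<gamma>' 1 = \<gamma> 1" using assms by blast
  fix q assume "\<exists>\<gamma>'. exp_geodesic A g p v \<gamma>' \<and> \<gamma>' 1 = q"
  then obtain \<gamma>' where \<gamma>': "exp_geodesic A g p v \<gamma>'" "\<gamma>' 1 = q" by blast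
  obtain J where J: "open J" "{0..1} \<subseteq> J" "geodesic_on A g J \<gamma>" "\<gamma> 0 = p" "velocity A \<gamma> 0 = v"
    using assms unfolding exp_geodesic_def by blast
  obtain J' where J': "open J'" "{0..1} \<subseteq> J'" "geodesic_on A g J' \<gamma>'" "\<gamma>' 0 = p" "velocity A \<gamma>' 0 = v"
    using \<gamma>'(1) unfolding exp_geodesic_def by blast
  have "\<gamma>' 1 = \<gamma> 1"
    by (rule geodesic_unique[OF J'(1-3) J(1-3)]) (use J J' in auto)
  then show "q = \<gamma> 1" using \<gamma>' by simp
qed

lemma E_ray:
  assumes "exp_geodesic A g p (coord_vec A c p \<xi>) \<gamma>" "t \<in> {0<..1}"
  shows "E (t *\<^sub>R \<xi>) = \<gamma> t"
  using exp_map_eq[OF exp_geodesic_scale[OF assms]] by (simp add: E_def)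

end

text \<open>The clauses of \<open>exp_diffeo_on_ball\<close> for a radius so small that the ball
  also lies in the chart domain, so that a single chart serves for all computations.\<close>

locale normal_ball = pointed_riemannian A g p c
  for A :: "('m::{t2_space,second_countable_topology}, 'e::euclidean_space) atlas" and g p c +
  fixes r :: real
  assumes r: "0 < r"
    and geo: "\<xi> \<in> D r \<Longrightarrow> \<exists>\<gamma>. exp_geodesic A g p (coord_vec A c p \<xi>) \<gamma>"
    and inj: "inj_on E (D r)"
    and open_ball: "open (E ` D r)"
    and E_smooth: "\<xi> \<in> D r \<Longrightarrow> smooth_map_at euclidean_atlas A \<xi> E"
    and inv_smooth: "z \<in> E ` D r \<Longrightarrow> smooth_map_at A euclidean_atlas z (inv_into (D r) E)"
    and in_chart: "E ` D r \<subseteq> fst c"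

context pointed_riemannian
begin

text \<open>Rescaling the zero vector changes nothing, so by \<open>E_ray\<close> the curve
  \<open>\<gamma>\<close> has the value \<open>E 0\<close> at all times in \<open>{0<..1}\<close>,
  and by continuity also at \<open>0\<close>, where it is \<open>p\<close>.\<close>

lemma E_0:
  assumes "exp_geodesic A g p (coord_vec A c p 0) \<gamma>"
  shows "E 0 = p"
proof -
  obtain J where J: "{0..1} \<subseteq> J" "geodesic_on A g J \<gamma>" and init: "\<gamma> 0 = p"
    using assms unfolding exp_geodesic_def by blast
  have "isCont \<gamma> 0" using geodesic_isCont[OF J(2), of 0] subsetD[OF J(1), of 0] by simp
  then have lim: "(\<gamma> \<longlongrightarrow> p) (at_right 0)" using init by (simp add: isCont_def filterlim_at_split)
  have "eventually (\<lambda>t. t \<in> {0<..<1}) (at_right (0::real))" by (rule eventually_at_right_real) simp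
  then have "eventually (\<lambda>t. \<gamma> t = E 0) (at_right 0)"
  proof eventually_elim
    case (elim t)
    then show ?case using E_ray[OF assms, of t] by simp
  qed
  from tendsto_cong[OF this] lim have "((\<lambda>t::real. E 0) \<longlongrightarrow> p) (at_right 0)" by blast
  then show ?thesis using tendsto_unique[OF trivial_limit_at_right_real] tendsto_const by blast
qed

end

text \<open>Since \<open>E\<close> is continuous at \<open>0\<close> with \<open>E 0 = p\<close>,
  the ball can be shrunk until its image lies in the domain of the chart that
  \<open>exp_diffeo_on_ball\<close> provides.\<close>

lemma (in riemannian) ex_normal_ball:
  assumes "0 < r" "exp_diffeo_on_ball A g p r"
  obtains c r' where "normal_ball A g p c r'"
proof -
  obtain c where c: "c \<in> A" "p \<in> fst c"
    and ex: "let D = {\<xi>. metric_coord A g c (snd c p) \<xi> \<xi> < r\<^sup>2};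
          E = (\<lambda>\<xi>. exp_map A g p (coord_vec A c p \<xi>))
      in (\<forall>\<xi>\<in>D. \<exists>\<gamma>. exp_geodesic A g p (coord_vec A c p \<xi>) \<gamma>) \<and>
         inj_on E D \<and> open (E ` D) \<and>
         (\<forall>\<xi>\<in>D. smooth_map_at euclidean_atlas A \<xi> E) \<and>
         (\<forall>z\<in>E ` D. smooth_map_at A euclidean_atlas z (inv_into D E))"
    using assms(2) unfolding exp_diffeo_on_ball_def by blast
  interpret P: pointed_riemannian A g p c by unfold_locales (use c in auto)
  have E: "(\<lambda>\<xi>. exp_map A g p (coord_vec A c p \<xi>)) = P.E" by (simp add: P.E_def fun_eq_iff)
  have D: "{\<xi>. metric_coord A g c (snd c p) \<xi> \<xi> < r\<^sup>2} = P.D r" by (simp add: P.D_def P.G_def)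
  have ex: "\<And>\<xi>. \<xi> \<in> P.D r \<Longrightarrow> \<exists>\<gamma>. exp_geodesic A g p (coord_vec A c p \<xi>) \<gamma>"
    "inj_on P.E (P.D r)" "open (P.E ` P.D r)"
    "\<And>\<xi>. \<xi> \<in> P.D r \<Longrightarrow> smooth_map_at euclidean_atlas A \<xi> P.E"
    "\<And>z. z \<in> P.E ` P.D r \<Longrightarrow> smooth_map_at A euclidean_atlas z (inv_into (P.D r) P.E)"
    using ex unfolding E D Let_def by auto
  have E0: "P.E 0 = p" using ex(1)[OF P.D_0[OF assms(1)]] P.E_0 by blast
  have "isCont P.E 0"
    using smooth_map_at_isCont[OF manifold_euclidean manifold_axioms ex(4)[OF P.D_0[OF assms(1)]]] .
  then have "eventually (\<lambda>\<xi>. P.E \<xi> \<in> fst c) (nhds 0)"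
    using isCont_eventually[of 0 P.E "\<lambda>x. x \<in> fst c"] eventually_chart[OF c] E0 by simp
  then obtain d where d: "d > 0" "\<And>\<xi>. dist \<xi> 0 < d \<Longrightarrow> P.E \<xi> \<in> fst c"
    unfolding eventually_nhds_metric by blast
  obtain l where l: "l > 0" "\<And>\<xi>. l * (norm \<xi>)\<^sup>2 \<le> P.G \<xi> \<xi>" using P.G_lower by blast
  \<comment> \<open>As \<open>l\<close> bounds \<open>G\<close> from below,
    \<open>G \<xi> \<xi> < l * d\<^sup>2\<close> forces \<open>norm \<xi> < d\<close>.\<close>
  define r' where "r' = min r (sqrt l * d)"
  have r': "0 < r'" "r' \<le> r" using assms(1) l d by (auto simp: r'_def)
  have sub: "P.D r' \<subseteq> P.D r" using r' by (intro P.D_mono) auto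
  have chart: "P.E \<xi> \<in> fst c" if "\<xi> \<in> P.D r'" for \<xi>
  proof -
    have "l * (norm \<xi>)\<^sup>2 < r'\<^sup>2" using l(2)[of \<xi>] that by (simp add: P.D_def)
    also have "r'\<^sup>2 \<le> (sqrt l * d)\<^sup>2" using r' by (intro power_mono) (auto simp: r'_def)
    also have "\<dots> = l * d\<^sup>2" using l(1) by (simp add: power_mult_distrib)
    finally have "(norm \<xi>)\<^sup>2 < d\<^sup>2" using l(1) by simp
    then have "norm \<xi> < d" using d(1) by (simp add: power_less_imp_less_base)
    then show ?thesis using d(2) by (simp add: dist_norm)
  qed
  let ?I = "inv_into (P.D r) P.E"
  \<comment> \<open>\<open>inv_into\<close> depends on the set on which it inverts; on the smaller
    image both inverses agree by injectivity on the larger ball.\<close>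
  have inv_eq: "inv_into (P.D r') P.E z = ?I z" if z: "z \<in> P.E ` P.D r'" for z
  proof -
    obtain \<xi> where "\<xi> \<in> P.D r'" "z = P.E \<xi>" using z by blast
    then show ?thesis
      using inv_into_f_f[OF ex(2), of \<xi>] inv_into_f_f[OF inj_on_subset[OF ex(2) sub], of \<xi>] sub by auto
  qed
  have "open (P.E ` P.D r')"
  proof -
    have "continuous_on (P.E ` P.D r) ?I"
      using smooth_map_at_isCont[OF manifold_axioms manifold_euclidean ex(5)]
      by (intro continuous_at_imp_continuous_on) auto
    then have "open (P.E ` P.D r \<inter> ?I -` P.D r')"
      using continuous_open_preimage ex(3) P.open_D by blast
    moreover have "P.E ` P.D r \<inter> ?I -` P.D r' = P.E ` P.D r'"
      using sub inv_into_f_f[OF ex(2)] by auto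
    ultimately show ?thesis by simp
  qed
  have "normal_ball A g p c r'"
  proof unfold_locales
    show "smooth_map_at A euclidean_atlas z (inv_into (P.D r') P.E)" if z: "z \<in> P.E ` P.D r'" for z
    proof -
      have z': "z \<in> P.E ` P.D r" using z sub by blast
      have "eventually (\<lambda>z. inv_into (P.D r') P.E z = ?I z) (nhds z)"
        using eventually_nhds_in_open[OF \<open>open (P.E ` P.D r')\<close> z] by eventually_elim (rule inv_eq)
      then obtain S where S: "open S" "z \<in> S" "\<And>y. y \<in> S \<Longrightarrow> ?I y = inv_into (P.D r') P.E y"
        unfolding eventually_nhds by auto
      have I: "smooth_at ((\<lambda>x. x) \<circ> ?I \<circ> chart_inv c') (snd c' z)" if "c' \<in> A" "z \<in> fst c'" for c'
        using smooth_map_at_iff[where h = ?I and c' = "(UNIV, \<lambda>x. x)", OF manifold_axioms manifold_euclidean that]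
          ex(5)[OF z'] by (simp add: euclidean_atlas_def)
      obtain c' where c': "c' \<in> A" "z \<in> fst c'" using ex_chart by blast
      have "eventually (\<lambda>y. ((\<lambda>x. x) \<circ> ?I \<circ> chart_inv c') y
          = ((\<lambda>x. x) \<circ> inv_into (P.D r') P.E \<circ> chart_inv c') y) (nhds (snd c' z))"
        using eventually_chart_inv[OF c' eventually_nhds_in_open[OF S(1,2)]]
        by eventually_elim (use S in simp)
      then have "smooth_at ((\<lambda>x. x) \<circ> inv_into (P.D r') P.E \<circ> chart_inv c') (snd c' z)"
        using I[OF c'] by (rule smooth_at_cong)
      then show ?thesis
        using smooth_map_at_iff[where h = "inv_into (P.D r') P.E" and c' = "(UNIV, \<lambda>x. x)",
            OF manifold_axioms manifold_euclidean c'] by (simp add: euclidean_atlas_def)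
    qed
    show "inj_on P.E (P.D r')" using ex(2) sub inj_on_subset by blast
    show "\<exists>\<gamma>. exp_geodesic A g p (coord_vec A c p \<xi>) \<gamma>" if "\<xi> \<in> P.D r'" for \<xi>
      using ex(1) that sub by blast
    show "smooth_map_at euclidean_atlas A \<xi> P.E" if "\<xi> \<in> P.D r'" for \<xi>
      using ex(4) that sub by blast
  qed (use r' chart \<open>open (P.E ` P.D r')\<close> in auto)
  then show ?thesis by (rule that)
qed

text \<open>The derivative exists off a finite set and need not be Lebesgue integrable, nor need
  \<open>f\<close> be measurable. The fundamental theorem holds for the gauge integral, which also
  gives measurability of the derivative; if the integral of its absolute value is infinite, the
  claim is trivial.\<close>

lemma abs_diff_le_nn_integral_derivative:
  fixes u f :: "real \<Rightarrow> real"
  assumes xy: "x \<le> y" and cont: "continuous_on {x..y} u" and S: "finite S"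
    and d: "\<And>t. t \<in> {x<..<y} - S \<Longrightarrow> (u has_real_derivative u' t) (at t) \<and> \<bar>u' t\<bar> \<le> f t"
  shows "ennreal \<bar>u y - u x\<bar> \<le> (\<integral>\<^sup>+ t\<in>{x..y}. ennreal (f t) \<partial>lborel)"
proof -
  define w where "w t = (if t \<in> {x<..<y} - S then u' t else 0)" for t
  define v where "v t = indicator {x..y} t *\<^sub>R w t" for t
  have "(w has_integral (u y - u x)) {x..y}"
    by (rule fundamental_theorem_of_calculus_interior_strong[OF S xy _ cont])
      (use d in \<open>auto simp: w_def has_real_derivative_iff_has_vector_derivative\<close>)
  moreover from this have meas: "v \<in> borel_measurable lebesgue"
    unfolding v_def by (rule has_integral_implies_lebesgue_measurable)
  moreover have "v = (\<lambda>t. if t \<in> {x..y} then w t else 0)"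
    by (auto simp: v_def fun_eq_iff indicator_def)
  ultimately have v: "(v has_integral (u y - u x)) UNIV"
    by (simp only: has_integral_restrict_UNIV)
  have le: "(\<integral>\<^sup>+ t. norm (v t) \<partial>lebesgue) \<le> (\<integral>\<^sup>+ t\<in>{x..y}. ennreal (f t) \<partial>lborel)"
    unfolding nn_integral_completion
    by (rule nn_integral_mono) (use d in \<open>auto simp: v_def w_def indicator_def intro!: ennreal_leI\<close>)
  show ?thesis
  proof (cases "(\<integral>\<^sup>+ t. norm (v t) \<partial>lebesgue) < \<infinity>")
    case True
    then have int: "integrable lebesgue v" using meas by (intro integrableI_bounded) auto
    then have "integral\<^sup>L lebesgue v = u y - u x"
      using has_integral_integral_lebesgue v has_integral_unique by blast
    then show ?thesis using integral_norm_bound_ennreal[OF int] le by simp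
  next
    case False
    then have "(\<integral>\<^sup>+ t. norm (v t) \<partial>lebesgue) = \<infinity>"
      by (metis top.not_eq_extremum infinity_ennreal_def)
    then show ?thesis using le by (simp add: top_unique)
  qed
qed

lemma (in metric_field) cauchy_schwarz:
  assumes y: "y \<in> \<Omega>"
  shows "\<bar>m y v w\<bar> \<le> sqrt (m y v v) * sqrt (m y w w)"
proof (cases "w = 0")
  case True
  then show ?thesis using linear_0[OF linear_right[OF y]] by simp
next
  case False
  define t where "t = m y v w / m y w w"
  have w: "m y w w > 0" by (rule pos[OF y False])
  have "0 \<le> m y (v - t *\<^sub>R w) (v - t *\<^sub>R w)" by (rule nonneg[OF y])
  also have "\<dots> = (m y v v - t * m y v w) - (t * m y w v - t * (t * m y w w))"
    by (simp only: linear_diff[OF linear_left[OF y]] linear_diff[OF linear_right[OF y]]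
      linear_cmul[OF linear_left[OF y]] linear_cmul[OF linear_right[OF y]] real_scaleR_def)
      (simp add: algebra_simps)
  also have "\<dots> = m y v v - 2 * t * m y v w + t * t * m y w w"
    using sym[OF y, of w v] by (simp add: algebra_simps)
  also have "\<dots> = m y v v - (m y v w)\<^sup>2 / m y w w"
    using w by (simp add: t_def power2_eq_square)
  finally have "(m y v w)\<^sup>2 \<le> m y v v * m y w w" using w by (simp add: field_simps)
  then have "sqrt ((m y v w)\<^sup>2) \<le> sqrt (m y v v * m y w w)" by (rule real_sqrt_le_mono)
  then show ?thesis by (simp add: real_sqrt_mult)
qed

section \<open>The Gauss lemma and the distance near a point\<close>

context normal_ball
begin

definition e :: "'e \<Rightarrow> 'e" where "e \<xi> = snd c (E \<xi>)"

abbreviation De :: "'e \<Rightarrow> 'e \<Rightarrow> 'e" where "De \<xi> \<equiv> frechet_derivative e (at \<xi>)"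

abbreviation mc :: "'e \<Rightarrow> 'e \<Rightarrow> 'e \<Rightarrow> real" where "mc \<equiv> metric_coord A g c"

lemma E_in: "\<xi> \<in> D r \<Longrightarrow> E \<xi> \<in> fst c"
  using in_chart by blast

lemma e_in: "\<xi> \<in> D r \<Longrightarrow> e \<xi> \<in> snd c ` fst c"
  using E_in unfolding e_def by blast

lemma euclidean_chart: "(UNIV, \<lambda>x. x) \<in> (euclidean_atlas :: ('a::euclidean_space, 'a) atlas)"
  by (simp add: euclidean_atlas_def)

lemma e_smooth: assumes "\<xi> \<in> D r" shows "smooth_at e \<xi>"
proof -
  have "smooth_at (snd c \<circ> E \<circ> chart_inv (UNIV, \<lambda>x. x)) (snd (UNIV :: 'e set, \<lambda>x. x) \<xi>)"
    using E_smooth[OF assms]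
      smooth_map_at_iff[where h = E, OF manifold_euclidean manifold_axioms euclidean_chart _ c(1), of \<xi>]
      E_in[OF assms] by simp
  moreover have "snd c \<circ> E \<circ> chart_inv (UNIV, \<lambda>x. x) = e" by (simp add: fun_eq_iff e_def)
  ultimately show ?thesis by simp
qed

lemma E_isCont: "\<xi> \<in> D r \<Longrightarrow> isCont E \<xi>"
  using smooth_map_at_isCont[OF manifold_euclidean manifold_axioms E_smooth] .

lemma E_zero: "E 0 = p"
  using geo[OF D_0[OF r]] E_0 by blast

lemma line: "((\<lambda>s. s *\<^sub>R \<xi>) has_vector_derivative \<xi>) (at t)"
  by (auto intro!: derivative_eq_intros)

lemma ray_has_derivative:
  "t *\<^sub>R \<xi> \<in> D r \<Longrightarrow> ((\<lambda>s. e (s *\<^sub>R \<xi>)) has_vector_derivative De (t *\<^sub>R \<xi>) \<xi>) (at t)"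
  by (rule has_vector_derivative_smooth_compose[OF line e_smooth])

lemma ray_velocity_has_derivative:
  assumes "t *\<^sub>R \<xi> \<in> D r"
  shows "((\<lambda>s. De (s *\<^sub>R \<xi>) \<xi>) has_vector_derivative
    frechet_derivative (\<lambda>z. De z \<xi>) (at (t *\<^sub>R \<xi>)) \<xi>) (at t)"
  by (rule has_vector_derivative_smooth_compose[OF line smooth_at_frechet_derivative[OF e_smooth[OF assms]]])

text \<open>By \<open>E_ray\<close> the curve \<open>e (t *\<^sub>R \<xi>)\<close> is the geodesic
  in coordinates, so its derivatives are the velocity and acceleration of the geodesic. The
  identification is available on \<open>{0..1}\<close> only: at \<open>0\<close> it is exploited
  through derivatives within that interval, and the equation is obtained in the interior.\<close>

lemma ray:
  assumes \<xi>: "\<xi> \<in> D r"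
  shows De_zero: "De 0 \<xi> = \<xi>"
    and ray_geodesic: "t \<in> {0<..<1} \<Longrightarrow>
      mc (e (t *\<^sub>R \<xi>)) (frechet_derivative (\<lambda>z. De z \<xi>) (at (t *\<^sub>R \<xi>)) \<xi>) w
      + m.chr (e (t *\<^sub>R \<xi>)) (De (t *\<^sub>R \<xi>) \<xi>) (De (t *\<^sub>R \<xi>) \<xi>) w = 0"
proof -
  obtain \<gamma> where \<gamma>: "exp_geodesic A g p (coord_vec A c p \<xi>) \<gamma>" using geo[OF \<xi>] by blast
  then obtain J where J: "open J" "{0..1} \<subseteq> J" "geodesic_on A g J \<gamma>"
    and init: "\<gamma> 0 = p" "velocity A \<gamma> 0 = coord_vec A c p \<xi>"
    unfolding exp_geodesic_def by blast
  have inJ: "t \<in> J" if "t \<in> {0..1}" for t using J(2) that by blast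
  have e_ray: "e (t *\<^sub>R \<xi>) = (snd c \<circ> \<gamma>) t" if "t \<in> {0..1}" for t
    using E_ray[OF \<gamma>, of t] E_zero init that by (cases "t = 0") (auto simp: e_def)
  have in_c: "\<gamma> t \<in> fst c" if "t \<in> {0..1}" for t
    using E_ray[OF \<gamma>, of t] E_in[OF D_scale[OF \<xi> that]] init c that by (cases "t = 0") auto
  note \<gamma>_d = geodesic_chart_derivatives[OF J(3) inJ c(1) in_c]
  have v: "chart_vel c \<gamma> t = De (t *\<^sub>R \<xi>) \<xi>" if t: "t \<in> {0<..<1}" for t
  proof -
    have "((\<lambda>s. e (s *\<^sub>R \<xi>)) has_vector_derivative chart_vel c \<gamma> t) (at t)"
      by (rule has_vector_derivative_transform_within_open[of "snd c \<circ> \<gamma>" _ _ "{0<..<1}"])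
        (use \<gamma>_d(1)[of t] t e_ray in auto)
    moreover have "t *\<^sub>R \<xi> \<in> D r" using t by (intro D_scale[OF \<xi>]) auto
    ultimately show ?thesis
      using ray_has_derivative vector_derivative_unique_at by blast
  qed
  show "De 0 \<xi> = \<xi>"
  proof -
    have "((snd c \<circ> \<gamma>) has_vector_derivative chart_vel c \<gamma> 0) (at 0 within {0..1})"
      using \<gamma>_d(1)[of 0] by (auto intro: has_vector_derivative_at_within)
    moreover have "((\<lambda>s. e (s *\<^sub>R \<xi>)) has_vector_derivative De 0 \<xi>) (at 0 within {0..1})"
      using ray_has_derivative[of 0 \<xi>] D_0[OF r] by (auto intro: has_vector_derivative_at_within)
    then have "((snd c \<circ> \<gamma>) has_vector_derivative De 0 \<xi>) (at 0 within {0..1})"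
      by (rule has_vector_derivative_transform[rotated 2]) (use e_ray in auto)
    ultimately have "chart_vel c \<gamma> 0 = De 0 \<xi>"
      using vector_derivative_unique_within_closed_interval[of 0 1 0] by (simp add: cbox_interval)
    moreover have "chart_vel c \<gamma> 0 = \<xi>"
      using \<gamma>_d(4)[of 0] init coord_vec_inject[OF c] by simp
    ultimately show ?thesis by simp
  qed
  show "mc (e (t *\<^sub>R \<xi>)) (frechet_derivative (\<lambda>z. De z \<xi>) (at (t *\<^sub>R \<xi>)) \<xi>) w
      + m.chr (e (t *\<^sub>R \<xi>)) (De (t *\<^sub>R \<xi>) \<xi>) (De (t *\<^sub>R \<xi>) \<xi>) w = 0" if t: "t \<in> {0<..<1}"
  proof -
    have t': "t \<in> {0..1}" using t by auto
    have "((\<lambda>s. De (s *\<^sub>R \<xi>) \<xi>) has_vector_derivative chart_acc c \<gamma> t) (at t)"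
      by (rule has_vector_derivative_transform_within_open[of "chart_vel c \<gamma>" _ _ "{0<..<1}"])
        (use \<gamma>_d(2)[OF t' t'] t v in auto)
    then have "chart_acc c \<gamma> t = frechet_derivative (\<lambda>z. De z \<xi>) (at (t *\<^sub>R \<xi>)) \<xi>"
      using ray_velocity_has_derivative[OF D_scale[OF \<xi> t']] vector_derivative_unique_at by blast
    then show ?thesis
      using \<gamma>_d(3)[OF t' t', of w] v[OF t] e_ray[OF t'] by simp
  qed
qed

text \<open>The derivative of the squared speed is twice the geodesic equation tested with the
  velocity, hence \<open>0\<close>; at \<open>t = 0\<close> the velocity is \<open>\<xi>\<close> by
  \<open>De_zero\<close>.\<close>

lemma energy:
  assumes \<xi>: "\<xi> \<in> D r" and t: "t \<in> {0..1}"
  shows "mc (e (t *\<^sub>R \<xi>)) (De (t *\<^sub>R \<xi>) \<xi>) (De (t *\<^sub>R \<xi>) \<xi>) = G \<xi> \<xi>"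
proof -
  let ?K = "\<lambda>s. mc (e (s *\<^sub>R \<xi>)) (De (s *\<^sub>R \<xi>) \<xi>) (De (s *\<^sub>R \<xi>) \<xi>)"
  let ?a = "\<lambda>s. frechet_derivative (\<lambda>z. De z \<xi>) (at (s *\<^sub>R \<xi>)) \<xi>"
  have d: "(?K has_real_derivative m.dm (e (s *\<^sub>R \<xi>)) (De (s *\<^sub>R \<xi>) \<xi>) (De (s *\<^sub>R \<xi>) \<xi>) (De (s *\<^sub>R \<xi>) \<xi>)
      + mc (e (s *\<^sub>R \<xi>)) (?a s) (De (s *\<^sub>R \<xi>) \<xi>) + mc (e (s *\<^sub>R \<xi>)) (De (s *\<^sub>R \<xi>) \<xi>) (?a s)) (at s)"
    if "s \<in> {0..1}" for s
    using D_scale[OF \<xi> that]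
    by (intro m.has_derivative_along ray_has_derivative ray_velocity_has_derivative e_in)
  have z: "(?K has_real_derivative 0) (at s)" if s: "s \<in> {0<..<1}" for s
  proof -
    have s': "s \<in> {0..1}" using s by auto
    have "mc (e (s *\<^sub>R \<xi>)) (?a s) (De (s *\<^sub>R \<xi>) \<xi>) = mc (e (s *\<^sub>R \<xi>)) (De (s *\<^sub>R \<xi>) \<xi>) (?a s)"
      by (rule m.sym[OF e_in[OF D_scale[OF \<xi> s']]])
    then show ?thesis
      using d[OF s'] ray_geodesic[OF \<xi> s, of "De (s *\<^sub>R \<xi>) \<xi>"] by (simp add: m.chr_def field_simps)
  qed
  have "?K t = ?K 0"
  proof (cases "t = 0")
    case False
    show ?thesis
    proof (rule DERIV_isconst_end[of 0 t ?K])
      show "continuous_on {0..t} ?K"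
        using t by (intro continuous_at_imp_continuous_on ballI DERIV_isCont[OF d]) auto
    qed (use False t z in auto)
  qed simp
  then show ?thesis using De_zero[OF \<xi>] E_zero by (simp add: G_def e_def)
qed

text \<open>Both sides of the first variation formula are \<open>1/2\<close> of the derivative of the energy in the
  direction of the variation field \<open>De (t \<xi>) (t \<eta>)\<close>.\<close>
lemma gauss_lemma:
  assumes \<xi>: "\<xi> \<in> D r"
  shows "mc (e \<xi>) (De \<xi> \<xi>) (De \<xi> \<eta>) = G \<xi> \<eta>"
proof -
  let ?v = "\<lambda>t. De (t *\<^sub>R \<xi>) \<xi>" and ?w = "\<lambda>t. De (t *\<^sub>R \<xi>) (t *\<^sub>R \<eta>)"
  let ?a = "\<lambda>t. frechet_derivative (\<lambda>z. De z \<xi>) (at (t *\<^sub>R \<xi>)) \<xi>"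
  let ?w' = "\<lambda>t. De (t *\<^sub>R \<xi>) \<eta> + frechet_derivative (\<lambda>z. De z (t *\<^sub>R \<eta>)) (at (t *\<^sub>R \<xi>)) \<xi>"
  let ?K = "\<lambda>t. mc (e (t *\<^sub>R \<xi>)) (?v t) (?w t)"
  have dw: "(?w has_vector_derivative ?w' t) (at t)" if "t \<in> {0..1}" for t
    by (rule has_vector_derivative_frechet_along[OF line line e_smooth[OF D_scale[OF \<xi> that]]])
  have d: "(?K has_real_derivative m.dm (e (t *\<^sub>R \<xi>)) (?v t) (?v t) (?w t)
      + mc (e (t *\<^sub>R \<xi>)) (?a t) (?w t) + mc (e (t *\<^sub>R \<xi>)) (?v t) (?w' t)) (at t)"
    if "t \<in> {0..1}" for t
    using D_scale[OF \<xi> that] that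
    by (intro m.has_derivative_along ray_has_derivative ray_velocity_has_derivative e_in dw)
  have K': "(?K has_real_derivative G \<xi> \<eta>) (at t)" if t: "t \<in> {0<..<1}" for t
  proof -
    have t': "t \<in> {0..1}" using t by auto
    have t\<xi>: "t *\<^sub>R \<xi> \<in> D r" by (rule D_scale[OF \<xi> t'])
    let ?y = "e (t *\<^sub>R \<xi>)"
    have y: "?y \<in> snd c ` fst c" by (rule e_in[OF t\<xi>])
    have lin\<xi>: "((\<lambda>s. \<xi> + s *\<^sub>R \<eta>) has_vector_derivative \<eta>) (at 0)"
      by (auto intro!: derivative_eq_intros)
    have lint: "((\<lambda>s. t *\<^sub>R (\<xi> + s *\<^sub>R \<eta>)) has_vector_derivative t *\<^sub>R \<eta>) (at 0)"
      by (auto intro!: derivative_eq_intros)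
    have t0: "t *\<^sub>R (\<xi> + 0 *\<^sub>R \<eta>) = t *\<^sub>R \<xi>" by simp
    let ?b = "De (t *\<^sub>R \<xi>) \<eta> + frechet_derivative (\<lambda>z. De z \<xi>) (at (t *\<^sub>R \<xi>)) (t *\<^sub>R \<eta>)"
    have de: "((\<lambda>s. e (t *\<^sub>R (\<xi> + s *\<^sub>R \<eta>))) has_vector_derivative ?w t) (at 0)"
      using has_vector_derivative_smooth_compose[OF lint, of e] e_smooth[OF t\<xi>] unfolding t0 by blast
    have dv: "((\<lambda>s. De (t *\<^sub>R (\<xi> + s *\<^sub>R \<eta>)) (\<xi> + s *\<^sub>R \<eta>)) has_vector_derivative ?b) (at 0)"
      using has_vector_derivative_frechet_along[OF lint lin\<xi>, of e] e_smooth[OF t\<xi>] unfolding t0 by simp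
    \<comment> \<open>The derivative in \<open>s\<close> of the velocity field equals the derivative
      in \<open>t\<close> of the variation field, because mixed second derivatives of
      \<open>e\<close> agree.\<close>
    have b: "?b = ?w' t" using smooth_at_symmetric[OF e_smooth[OF t\<xi>]] by simp
    have Q1: "((\<lambda>s. mc (e (t *\<^sub>R (\<xi> + s *\<^sub>R \<eta>))) (De (t *\<^sub>R (\<xi> + s *\<^sub>R \<eta>)) (\<xi> + s *\<^sub>R \<eta>))
        (De (t *\<^sub>R (\<xi> + s *\<^sub>R \<eta>)) (\<xi> + s *\<^sub>R \<eta>))) has_real_derivative
        m.dm ?y (?w t) (?v t) (?v t) + mc ?y ?b (?v t) + mc ?y (?v t) ?b) (at 0)"
      using m.has_derivative_along[OF de _ dv dv] y by simp
    have "continuous_on UNIV (\<lambda>s::real. \<xi> + s *\<^sub>R \<eta>)" by (intro continuous_intros)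
    then have "isCont (\<lambda>s::real. \<xi> + s *\<^sub>R \<eta>) 0" by (simp add: continuous_on_eq_continuous_at)
    then have "eventually (\<lambda>s. \<xi> + s *\<^sub>R \<eta> \<in> D r) (nhds (0::real))"
      by (rule isCont_eventually[where P = "\<lambda>\<xi>. \<xi> \<in> D r"]) (use eventually_nhds_in_open[OF open_D \<xi>] in simp)
    \<comment> \<open>Every neighbouring ray has constant energy, so the energy at time
      \<open>t\<close> is an explicit quadratic function of \<open>s\<close>.\<close>
    then have ev: "eventually (\<lambda>s. mc (e (t *\<^sub>R (\<xi> + s *\<^sub>R \<eta>))) (De (t *\<^sub>R (\<xi> + s *\<^sub>R \<eta>)) (\<xi> + s *\<^sub>R \<eta>))
        (De (t *\<^sub>R (\<xi> + s *\<^sub>R \<eta>)) (\<xi> + s *\<^sub>R \<eta>)) = G (\<xi> + s *\<^sub>R \<eta>) (\<xi> + s *\<^sub>R \<eta>)) (nhds 0)"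
      by eventually_elim (rule energy[OF _ t'])
    have Q2: "((\<lambda>s. G (\<xi> + s *\<^sub>R \<eta>) (\<xi> + s *\<^sub>R \<eta>)) has_real_derivative 2 * G \<xi> \<eta>) (at 0)"
      using bounded_bilinear.has_vector_derivative[OF G_bounded_bilinear lin\<xi> lin\<xi>] G_sym[of \<eta> \<xi>]
      by (simp add: has_real_derivative_iff_has_vector_derivative)
    have "m.dm ?y (?w t) (?v t) (?v t) + mc ?y ?b (?v t) + mc ?y (?v t) ?b = 2 * G \<xi> \<eta>"
      by (rule DERIV_unique[OF DERIV_cong_ev[OF refl ev refl, THEN iffD1, OF Q1] Q2])
    then have "m.dm ?y (?w t) (?v t) (?v t) / 2 + mc ?y (?v t) (?w' t) = G \<xi> \<eta>"
      using m.sym[OF y, of ?b "?v t"] unfolding b by simp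
    moreover have "mc ?y (?a t) (?w t) = m.dm ?y (?w t) (?v t) (?v t) / 2 - m.dm ?y (?v t) (?v t) (?w t)"
      using ray_geodesic[OF \<xi> t, of "?w t"] by (simp add: m.chr_def field_simps)
    ultimately show ?thesis using d[OF t'] by simp
  qed
  \<comment> \<open>\<open>?K\<close> has the constant derivative \<open>G \<xi> \<eta>\<close> and
    vanishes at \<open>0\<close> together with the variation field; its value at time
    \<open>1\<close> is the claim.\<close>
  have "?K 1 - 1 * G \<xi> \<eta> = ?K 0 - 0 * G \<xi> \<eta>"
  proof (rule DERIV_isconst_end[of 0 1 "\<lambda>t. ?K t - t * G \<xi> \<eta>"])
    show "continuous_on {0..1} (\<lambda>t. ?K t - t * G \<xi> \<eta>)"
    proof (rule continuous_on_diff)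
      show "continuous_on {0..1} ?K"
        by (intro continuous_at_imp_continuous_on ballI DERIV_isCont[OF d])
    qed (intro continuous_intros)
    show "((\<lambda>t. ?K t - t * G \<xi> \<eta>) has_real_derivative 0) (at t)" if "0 < t" "t < 1" for t
      using K'[of t] that by (auto intro!: derivative_eq_intros)
  qed simp
  moreover have "?K 0 = 0"
    using e_in[OF D_0[OF r]] linear_0[OF m.linear_right]
      linear_0[OF linear_frechet_derivative[OF smooth_at_differentiable[OF e_smooth[OF D_0[OF r]]]]]
    by simp
  ultimately show ?thesis by simp
qed

end

section \<open>Radius and length of curves\<close>

context riemannian
begin

text \<open>The definition lets each time choose its own chart, whereas the radius is computed in
  the chart of the normal ball; transition maps carry differentiability over. The exceptional set is
  the same for all charts.\<close>

lemma piecewise_C1_curve_chart: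
  assumes "piecewise_C1_curve A \<gamma>"
  shows "\<exists>S. finite S \<and> (\<forall>t\<in>{0<..<1} - S. \<forall>c\<in>A. \<gamma> t \<in> fst c \<longrightarrow>
       isCont \<gamma> t \<and> (\<exists>y'. ((snd c \<circ> \<gamma>) has_vector_derivative y') (at t)))"
proof -
  obtain S where S: "finite S" "\<And>t. t \<in> {0<..<1} - S \<Longrightarrow> \<exists>c\<in>A. \<exists>e>0.
        \<gamma> ` {t-e<..<t+e} \<subseteq> fst c \<and> (snd c \<circ> \<gamma>) C1_differentiable_on {t-e<..<t+e}"
    using assms unfolding piecewise_C1_curve_def by blast
  have "isCont \<gamma> t \<and> (\<exists>y'. ((snd c \<circ> \<gamma>) has_vector_derivative y') (at t))"
    if t: "t \<in> {0<..<1} - S" and c: "c \<in> A" "\<gamma> t \<in> fst c" for t c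
  proof -
    obtain c1 e where c1: "c1 \<in> A" and e: "e > 0" "\<gamma> ` {t-e<..<t+e} \<subseteq> fst c1"
      and C1: "(snd c1 \<circ> \<gamma>) C1_differentiable_on {t-e<..<t+e}"
      using S(2)[OF t] by blast
    have t_in: "t \<in> {t-e<..<t+e}" using e by simp
    then have x1: "\<gamma> t \<in> fst c1" using e by blast
    obtain y1 where y1: "((snd c1 \<circ> \<gamma>) has_vector_derivative y1) (at t)"
      using C1 t_in unfolding C1_differentiable_on_def by blast
    have ev: "eventually (\<lambda>s. \<gamma> s \<in> fst c1) (nhds t)"
      using eventually_nhds_in_open[OF open_greaterThanLessThan t_in]
      by eventually_elim (use e in blast)
    have "isCont (chart_inv c1 \<circ> (snd c1 \<circ> \<gamma>)) t"
      using chart_inv_isCont[OF c1 x1] y1 has_vector_derivative_continuous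
      by (intro isCont_comp[of t "snd c1 \<circ> \<gamma>" "chart_inv c1"]) auto
    moreover have "eventually (\<lambda>s. (chart_inv c1 \<circ> (snd c1 \<circ> \<gamma>)) s = \<gamma> s) (nhds t)"
      using ev by eventually_elim (use c1 in simp)
    ultimately have cont: "isCont \<gamma> t" using isCont_cong[of "chart_inv c1 \<circ> (snd c1 \<circ> \<gamma>)" \<gamma> t] by simp
    let ?T = "snd c \<circ> chart_inv c1"
    have d: "((\<lambda>s. ?T ((snd c1 \<circ> \<gamma>) s)) has_vector_derivative
        frechet_derivative ?T (at ((snd c1 \<circ> \<gamma>) t)) y1) (at t)"
      by (rule has_vector_derivative_smooth_compose[OF y1])
        (use transition_smooth_at[OF c1 c(1) x1 c(2)] in \<open>simp add: comp_def\<close>)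
    have e: "eventually (\<lambda>s. s \<in> UNIV \<longrightarrow> ?T ((snd c1 \<circ> \<gamma>) s) = (snd c \<circ> \<gamma>) s) (nhds t)"
      using ev by eventually_elim (use c1 in simp)
    have "((snd c \<circ> \<gamma>) has_vector_derivative frechet_derivative ?T (at ((snd c1 \<circ> \<gamma>) t)) y1) (at t)"
      using d has_vector_derivative_cong_ev[OF e] eventually_nhds_x_imp_x[OF e] by (simp add: comp_def)
    then show ?thesis using cont by blast
  qed
  then show ?thesis using S(1) by blast
qed

end

context normal_ball
begin

abbreviation I :: "'m \<Rightarrow> 'e" where "I \<equiv> inv_into (D r) E"

definition L :: "'e \<Rightarrow> 'e" where "L y = I (chart_inv c y)"

text \<open>The squared norm of the normal coordinates of \<open>z\<close>, identified with
  \<open>dist_sq\<close> on the ball in \<open>dist_sq_ball\<close>.\<close>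

definition R :: "'m \<Rightarrow> real" where "R z = G (I z) (I z)"

lemma I_E: "\<xi> \<in> D r \<Longrightarrow> I (E \<xi>) = \<xi>"
  using inv_into_f_f[OF inj] .

lemma E_I: "z \<in> E ` D r \<Longrightarrow> E (I z) = z" and I_in: "z \<in> E ` D r \<Longrightarrow> I z \<in> D r"
  by (auto simp: f_inv_into_f inv_into_into)

lemma I_isCont: "z \<in> E ` D r \<Longrightarrow> isCont I z"
  using smooth_map_at_isCont[OF manifold_axioms manifold_euclidean inv_smooth] .

lemma eventually_ball: "z \<in> E ` D r \<Longrightarrow> eventually (\<lambda>z. z \<in> E ` D r) (nhds z)"
  using eventually_nhds_in_open[OF open_ball] .

lemma L_smooth: assumes "z \<in> E ` D r" shows "smooth_at L (snd c z)"
proof -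
  have z: "z \<in> fst c" using assms in_chart by blast
  have "smooth_at ((\<lambda>x. x) \<circ> I \<circ> chart_inv c) (snd c z)"
    using smooth_map_at_iff[where h = I, OF manifold_axioms manifold_euclidean c(1) z euclidean_chart]
      inv_smooth[OF assms] by simp
  moreover have "(\<lambda>x. x) \<circ> I \<circ> chart_inv c = L" by (simp add: fun_eq_iff L_def)
  ultimately show ?thesis by simp
qed

lemma De_L:
  assumes z: "z \<in> E ` D r"
  shows "De (I z) (frechet_derivative L (at (snd c z)) w) = w"
proof -
  have zc: "z \<in> fst c" using z in_chart by blast
  have Lz: "L (snd c z) = I z" using zc c by (simp add: L_def)
  have d: "((\<lambda>y. e (L y)) has_derivative (\<lambda>w. De (L (snd c z)) (frechet_derivative L (at (snd c z)) w))) (at (snd c z))"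
    by (rule has_derivative_compose[where g = e, OF smooth_at_has_derivative[OF L_smooth[OF z]]])
      (use e_smooth[OF I_in[OF z]] Lz smooth_at_has_derivative in simp)
  have ev: "eventually (\<lambda>y. e (L y) = y) (nhds (snd c z))"
    using eventually_chart_inv[OF c(1) zc eventually_ball[OF z]] eventually_chart_image[OF c(1) zc]
  proof eventually_elim
    case (elim y)
    then show ?case using E_I by (simp add: e_def L_def f_inv_into_f)
  qed
  have "(\<lambda>w. De (L (snd c z)) (frechet_derivative L (at (snd c z)) w)) = (\<lambda>w. w)"
    using frechet_derivative_cong_eventually[OF ev] frechet_derivative_eq[OF d]
      frechet_derivative_eq[OF has_derivative_ident, of "snd c z"] by simp
  from fun_cong[OF this, of w] show ?thesis unfolding Lz .
qed

lemma R_nonneg: "0 \<le> R z"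
  unfolding R_def by (rule G_nonneg)

lemma R_isCont: "z \<in> E ` D r \<Longrightarrow> isCont R z"
proof -
  assume z: "z \<in> E ` D r"
  have "isCont (\<lambda>\<xi>. G \<xi> \<xi>) (I z)" using G_continuous by (simp add: continuous_on_eq_continuous_at)
  from isCont_comp[OF I_isCont[OF z] this] show ?thesis by (simp add: comp_def R_def[abs_def])
qed

text \<open>The Gauss lemma rewrites the derivative of \<open>R\<close> as twice the inner product
  of the radial vector with the velocity. Cauchy-Schwarz applies, and the radial vector has length
  \<open>sqrt R\<close>, again by the Gauss lemma.\<close>

lemma R_along_has_derivative:
  assumes z: "\<gamma> t \<in> E ` D r" and cont: "isCont \<gamma> t"
    and d: "((snd c \<circ> \<gamma>) has_vector_derivative y') (at t)"
  obtains R' where "((\<lambda>s. R (\<gamma> s)) has_real_derivative R') (at t)"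
    "\<bar>R'\<bar> \<le> 2 * sqrt (R (\<gamma> t)) * sqrt (g (\<gamma> t) (velocity A \<gamma> t) (velocity A \<gamma> t))"
    "0 \<le> g (\<gamma> t) (velocity A \<gamma> t) (velocity A \<gamma> t)"
proof -
  have zc: "\<gamma> t \<in> fst c" using z in_chart by blast
  let ?DL = "frechet_derivative L (at (snd c (\<gamma> t)))"
  let ?\<zeta> = "I (\<gamma> t)"
  have Lz: "L ((snd c \<circ> \<gamma>) t) = ?\<zeta>" using zc c by (simp add: L_def)
  have dL: "((\<lambda>s. L ((snd c \<circ> \<gamma>) s)) has_vector_derivative ?DL y') (at t)"
    using has_vector_derivative_smooth_compose[OF d, of L] L_smooth[OF z] by simp
  have dG: "((\<lambda>s. G (L ((snd c \<circ> \<gamma>) s)) (L ((snd c \<circ> \<gamma>) s))) has_real_derivative 2 * G ?\<zeta> (?DL y')) (at t)"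
    using bounded_bilinear.has_vector_derivative[OF G_bounded_bilinear dL dL] G_sym[of "?DL y'" ?\<zeta>] Lz
    by (simp add: has_real_derivative_iff_has_vector_derivative)
  have ev: "eventually (\<lambda>s. G (L ((snd c \<circ> \<gamma>) s)) (L ((snd c \<circ> \<gamma>) s)) = R (\<gamma> s)) (nhds t)"
    using isCont_eventually[OF cont eventually_ball[OF z]]
  proof eventually_elim
    case (elim s)
    then have "\<gamma> s \<in> fst c" using in_chart by blast
    then show ?case using c by (simp add: L_def R_def)
  qed
  show ?thesis
  proof (rule that)
    show "((\<lambda>s. R (\<gamma> s)) has_real_derivative 2 * G ?\<zeta> (?DL y')) (at t)"
      using dG DERIV_cong_ev[OF refl ev refl] by blast
    have y: "e ?\<zeta> = snd c (\<gamma> t)" using E_I[OF z] by (simp add: e_def)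
    have \<zeta>: "?\<zeta> \<in> D r" by (rule I_in[OF z])
    have "2 * G ?\<zeta> (?DL y') = 2 * mc (e ?\<zeta>) (De ?\<zeta> ?\<zeta>) (De ?\<zeta> (?DL y'))"
      using gauss_lemma[OF \<zeta>] by simp
    also have "\<dots> = 2 * mc (e ?\<zeta>) (De ?\<zeta> ?\<zeta>) y'" using De_L[OF z] by simp
    finally have "\<bar>2 * G ?\<zeta> (?DL y')\<bar> \<le> 2 * (sqrt (mc (e ?\<zeta>) (De ?\<zeta> ?\<zeta>) (De ?\<zeta> ?\<zeta>)) * sqrt (mc (e ?\<zeta>) y' y'))"
      using m.cauchy_schwarz[OF e_in[OF \<zeta>], of "De ?\<zeta> ?\<zeta>" y'] by simp
    also have "mc (e ?\<zeta>) (De ?\<zeta> ?\<zeta>) (De ?\<zeta> ?\<zeta>) = R (\<gamma> t)"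
      using gauss_lemma[OF \<zeta>, of ?\<zeta>] by (simp add: R_def)
    also have speed: "mc (e ?\<zeta>) y' y' = g (\<gamma> t) (velocity A \<gamma> t) (velocity A \<gamma> t)"
    proof -
      have "velocity A \<gamma> t = coord_vec A c (\<gamma> t) y'"
        by (rule velocity_eq[where ?\<gamma> = \<gamma>, OF c(1) zc isCont_eventually[OF cont eventually_chart[OF c(1) zc]] d])
      then show ?thesis unfolding y using metric_coord_chart[OF c(1) zc] by simp
    qed
    finally show "\<bar>2 * G ?\<zeta> (?DL y')\<bar> \<le>
        2 * sqrt (R (\<gamma> t)) * sqrt (g (\<gamma> t) (velocity A \<gamma> t) (velocity A \<gamma> t))"
      by (simp add: mult.assoc)
    show "0 \<le> g (\<gamma> t) (velocity A \<gamma> t) (velocity A \<gamma> t)"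
      using m.nonneg[OF e_in[OF \<zeta>], of y'] speed by simp
  qed
qed

text \<open>The constant \<open>\<kappa>\<close> removes the singularity of the radius at \<open>p\<close>.\<close>
lemma radius_change_le_length:
  assumes \<gamma>: "piecewise_C1_curve A \<gamma>" and xy: "0 \<le> x" "x \<le> y" "y \<le> 1"
    and ball: "\<gamma> ` {x..y} \<subseteq> E ` D r" and \<kappa>: "0 < \<kappa>"
  shows "ennreal \<bar>sqrt (R (\<gamma> y) + \<kappa>) - sqrt (R (\<gamma> x) + \<kappa>)\<bar> \<le> curve_length A g \<gamma>"
proof -
  obtain S where S: "finite S" "\<forall>t\<in>{0<..<1} - S. \<forall>c\<in>A. \<gamma> t \<in> fst c \<longrightarrow>
       isCont \<gamma> t \<and> (\<exists>y'. ((snd c \<circ> \<gamma>) has_vector_derivative y') (at t))"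
    using piecewise_C1_curve_chart[OF \<gamma>] by blast
  let ?u = "\<lambda>s. sqrt (R (\<gamma> s) + \<kappa>)"
  let ?f = "\<lambda>t. sqrt (g (\<gamma> t) (velocity A \<gamma> t) (velocity A \<gamma> t))"
  have pos: "0 < R z + \<kappa>" for z using R_nonneg[of z] \<kappa> by simp
  have "\<exists>u'. (?u has_real_derivative u') (at t) \<and> \<bar>u'\<bar> \<le> ?f t" if t: "t \<in> {x<..<y} - S" for t
  proof -
    have z: "\<gamma> t \<in> E ` D r" using ball t by auto
    then have zc: "\<gamma> t \<in> fst c" using in_chart by blast
    have "t \<in> {0<..<1} - S" using t xy by auto
    then obtain y' where "isCont \<gamma> t" "((snd c \<circ> \<gamma>) has_vector_derivative y') (at t)"
      using S(2) c(1) zc by blast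
    then obtain R' where R': "((\<lambda>s. R (\<gamma> s)) has_real_derivative R') (at t)"
      "\<bar>R'\<bar> \<le> 2 * sqrt (R (\<gamma> t)) * ?f t" "0 \<le> g (\<gamma> t) (velocity A \<gamma> t) (velocity A \<gamma> t)"
      using R_along_has_derivative[where ?\<gamma> = \<gamma> and t = t, OF z] by blast
    have "(?u has_real_derivative R' / (2 * sqrt (R (\<gamma> t) + \<kappa>))) (at t)"
      using R'(1) pos[of "\<gamma> t"] by (auto intro!: derivative_eq_intros simp: field_simps)
    moreover have "\<bar>R' / (2 * sqrt (R (\<gamma> t) + \<kappa>))\<bar> \<le> ?f t"
    proof -
      have "2 * sqrt (R (\<gamma> t)) * ?f t \<le> 2 * sqrt (R (\<gamma> t) + \<kappa>) * ?f t"
        using \<kappa> R'(3) by (intro mult_right_mono) auto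
      then have "\<bar>R'\<bar> \<le> 2 * sqrt (R (\<gamma> t) + \<kappa>) * ?f t" using R'(2) by linarith
      then show ?thesis using pos[of "\<gamma> t"] by (simp add: abs_mult field_simps)
    qed
    ultimately show ?thesis by blast
  qed
  then have "\<forall>t\<in>{x<..<y} - S. \<exists>u'. (?u has_real_derivative u') (at t) \<and> \<bar>u'\<bar> \<le> ?f t" by blast
  from bchoice[OF this] obtain u' where
    u': "\<forall>t\<in>{x<..<y} - S. (?u has_real_derivative u' t) (at t) \<and> \<bar>u' t\<bar> \<le> ?f t" by blast
  have "continuous_on {x..y} ?u"
  proof -
    have "continuous_on {x..y} (\<lambda>s. R (\<gamma> s))"
    proof (rule continuous_on_compose2[of "E ` D r" R])
      show "continuous_on (E ` D r) R"
        using R_isCont by (intro continuous_at_imp_continuous_on) auto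
      show "continuous_on {x..y} \<gamma>"
        using \<gamma> xy continuous_on_subset[of "{0..1}" \<gamma> "{x..y}"] unfolding piecewise_C1_curve_def by auto
    qed (use ball in auto)
    then show ?thesis by (intro continuous_intros)
  qed
  then have "ennreal \<bar>?u y - ?u x\<bar> \<le> (\<integral>\<^sup>+ t\<in>{x..y}. ennreal (?f t) \<partial>lborel)"
    by (rule abs_diff_le_nn_integral_derivative[OF xy(2) _ S(1)]) (use u' in blast)+
  also have "\<dots> \<le> curve_length A g \<gamma>"
    unfolding curve_length_def
    by (rule nn_integral_mono) (use xy in \<open>auto simp: indicator_def\<close>)
  finally show ?thesis .
qed

text \<open>\<open>G_lower\<close> makes the closed ball compact in the model space, so its image is
  compact, and closed in the Hausdorff space. This separates small closed balls from the points
  outside the normal ball.\<close>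

lemma D_closed_ball:
  assumes "0 < \<rho>" "\<rho> < r"
  shows "closed (E ` {\<xi>. G \<xi> \<xi> \<le> \<rho>\<^sup>2})" "{\<xi>. G \<xi> \<xi> \<le> \<rho>\<^sup>2} \<subseteq> D r"
proof -
  show sub: "{\<xi>. G \<xi> \<xi> \<le> \<rho>\<^sup>2} \<subseteq> D r"
    using assms power_strict_mono[of \<rho> r 2] by (auto simp: D_def)
  obtain l where l: "l > 0" "\<And>\<xi>. l * (norm \<xi>)\<^sup>2 \<le> G \<xi> \<xi>" using G_lower by blast
  have "closed {\<xi>. G \<xi> \<xi> \<le> \<rho>\<^sup>2}"
    using G_continuous by (intro closed_Collect_le) (auto intro: continuous_intros)
  moreover have "bounded {\<xi>. G \<xi> \<xi> \<le> \<rho>\<^sup>2}"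
  proof (rule boundedI[of _ "sqrt (\<rho>\<^sup>2 / l)"])
    fix \<xi> assume "\<xi> \<in> {\<xi>. G \<xi> \<xi> \<le> \<rho>\<^sup>2}"
    then have "(norm \<xi>)\<^sup>2 \<le> \<rho>\<^sup>2 / l" using l(1) l(2)[of \<xi>] by (simp add: field_simps)
    then show "norm \<xi> \<le> sqrt (\<rho>\<^sup>2 / l)" by (simp add: real_le_rsqrt)
  qed
  ultimately have "compact {\<xi>. G \<xi> \<xi> \<le> \<rho>\<^sup>2}" by (simp add: compact_eq_bounded_closed)
  then have "compact (E ` {\<xi>. G \<xi> \<xi> \<le> \<rho>\<^sup>2})"
    using sub E_isCont by (intro compact_continuous_image continuous_at_imp_continuous_on) auto
  then show "closed (E ` {\<xi>. G \<xi> \<xi> \<le> \<rho>\<^sup>2})" by (rule compact_imp_closed)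
qed

lemma open_sub_ball: assumes "0 \<le> \<rho>" "\<rho> \<le> r" shows "open (E ` D \<rho>)"
proof -
  have sub: "D \<rho> \<subseteq> D r" using assms by (intro D_mono)
  have "continuous_on (E ` D r) I"
    using I_isCont by (intro continuous_at_imp_continuous_on) auto
  then have "open (E ` D r \<inter> I -` D \<rho>)" using continuous_open_preimage open_ball open_D by blast
  moreover have "E ` D r \<inter> I -` D \<rho> = E ` D \<rho>" using sub I_E by auto
  ultimately show ?thesis by simp
qed

text \<open>At the first time outside the open ball of radius \<open>\<rho>\<close> the point is a
  limit of points of that ball, hence lies in the closed image of the closed ball. So its radius is
  exactly \<open>\<rho>\<close>, and up to then the curve stays where normal coordinates
  exist.\<close>

lemma first_exit:
  fixes s :: "real \<Rightarrow> 'm"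
  assumes cont: "continuous_on {0..1} s" and ends: "s 0 = p" "s 1 \<notin> E ` D \<rho>" and \<rho>: "0 < \<rho>" "\<rho> < r"
  obtains t where "t \<in> {0..1}" "s ` {0..t} \<subseteq> E ` D r" "R (s t) = \<rho>\<^sup>2"
proof -
  define Z where "Z = {t \<in> {0..1}. s t \<in> - (E ` D \<rho>)}"
  have "closed Z"
    unfolding Z_def using continuous_closed_preimage[OF cont closed_atLeastAtMost, of "- (E ` D \<rho>)"] open_sub_ball \<rho>
    by (simp add: Int_def vimage_def closed_Compl)
  moreover have Z1: "1 \<in> Z" using ends by (simp add: Z_def)
  moreover have bdd: "bdd_below Z" unfolding Z_def by (rule bdd_belowI[of _ 0]) auto
  ultimately have tZ: "Inf Z \<in> Z" by (intro closed_contains_Inf) auto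
  define t where "t = Inf Z"
  have t: "t \<in> {0..1}" "s t \<notin> E ` D \<rho>" using tZ by (auto simp: Z_def t_def)
  have below: "s u \<in> E ` D \<rho>" if "u \<in> {0..<t}" for u
  proof (rule ccontr)
    assume "s u \<notin> E ` D \<rho>"
    then have "u \<in> Z" using that t by (auto simp: Z_def)
    then show False using cInf_lower[OF _ bdd, of u] that by (simp add: t_def)
  qed
  have "p \<in> E ` D \<rho>" using E_zero D_0[OF \<rho>(1)] by force
  then have t0: "t > 0" using t ends by (cases "t = 0") auto
  let ?C = "{\<xi>. G \<xi> \<xi> \<le> \<rho>\<^sup>2}"
  have st: "s t \<in> E ` ?C"
  proof (rule Lim_in_closed_set[OF D_closed_ball(1)[OF \<rho>]])
    have "(s \<longlongrightarrow> s t) (at t within {0..1})" using cont t(1) by (simp add: continuous_on_def)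
    then show "(s \<longlongrightarrow> s t) (at t within {0..<t})"
      by (rule tendsto_within_subset) (use t in auto)
    have "E ` D \<rho> \<subseteq> E ` ?C" by (rule image_mono) (auto simp: D_def)
    then show "\<forall>\<^sub>F u in at t within {0..<t}. s u \<in> E ` ?C"
      unfolding eventually_at_filter by (intro eventuallyI impI) (use below in blast)
    show "at t within {0..<t} \<noteq> bot"
      using t0 by (simp add: at_within_eq_bot_iff)
  qed
  then obtain \<xi> where \<xi>: "G \<xi> \<xi> \<le> \<rho>\<^sup>2" "s t = E \<xi>" by blast
  have "\<xi> \<in> D r" using \<xi> D_closed_ball(2)[OF \<rho>] by blast
  moreover have "\<not> G \<xi> \<xi> < \<rho>\<^sup>2" using t(2) \<xi> by (auto simp: D_def)
  ultimately have "R (s t) = \<rho>\<^sup>2" using \<xi> I_E by (simp add: R_def)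
  moreover have "s ` {0..t} \<subseteq> E ` D r"
  proof
    fix z assume "z \<in> s ` {0..t}"
    then obtain u where u: "u \<in> {0..t}" "z = s u" by blast
    have "D \<rho> \<subseteq> D r" using \<rho> by (intro D_mono) auto
    then show "z \<in> E ` D r" using u below[of u] \<xi> \<open>\<xi> \<in> D r\<close> by (cases "u = t") auto
  qed
  ultimately show ?thesis using t that by blast
qed

text \<open>A curve from \<open>p\<close> to \<open>z\<close> is cut at its first exit, a curve from
  \<open>z\<close> to \<open>p\<close> at its last entry, by reversing time. Both directions are
  treated because \<open>riem_dist\<close> is an infimum over oriented curves and both orders of its
  arguments occur later.\<close>

lemma curve_length_ge:
  assumes \<gamma>: "piecewise_C1_curve A \<gamma>" and ends: "\<gamma> 0 = p \<and> \<gamma> 1 = z \<or> \<gamma> 0 = z \<and> \<gamma> 1 = p"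
    and z: "z \<notin> E ` D \<rho>" and \<rho>: "0 < \<rho>" "\<rho> < r"
  shows "ennreal \<rho> \<le> curve_length A g \<gamma>"
proof -
  have cont: "continuous_on {0..1} \<gamma>" using \<gamma> by (simp add: piecewise_C1_curve_def)
  have Rp: "R p = 0"
    using I_E[OF D_0[OF r]] E_zero by (simp add: R_def G_simps)
  have *: "ennreal \<bar>sqrt (\<rho>\<^sup>2 + \<kappa>) - sqrt \<kappa>\<bar> \<le> curve_length A g \<gamma>" if \<kappa>: "0 < \<kappa>" for \<kappa>
    using ends
  proof
    assume e: "\<gamma> 0 = p \<and> \<gamma> 1 = z"
    obtain t where t: "t \<in> {0..1}" "\<gamma> ` {0..t} \<subseteq> E ` D r" "R (\<gamma> t) = \<rho>\<^sup>2"
      using first_exit[OF cont _ _ \<rho>] e z by blast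
    show ?thesis
      using radius_change_le_length[OF \<gamma>, of 0 t \<kappa>] t \<kappa> e Rp by simp
  next
    assume e: "\<gamma> 0 = z \<and> \<gamma> 1 = p"
    let ?s = "\<lambda>u. \<gamma> (1 - u)"
    have "continuous_on {0..1} ?s"
      by (rule continuous_on_compose2[OF cont]) (auto intro: continuous_intros)
    then obtain t where t: "t \<in> {0..1}" "?s ` {0..t} \<subseteq> E ` D r" "R (?s t) = \<rho>\<^sup>2"
      using first_exit[of ?s \<rho>] e z \<rho> by auto
    have "\<gamma> ` {1 - t..1} \<subseteq> E ` D r"
    proof
      fix q assume "q \<in> \<gamma> ` {1 - t..1}"
      then obtain u where u: "u \<in> {1 - t..1}" "q = \<gamma> u" by blast
      then have "q = ?s (1 - u)" "1 - u \<in> {0..t}" by auto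
      then show "q \<in> E ` D r" using t(2) by blast
    qed
    then show ?thesis
      using radius_change_le_length[OF \<gamma>, of "1 - t" 1 \<kappa>] t \<kappa> e Rp by (simp add: abs_minus_commute)
  qed
  show ?thesis
  proof (cases "curve_length A g \<gamma>")
    case (real l)
    \<comment> \<open>The regularising constant is taken to be \<open>e\<^sup>2\<close>, so its root
      \<open>e\<close> disappears in the limit.\<close>
    have "\<rho> \<le> l + e" if e: "0 < e" for e
    proof -
      have "\<bar>sqrt (\<rho>\<^sup>2 + e\<^sup>2) - sqrt (e\<^sup>2)\<bar> \<le> l"
        using *[of "e\<^sup>2"] real e by (simp add: ennreal_le_iff)
      moreover have "\<rho> \<le> sqrt (\<rho>\<^sup>2 + e\<^sup>2)" by (simp add: real_le_rsqrt)
      moreover have "sqrt (e\<^sup>2) = e" using e by simp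
      ultimately show ?thesis using e by linarith
    qed
    then have "\<rho> \<le> l" by (rule field_le_epsilon)
    then show ?thesis using real by (simp add: ennreal_leI)
  qed simp
qed

section \<open>The distance from the centre of a normal ball\<close>

lemma riem_dist_E_le:
  assumes \<xi>: "\<xi> \<in> D r"
  shows "riem_dist A g p (E \<xi>) \<le> ennreal (sqrt (G \<xi> \<xi>))"
proof -
  let ?\<gamma> = "\<lambda>t. E (t *\<^sub>R \<xi>)"
  have ev: "eventually (\<lambda>s. ?\<gamma> s \<in> fst c) (nhds t)" if t: "t \<in> {0..1}" for t
  proof -
    have "continuous_on UNIV (\<lambda>s::real. s *\<^sub>R \<xi>)" by (intro continuous_intros)
    then have "isCont (\<lambda>s::real. s *\<^sub>R \<xi>) t" by (simp add: continuous_on_eq_continuous_at)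
    then have "eventually (\<lambda>s. s *\<^sub>R \<xi> \<in> D r) (nhds t)"
      using isCont_eventually[where P = "\<lambda>\<xi>. \<xi> \<in> D r"] eventually_nhds_in_open[OF open_D D_scale[OF \<xi> t]] by blast
    then show ?thesis by eventually_elim (rule E_in)
  qed
  have eq: "snd c \<circ> ?\<gamma> = (\<lambda>s. e (s *\<^sub>R \<xi>))" by (simp add: fun_eq_iff e_def)
  have speed: "g (?\<gamma> t) (velocity A ?\<gamma> t) (velocity A ?\<gamma> t) = G \<xi> \<xi>" if t: "t \<in> {0..1}" for t
  proof -
    have in_c: "?\<gamma> t \<in> fst c" by (rule E_in[OF D_scale[OF \<xi> t]])
    have "velocity A ?\<gamma> t = coord_vec A c (?\<gamma> t) (De (t *\<^sub>R \<xi>) \<xi>)"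
      by (rule velocity_eq[where ?\<gamma> = ?\<gamma>, OF c(1) in_c ev[OF t]])
        (use ray_has_derivative[OF D_scale[OF \<xi> t]] eq in simp)
    then show ?thesis
      using energy[OF \<xi> t] metric_coord_chart[OF c(1) in_c] by (simp add: e_def)
  qed
  have "piecewise_C1_curve A ?\<gamma>"
    unfolding piecewise_C1_curve_def
  proof (intro conjI exI[of _ "{}"] ballI)
    have "continuous_on (D r) E" using E_isCont by (intro continuous_at_imp_continuous_on) auto
    then show "continuous_on {0..1} ?\<gamma>"
      by (rule continuous_on_compose2) (use D_scale[OF \<xi>] in \<open>auto intro: continuous_intros\<close>)
    fix t :: real assume t: "t \<in> {0<..<1} - {}"
    define d where "d = min t (1 - t)"
    have dpos: "d > 0" using t by (auto simp: d_def)
    have sub: "s \<in> {0..1}" if "s \<in> {t - d<..<t + d}" for s using that t by (auto simp: d_def)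
    have "(snd c \<circ> ?\<gamma>) C1_differentiable_on {t - d<..<t + d}"
      unfolding C1_differentiable_on_def eq
    proof (intro exI[of _ "\<lambda>s. De (s *\<^sub>R \<xi>) \<xi>"] conjI ballI)
      show "((\<lambda>s. e (s *\<^sub>R \<xi>)) has_vector_derivative De (s *\<^sub>R \<xi>) \<xi>) (at s)" if "s \<in> {t - d<..<t + d}" for s
        by (rule ray_has_derivative[OF D_scale[OF \<xi> sub[OF that]]])
      show "continuous_on {t - d<..<t + d} (\<lambda>s. De (s *\<^sub>R \<xi>) \<xi>)"
        by (intro continuous_at_imp_continuous_on ballI
            has_vector_derivative_continuous[OF ray_velocity_has_derivative[OF D_scale[OF \<xi> sub]]])
    qed
    moreover have "?\<gamma> ` {t - d<..<t + d} \<subseteq> fst c"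
      using E_in[OF D_scale[OF \<xi> sub]] by blast
    ultimately show "\<exists>c\<in>A. \<exists>e>0. ?\<gamma> ` {t - e<..<t + e} \<subseteq> fst c \<and>
        (snd c \<circ> ?\<gamma>) C1_differentiable_on {t - e<..<t + e}"
      using c(1) dpos by blast
  qed simp
  moreover have "curve_length A g ?\<gamma> = ennreal (sqrt (G \<xi> \<xi>))"
  proof -
    have "curve_length A g ?\<gamma> = (\<integral>\<^sup>+ t. ennreal (sqrt (G \<xi> \<xi>)) * indicator {0..1::real} t \<partial>lborel)"
      unfolding curve_length_def by (rule nn_integral_cong) (use speed in \<open>auto simp: indicator_def\<close>)
    then show ?thesis by (simp add: nn_integral_cmult_indicator)
  qed
  ultimately show ?thesis
    unfolding riem_dist_def using E_zero by (intro INF_lower2[of ?\<gamma>]) auto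
qed

lemma riem_dist_ge:
  assumes "z \<notin> E ` D \<rho>" "0 < \<rho>" "\<rho> < r"
  shows "ennreal \<rho> \<le> riem_dist A g p z" "ennreal \<rho> \<le> riem_dist A g z p"
  unfolding riem_dist_def using assms by (auto intro!: INF_greatest curve_length_ge[of _ z \<rho>])

text \<open>For the lower bound, injectivity of \<open>E\<close> puts \<open>E \<xi>\<close> outside
  the open ball of its own radius \<open>sqrt (G \<xi> \<xi>)\<close>, and
  \<open>riem_dist_ge\<close> applies with this radius.\<close>

lemma riem_dist_E:
  assumes \<xi>: "\<xi> \<in> D r"
  shows "riem_dist A g p (E \<xi>) = ennreal (sqrt (G \<xi> \<xi>))"
proof (rule antisym[OF riem_dist_E_le[OF \<xi>]])
  show "ennreal (sqrt (G \<xi> \<xi>)) \<le> riem_dist A g p (E \<xi>)"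
  proof (cases "G \<xi> \<xi> = 0")
    case False
    let ?\<rho> = "sqrt (G \<xi> \<xi>)"
    have \<rho>: "0 < ?\<rho>" "?\<rho>\<^sup>2 = G \<xi> \<xi>" using False G_nonneg[of \<xi>] by auto
    then have lt: "?\<rho> < r" using \<xi> r by (simp add: D_def real_sqrt_less_iff real_less_lsqrt)
    have sub: "D ?\<rho> \<subseteq> D r" using \<rho> lt by (intro D_mono) auto
    have "E \<xi> \<notin> E ` D ?\<rho>"
    proof
      assume "E \<xi> \<in> E ` D ?\<rho>"
      then obtain \<eta> where "\<eta> \<in> D ?\<rho>" "E \<xi> = E \<eta>" by blast
      then have "\<xi> \<in> D ?\<rho>" using inj \<xi> sub by (metis inj_onD subsetD)
      then show False using \<rho>(2) by (simp add: D_def)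
    qed
    then show ?thesis using riem_dist_ge(1) \<rho>(1) lt by blast
  qed simp
qed

lemma riem_dist_self: "riem_dist A g p p = 0"
  using riem_dist_E[OF D_0[OF r]] E_zero by (simp add: G_simps)

text \<open>With the arguments in this order, strict positivity is what uniqueness of the minimiser
  in \<open>is_riemannian_mean\<close> amounts to for a variable that is almost surely
  \<open>p\<close>.\<close>

lemma riem_dist_pos: assumes "q \<noteq> p" shows "0 < riem_dist A g q p"
proof (cases "q \<in> E ` D r")
  case False
  then have "q \<notin> E ` D (r / 2)" using D_mono[of "r / 2" r] r by auto
  then have "ennreal (r / 2) \<le> riem_dist A g q p" using r by (intro riem_dist_ge) auto
  then show ?thesis using r by (metis ennreal_less_zero_iff half_gt_zero less_le_trans)
next
  case True
  then obtain \<xi> where \<xi>: "\<xi> \<in> D r" "q = E \<xi>" by blast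
  have "G \<xi> \<xi> \<noteq> 0" using \<xi> assms E_zero G_eq_0_iff by auto
  then have \<rho>: "0 < sqrt (G \<xi> \<xi>)" using G_nonneg[of \<xi>] by simp
  define \<rho> where "\<rho> = sqrt (G \<xi> \<xi>) / 2"
  have \<rho>: "0 < \<rho>" "\<rho>\<^sup>2 < G \<xi> \<xi>" using \<rho> G_nonneg[of \<xi>] by (auto simp: \<rho>_def power_divide)
  have "sqrt (G \<xi> \<xi>) < r" using \<xi>(1) r by (simp add: D_def real_less_lsqrt)
  then have lt: "\<rho> < r" using \<rho>(1) unfolding \<rho>_def by linarith
  have "q \<notin> E ` D \<rho>"
  proof
    assume "q \<in> E ` D \<rho>"
    then obtain \<eta> where \<eta>: "\<eta> \<in> D \<rho>" "q = E \<eta>" by blast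
    have "D \<rho> \<subseteq> D r" using \<rho>(1) lt by (intro D_mono) auto
    then have "\<eta> \<in> D r" using \<eta>(1) by blast
    then have "\<xi> = \<eta>" using inj_onD[OF inj, of \<xi> \<eta>] \<xi> \<eta>(2) by simp
    then have "\<xi> \<in> D \<rho>" using \<eta>(1) by simp
    then show False using \<rho>(2) by (simp add: D_def)
  qed
  then have "ennreal \<rho> \<le> riem_dist A g q p" using \<rho>(1) lt by (intro riem_dist_ge)
  then show ?thesis using \<rho>(1) by (metis ennreal_less_zero_iff less_le_trans)
qed

lemma dist_sq_ball: assumes "z \<in> E ` D r" shows "dist_sq A g p z = R z"
  using riem_dist_E[OF I_in[OF assms]] E_I[OF assms] G_nonneg
  by (simp add: dist_sq_def R_def enn2real_ennreal)

lemma dist_sq_smooth: assumes z: "z \<in> E ` D r" shows "smooth_fun_at A z (dist_sq A g p)"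
proof -
  have zc: "z \<in> fst c" using z in_chart by blast
  have "smooth_at (\<lambda>y. G (L y) (L y)) (snd c z)"
    by (rule smooth_at_bilinear[OF G_bounded_bilinear L_smooth[OF z] L_smooth[OF z]])
  moreover have "eventually (\<lambda>y. G (L y) (L y) = (dist_sq A g p \<circ> chart_inv c) y) (nhds (snd c z))"
    using eventually_chart_inv[OF c(1) zc eventually_ball[OF z]]
    by eventually_elim (simp add: dist_sq_ball R_def L_def)
  ultimately have "smooth_at (dist_sq A g p \<circ> chart_inv c) (snd c z)"
    by (rule smooth_at_cong[rotated])
  then show ?thesis using smooth_fun_at_iff[OF c(1) zc] by blast
qed

end

section \<open>The truncated squared distance\<close>

context normal_ball
begin

text \<open>Where \<open>\<kappa> \<le> R z\<close> inside the ball, the first branch already has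
  the constant value of the second, so for \<open>\<kappa> < r\<^sup>2\<close> the branches fit
  together without a seam.\<close>

definition cutoff :: "real \<Rightarrow> 'm \<Rightarrow> real" where
  "cutoff \<kappa> z = (if z \<in> E ` D r then cap \<kappa> (R z) else cap \<kappa> \<kappa>)"

lemma cutoff_near:
  assumes "z \<in> E ` D r"
  shows "eventually (\<lambda>y. cap \<kappa> (dist_sq A g p y) = cutoff \<kappa> y) (nhds z)"
  using eventually_ball[OF assms] by eventually_elim (simp add: cutoff_def dist_sq_ball)

text \<open>The image of the closed ball of radius \<open>sqrt \<kappa>\<close> is closed and does
  not contain \<open>z\<close>, so a whole neighbourhood of \<open>z\<close> avoids it, and on that
  neighbourhood both branches have the same constant value.\<close>

lemma cutoff_const_near:
  assumes \<kappa>: "0 < \<kappa>" "\<kappa> < r\<^sup>2" and z: "z \<notin> E ` D r"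
  shows "eventually (\<lambda>y. cutoff \<kappa> y = cap \<kappa> \<kappa>) (nhds z)"
proof -
  let ?C = "{\<xi>. G \<xi> \<xi> \<le> (sqrt \<kappa>)\<^sup>2}"
  have \<rho>: "0 < sqrt \<kappa>" "sqrt \<kappa> < r" using \<kappa> r by (auto intro: real_less_lsqrt)
  have "z \<in> - (E ` ?C)" using z D_closed_ball(2)[OF \<rho>] by blast
  then have "eventually (\<lambda>y. y \<in> - (E ` ?C)) (nhds z)"
    using D_closed_ball(1)[OF \<rho>] by (intro eventually_nhds_in_open) auto
  then show ?thesis
  proof eventually_elim
    case (elim y)
    have "\<kappa> \<le> R y" if y: "y \<in> E ` D r"
    proof (rule ccontr)
      assume "\<not> \<kappa> \<le> R y"
      then have "I y \<in> ?C" using \<kappa> by (simp add: R_def)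
      then have "E (I y) \<in> E ` ?C" by (rule imageI)
      then show False using elim E_I[OF y] by simp
    qed
    then show ?case using cap_const[of \<kappa> "R y"] by (simp add: cutoff_def)
  qed
qed

lemma cutoff_smooth:
  assumes "0 < \<kappa>" "\<kappa> < r\<^sup>2"
  shows "smooth_fun A (cutoff \<kappa>)"
  unfolding smooth_fun_def
proof
  fix z
  show "smooth_fun_at A z (cutoff \<kappa>)"
  proof (cases "z \<in> E ` D r")
    case True
    show ?thesis
      by (rule smooth_fun_at_cong[OF smooth_fun_at_real_compose[OF dist_sq_smooth[OF True] smooth_at_cap]
            cutoff_near[OF True]])
  next
    case False
    have "eventually (\<lambda>y. cap \<kappa> \<kappa> = cutoff \<kappa> y) (nhds z)"
      using cutoff_const_near[OF assms False] by eventually_elim simp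
    then show ?thesis by (rule smooth_fun_at_cong[OF smooth_fun_at_const])
  qed
qed

lemma cutoff_nonneg: "0 < \<kappa> \<Longrightarrow> 0 \<le> cutoff \<kappa> z"
  using R_nonneg[of z] cap_pos[of "R z" \<kappa>] cap_pos[of \<kappa> \<kappa>] by (cases "R z = 0") (auto simp: cutoff_def)

lemma cutoff_eq_0_iff: assumes "0 < \<kappa>" shows "cutoff \<kappa> z = 0 \<longleftrightarrow> z = p"
proof
  assume 0: "cutoff \<kappa> z = 0"
  have z: "z \<in> E ` D r" using 0 cap_pos[OF assms assms] by (auto simp: cutoff_def split: if_splits)
  then have "R z = 0" using 0 R_nonneg[of z] cap_pos[of "R z" \<kappa>] assms
    by (cases "R z = 0") (auto simp: cutoff_def)
  then have "I z = 0" by (simp add: R_def G_eq_0_iff)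
  then show "z = p" using E_I[OF z] E_zero by simp
next
  assume "z = p"
  then show "cutoff \<kappa> z = 0"
    using I_E[OF D_0[OF r]] E_zero imageI[OF D_0[OF r], of E] by (simp add: cutoff_def R_def G_simps)
qed

end

section \<open>Chain rule for second order operators\<close>

context manifold
begin

lemma partial1_cong:
  assumes "c \<in> A" "x \<in> fst c" "eventually (\<lambda>y. f y = f' y) (nhds x)"
  shows "eventually (\<lambda>y. partial1 c i f y = partial1 c i f' y) (nhds (snd c x))"
proof -
  have "eventually (\<lambda>y. (f \<circ> chart_inv c) y = (f' \<circ> chart_inv c) y) (nhds (snd c x))"
    using eventually_chart_inv[OF assms] by simp
  then obtain S where S: "open S" "snd c x \<in> S" "\<And>y. y \<in> S \<Longrightarrow> (f \<circ> chart_inv c) y = (f' \<circ> chart_inv c) y"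
    unfolding eventually_nhds by blast
  show ?thesis
    using eventually_nhds_in_open[OF S(1,2)]
  proof eventually_elim
    case (elim y)
    have "eventually (\<lambda>y. (f \<circ> chart_inv c) y = (f' \<circ> chart_inv c) y) (nhds y)"
      using eventually_nhds_in_open[OF S(1) elim] by eventually_elim (rule S(3))
    from frechet_derivative_cong_eventually[OF this] show ?case by (simp add: partial1_def comp_def)
  qed
qed

text \<open>\<open>partial2\<close> differentiates \<open>partial1\<close> as a function, so the
  first partial derivatives must agree near the point and not only at it; this is what
  \<open>partial1_cong\<close> provides.\<close>

lemma coord_op_cong:
  assumes "c \<in> A" "x \<in> fst c" "eventually (\<lambda>y. f y = f' y) (nhds x)"
  shows "coord_op A c x a b f = coord_op A c x a b f'"
proof -
  have "smooth_fun_at A x f \<longleftrightarrow> smooth_fun_at A x f'"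
    using smooth_fun_at_cong[OF _ assms(3)] smooth_fun_at_cong[of x f' f] assms(3)
    by (auto simp: eq_commute)
  moreover have "partial1 c i f (snd c x) = partial1 c i f' (snd c x)" for i
    using eventually_nhds_x_imp_x[OF partial1_cong[OF assms]] .
  moreover have "partial2 c i j f (snd c x) = partial2 c i j f' (snd c x)" for i j
    unfolding partial2_def using frechet_derivative_cong_eventually[OF partial1_cong[OF assms]] by simp
  ultimately show ?thesis by (simp add: coord_op_def)
qed

lemma coord_op_const: "coord_op A c x a b (\<lambda>y. k) = 0"
proof -
  have "partial1 c i (\<lambda>y. k) = (\<lambda>y. 0)" for i
    by (simp add: fun_eq_iff partial1_def comp_def frechet_derivative_const)
  then show ?thesis by (simp add: coord_op_def partial2_def frechet_derivative_const)
qed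

text \<open>A second derivative of \<open>\<psi> (f y)\<close> is \<open>\<psi>'\<close> times that
  of \<open>f\<close> plus \<open>\<psi>''\<close> times a product of two first derivatives;
  contracted with \<open>b\<close>, the products form the extra term.\<close>

lemma coord_op_chain:
  assumes c: "c \<in> A" "x \<in> fst c" and f: "smooth_fun_at A x f"
    and \<psi>: "\<And>s. (\<psi> has_real_derivative \<psi>' s) (at s)" "\<And>s. (\<psi>' has_real_derivative \<psi>'' s) (at s)"
    and smooth: "smooth_at \<psi> (f x)"
  shows "coord_op A c x a b (\<lambda>y. \<psi> (f y)) = \<psi>' (f x) * coord_op A c x a b f
    + \<psi>'' (f x) * (\<Sum>i\<in>Basis. \<Sum>j\<in>Basis. b i j * (partial1 c i f (snd c x) * partial1 c j f (snd c x)))"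
proof -
  let ?F = "f \<circ> chart_inv c" and ?y = "snd c x"
  have F: "smooth_at ?F ?y" using f smooth_fun_at_iff[OF c] by blast
  have Fy: "?F ?y = f x" using c by simp
  have d1: "partial1 c i (\<lambda>y. \<psi> (f y)) y = \<psi>' (?F y) * partial1 c i f y" if "smooth_at ?F y" for i y
  proof -
    have "((\<lambda>y. \<psi> (?F y)) has_derivative (\<lambda>v. \<psi>' (?F y) * frechet_derivative ?F (at y) v)) (at y)"
      using smooth_at_has_derivative[OF that] \<psi>(1)[of "?F y"] unfolding has_field_derivative_def
      by (rule has_derivative_compose)
    from frechet_derivative_eq[OF this] show ?thesis by (simp add: partial1_def comp_def)
  qed
  have d1': "partial1 c i (\<lambda>y. \<psi> (f y)) ?y = \<psi>' (f x) * partial1 c i f ?y" for i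
    using d1[OF F] Fy by simp
  have d2: "partial2 c i j (\<lambda>y. \<psi> (f y)) ?y =
      \<psi>'' (f x) * (partial1 c i f ?y * partial1 c j f ?y) + \<psi>' (f x) * partial2 c i j f ?y" for i j
  proof -
    have ev: "eventually (\<lambda>y. partial1 c j (\<lambda>y. \<psi> (f y)) y = \<psi>' (?F y) * partial1 c j f y) (nhds ?y)"
      using smooth_at_eventually[OF F] by eventually_elim (rule d1)
    have "((\<lambda>y. \<psi>' (?F y)) has_derivative (\<lambda>v. \<psi>'' (?F ?y) * frechet_derivative ?F (at ?y) v)) (at ?y)"
      using smooth_at_has_derivative[OF F] \<psi>(2)[of "?F ?y"] unfolding has_field_derivative_def
      by (rule has_derivative_compose)
    moreover have "(partial1 c j f has_derivative frechet_derivative (partial1 c j f) (at ?y)) (at ?y)"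
      unfolding partial1_def[abs_def]
      by (rule smooth_at_has_derivative[OF smooth_at_frechet_derivative[OF F]])
    ultimately have "((\<lambda>y. \<psi>' (?F y) * partial1 c j f y) has_derivative
        (\<lambda>v. \<psi>' (?F ?y) * frechet_derivative (partial1 c j f) (at ?y) v
          + \<psi>'' (?F ?y) * frechet_derivative ?F (at ?y) v * partial1 c j f ?y)) (at ?y)"
      by (rule has_derivative_mult)
    from frechet_derivative_eq[OF this] show ?thesis
      unfolding partial2_def frechet_derivative_cong_eventually[OF ev]
      using Fy by (simp add: partial1_def)
  qed
  have "smooth_fun_at A x (\<lambda>y. \<psi> (f y))" by (rule smooth_fun_at_real_compose[OF f smooth])
  then show ?thesis
    using f unfolding coord_op_def d1' d2
    by (simp add: sum_distrib_left sum.distrib distrib_left mult_ac)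
qed

lemma coord_vec_partial1:
  "smooth_fun_at A x f \<Longrightarrow> coord_vec A c x y f = (\<Sum>i\<in>Basis. (y \<bullet> i) * partial1 c i f (snd c x))"
  by (simp add: coord_vec_def coord_op_def)

lemma tangent_cong:
  assumes "v \<in> tangent_space A x" "eventually (\<lambda>y. f y = f' y) (nhds x)"
  shows "v f = v f'"
  using assms coord_op_cong unfolding tangent_space_def coord_vec_def by blast

lemma tangent_const: "v \<in> tangent_space A x \<Longrightarrow> v (\<lambda>y. k) = 0"
  using coord_op_const unfolding tangent_space_def coord_vec_def by blast

lemma tangent_chain:
  assumes "v \<in> tangent_space A x" and f: "smooth_fun_at A x f"
    and \<psi>: "\<And>s. (\<psi> has_real_derivative \<psi>' s) (at s)" "\<And>s. (\<psi>' has_real_derivative \<psi>'' s) (at s)"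
    and smooth: "smooth_at \<psi> (f x)"
  shows "v (\<lambda>y. \<psi> (f y)) = \<psi>' (f x) * v f"
proof -
  obtain c a where c: "c \<in> A" "x \<in> fst c" "v = coord_vec A c x a"
    using assms(1) unfolding tangent_space_def by blast
  show ?thesis
    using coord_op_chain[OF c(1,2) f \<psi> smooth, of a "\<lambda>_ _. 0"] unfolding c(3) coord_vec_def by simp
qed

lemma generator_cong:
  assumes G: "diffusion_generator A G" "v \<in> tangent_space A x" and ev: "eventually (\<lambda>y. f y = f' y) (nhds x)"
  shows "G x v f = G x v f'"
proof -
  have "G x v \<in> diffusion_space A x" using G unfolding diffusion_generator_def by blast
  then obtain c a b where c: "c \<in> A" "x \<in> fst c" "G x v = coord_op A c x a b"
    unfolding diffusion_space_def by blast
  show ?thesis unfolding c(3) by (rule coord_op_cong[OF c(1,2) ev])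
qed

lemma generator_const:
  assumes "diffusion_generator A G" "v \<in> tangent_space A x"
  shows "G x v (\<lambda>y. k) = 0"
proof -
  have "G x v \<in> diffusion_space A x" using assms unfolding diffusion_generator_def by blast
  then obtain c a b where c: "G x v = coord_op A c x a b"
    unfolding diffusion_space_def by blast
  show ?thesis unfolding c by (rule coord_op_const)
qed

text \<open>The symmetric part of \<open>G x v\<close> is \<open>v \<otimes> v\<close>, so the extra
  second order term is the square of \<open>v f\<close>. Here lies the Ito correction of the whole
  argument.\<close>

lemma generator_chain:
  assumes G: "diffusion_generator A G" "v \<in> tangent_space A x" and f: "smooth_fun_at A x f"
    and \<psi>: "\<And>s. (\<psi> has_real_derivative \<psi>' s) (at s)" "\<And>s. (\<psi>' has_real_derivative \<psi>'' s) (at s)"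
    and smooth: "smooth_at \<psi> (f x)"
  shows "G x v (\<lambda>y. \<psi> (f y)) = \<psi>' (f x) * G x v f + \<psi>'' (f x) * (v f)\<^sup>2"
proof -
  obtain c y where c: "c \<in> A" "x \<in> fst c" "v = coord_vec A c x y"
    using G(2) unfolding tangent_space_def by blast
  then have "has_sym_part A c x (G x v) (\<lambda>i j. (y \<bullet> i) * (y \<bullet> j))"
    using G unfolding diffusion_generator_def by blast
  then obtain a where a: "G x v = coord_op A c x a (\<lambda>i j. (y \<bullet> i) * (y \<bullet> j))"
    unfolding has_sym_part_def by blast
  have "(v f)\<^sup>2 = (\<Sum>i\<in>Basis. \<Sum>j\<in>Basis. (y \<bullet> i) * (y \<bullet> j) * (partial1 c i f (snd c x) * partial1 c j f (snd c x)))"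
    unfolding c(3) coord_vec_partial1[OF f] power2_eq_square sum_product by (simp add: mult_ac)
  then show ?thesis
    using coord_op_chain[OF c(1,2) f \<psi> smooth, of a "\<lambda>i j. (y \<bullet> i) * (y \<bullet> j)"] unfolding a by simp
qed

end

section \<open>The drift of the truncated squared distance\<close>

text \<open>The terms \<open>\<sigma>[\<sigma>[f \<circ> h]]\<close> enter through
  \<open>nabla_S\<close> with a minus sign and through \<open>stratonovich_push\<close> with a plus
  sign. They cancel and leave \<open>G\<close> applied to \<open>f \<circ> h\<close>.\<close>

lemma image_drift_eq_sde_drift:
  fixes \<sigma> :: "nat \<Rightarrow> 'm::{t2_space,second_countable_topology} \<Rightarrow> 'n \<Rightarrow> 'm operator"
  assumes "manifold AM" "manifold AP" "smooth_map AM AP h" and f: "smooth_fun_at AP (h x) f"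
  shows "image_drift AM AP h G d V \<sigma> x u f = sde_drift G d V \<sigma> x u (f \<circ> h)"
proof -
  have "smooth_map_at AM euclidean_atlas x (\<lambda>y. f (h y))"
    using assms by (intro smooth_map_at_compose[of AM AP euclidean_atlas x h f])
      (auto simp: manifold_euclidean smooth_map_def smooth_fun_at_def)
  then have fh: "smooth_fun_at AM x (f \<circ> h)" by (simp add: smooth_fun_at_def comp_def)
  show ?thesis
    using f fh by (simp add: image_drift_def sde_drift_def pushforward_def stratonovich_push_def
        nabla_S_def stratonovich_def sum_subtractf diff_divide_distrib)
qed

lemma sde_drift_chain:
  assumes "manifold AM" and G: "diffusion_generator AM G" and V: "V x u \<in> tangent_space AM x"
    and \<sigma>: "\<And>l. l \<in> {1..d} \<Longrightarrow> \<sigma> l x u \<in> tangent_space AM x"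
    and f: "smooth_fun_at AM x f"
    and \<psi>: "\<And>s. (\<psi> has_real_derivative \<psi>' s) (at s)" "\<And>s. (\<psi>' has_real_derivative \<psi>'' s) (at s)"
    and smooth: "smooth_at \<psi> (f x)"
  shows "sde_drift G d V \<sigma> x u (\<lambda>y. \<psi> (f y)) =
    \<psi>' (f x) * sde_drift G d V \<sigma> x u f + \<psi>'' (f x) * (\<Sum>l=1..d. (\<sigma> l x u f)\<^sup>2) / 2"
proof -
  interpret manifold AM by fact
  have "(\<Sum>l=1..d. G x (\<sigma> l x u) (\<lambda>y. \<psi> (f y)))
     = \<psi>' (f x) * (\<Sum>l=1..d. G x (\<sigma> l x u) f) + \<psi>'' (f x) * (\<Sum>l=1..d. (\<sigma> l x u f)\<^sup>2)"
    using generator_chain[OF G \<sigma> f \<psi> smooth] by (simp add: sum.distrib sum_distrib_left)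
  then show ?thesis
    using tangent_chain[OF V f \<psi> smooth] by (simp add: sde_drift_def field_simps)
qed

text \<open>If \<open>h x\<close> is in the normal ball, the drift is \<open>cap'\<close> times
  \<open>- b * dist_sq\<close> plus half of \<open>cap''\<close> times a sum of squares, and both
  summands are nonpositive. Elsewhere the truncated function is locally constant and all operators
  vanish on it. The factor \<open>16\<close> is the square of the bound for
  \<open>cap'\<close>.\<close>

lemma cutoff_drift:
  fixes AM :: "('m::{t2_space,second_countable_topology}, 'e::euclidean_space) atlas"
    and \<sigma> :: "nat \<Rightarrow> 'm \<Rightarrow> 'n \<Rightarrow> 'm operator"
  assumes AM: "manifold AM" and ball: "normal_ball AP g p c r" and h: "smooth_map AM AP h"
    and G: "diffusion_generator AM G" and V: "V x u \<in> tangent_space AM x"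
    and \<sigma>: "\<And>l. l \<in> {1..d} \<Longrightarrow> \<sigma> l x u \<in> tangent_space AM x"
    and \<kappa>: "0 < \<kappa>" "\<kappa> < r\<^sup>2" "\<kappa> \<le> 1 / 2" and b: "0 \<le> b"
    and drift: "smooth_fun_at AP (h x) (dist_sq AP g p) \<Longrightarrow>
       image_drift AM AP h G d V \<sigma> x u (dist_sq AP g p) = - b * dist_sq AP g p (h x)"
  shows "sde_drift G d V \<sigma> x u (\<lambda>y. normal_ball.cutoff AP g p c r \<kappa> (h y)) \<le> 0"
    and "l \<in> {1..d} \<Longrightarrow> (\<sigma> l x u (\<lambda>y. normal_ball.cutoff AP g p c r \<kappa> (h y)))\<^sup>2 \<le>
       16 * (\<Sum>l=1..d. (pushforward AP h x (\<sigma> l x u) (dist_sq AP g p))\<^sup>2)"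
proof -
  interpret M: manifold AM by fact
  interpret P: normal_ball AP g p c r by fact
  have cont: "isCont h x"
    using smooth_map_at_isCont[OF AM P.manifold_axioms] h unfolding smooth_map_def by blast
  let ?f = "dist_sq AP g p \<circ> h" and ?\<phi> = "\<lambda>y. P.cutoff \<kappa> (h y)"
  let ?q = "\<Sum>l=1..d. (pushforward AP h x (\<sigma> l x u) (dist_sq AP g p))\<^sup>2"
  have *: "sde_drift G d V \<sigma> x u ?\<phi> \<le> 0 \<and> (l \<in> {1..d} \<longrightarrow> (\<sigma> l x u ?\<phi>)\<^sup>2 \<le> 16 * ?q)" for l
  proof (cases "h x \<in> P.E ` P.D r")
    case True
    have s: "smooth_fun_at AP (h x) (dist_sq AP g p)" by (rule P.dist_sq_smooth[OF True])
    have "smooth_map_at AM euclidean_atlas x (\<lambda>y. dist_sq AP g p (h y))"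
      using AM h s by (intro smooth_map_at_compose[of AM AP euclidean_atlas x h "dist_sq AP g p"])
        (auto simp: manifold_euclidean smooth_map_def smooth_fun_at_def P.manifold_axioms)
    then have f: "smooth_fun_at AM x ?f" by (simp add: smooth_fun_at_def comp_def)
    have ev: "eventually (\<lambda>y. ?\<phi> y = cap \<kappa> (?f y)) (nhds x)"
      using isCont_eventually[OF cont P.cutoff_near[OF True, of \<kappa>]] by eventually_elim simp
    have nonneg: "0 \<le> ?f x" by (simp add: dist_sq_def)
    have "sde_drift G d V \<sigma> x u ?\<phi> = sde_drift G d V \<sigma> x u (\<lambda>y. cap \<kappa> (?f y))"
      using M.tangent_cong[OF V ev] M.generator_cong[OF G \<sigma> ev] by (simp add: sde_drift_def)
    also have "\<dots> = cap' \<kappa> (?f x) * sde_drift G d V \<sigma> x u ?f + cap'' \<kappa> (?f x) * (\<Sum>l=1..d. (\<sigma> l x u ?f)\<^sup>2) / 2"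
      by (rule sde_drift_chain[where \<psi> = "cap \<kappa>" and f = ?f and V = V and \<sigma> = \<sigma> and x = x and u = u,
          OF AM G V \<sigma> f cap_has_derivative cap'_has_derivative smooth_at_cap])
    also have "sde_drift G d V \<sigma> x u ?f = - b * ?f x"
      using image_drift_eq_sde_drift[where G = G and d = d and V = V and \<sigma> = \<sigma> and u = u,
          OF AM P.manifold_axioms h s] drift[OF s] by (simp only: comp_apply)
    also have "cap' \<kappa> (?f x) * (- b * ?f x) \<le> 0"
      using cap'_nonneg b nonneg by (simp add: mult_nonneg_nonpos)
    also have "cap'' \<kappa> (?f x) * (\<Sum>l=1..d. (\<sigma> l x u ?f)\<^sup>2) / 2 \<le> 0"
      using cap''_nonpos[OF \<kappa>(3) nonneg] by (simp add: mult_nonpos_nonneg sum_nonneg)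
    finally have 1: "sde_drift G d V \<sigma> x u ?\<phi> \<le> 0" by simp
    have 2: "(\<sigma> l x u ?\<phi>)\<^sup>2 \<le> 16 * ?q" if l: "l \<in> {1..d}"
    proof -
      have "\<sigma> l x u ?\<phi> = cap' \<kappa> (?f x) * \<sigma> l x u ?f"
        using M.tangent_cong[OF \<sigma>[OF l] ev]
          M.tangent_chain[where \<psi> = "cap \<kappa>" and f = ?f, OF \<sigma>[OF l] f cap_has_derivative cap'_has_derivative smooth_at_cap] by simp
      then have "(\<sigma> l x u ?\<phi>)\<^sup>2 = (cap' \<kappa> (?f x))\<^sup>2 * (\<sigma> l x u ?f)\<^sup>2" by (simp add: power_mult_distrib)
      also have "\<dots> \<le> 4\<^sup>2 * (\<sigma> l x u ?f)\<^sup>2"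
        using cap'_nonneg cap'_le_4 by (intro mult_right_mono power_mono) auto
      also have "(\<sigma> l x u ?f)\<^sup>2 = (pushforward AP h x (\<sigma> l x u) (dist_sq AP g p))\<^sup>2"
        using s by (simp add: pushforward_def)
      also have "4\<^sup>2 * \<dots> \<le> 4\<^sup>2 * ?q"
        using l by (intro mult_left_mono member_le_sum) auto
      finally show ?thesis by simp
    qed
    show ?thesis using 1 2 by blast
  next
    case False
    have ev: "eventually (\<lambda>y. ?\<phi> y = cap \<kappa> \<kappa>) (nhds x)"
      using isCont_eventually[OF cont P.cutoff_const_near[OF \<kappa>(1,2) False]] .
    have "sde_drift G d V \<sigma> x u ?\<phi> = 0"
      using M.tangent_cong[OF V ev] M.generator_cong[OF G \<sigma> ev] M.tangent_const[OF V] M.generator_const[OF G \<sigma>]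
      by (simp add: sde_drift_def)
    moreover have "\<sigma> l x u ?\<phi> = 0" if "l \<in> {1..d}"
      using M.tangent_cong[OF \<sigma>[OF that] ev] M.tangent_const[OF \<sigma>[OF that]] by simp
    moreover have "0 \<le> ?q" by (intro sum_nonneg) auto
    ultimately show ?thesis by simp
  qed
  show "sde_drift G d V \<sigma> x u ?\<phi> \<le> 0" using * by blast
  show "(\<sigma> l x u ?\<phi>)\<^sup>2 \<le> 16 * ?q" if "l \<in> {1..d}" using * that by blast
qed

section \<open>Mean of an Ito integral\<close>

text \<open>A single component of the Wiener process, with independence of the past reduced to a
  product formula for two events.\<close>

locale brownian_motion = prob_space Pr for Pr :: "'w measure" +
  fixes F :: "real \<Rightarrow> 'w measure" and B :: "real \<Rightarrow> 'w \<Rightarrow> real"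
  assumes subalg: "subalgebra Pr (F t)"
    and sets_mono: "s \<le> t \<Longrightarrow> sets (F s) \<subseteq> sets (F t)"
    and path_continuous: "\<omega> \<in> space Pr \<Longrightarrow> continuous_on {0..} (\<lambda>t. B t \<omega>)"
    and adapted: "0 \<le> t \<Longrightarrow> B t \<in> borel_measurable (F t)"
    and increment: "0 \<le> s \<Longrightarrow> s < t \<Longrightarrow>
      distributed Pr lborel (\<lambda>\<omega>. B t \<omega> - B s \<omega>) (normal_density 0 (sqrt (t - s)))"
    and increment_indep: "0 \<le> s \<Longrightarrow> s < t \<Longrightarrow> A \<in> sets (F s) \<Longrightarrow> C \<in> sets borel \<Longrightarrow>
      prob (A \<inter> ((\<lambda>\<omega>. B t \<omega> - B s \<omega>) -` C \<inter> space Pr)) =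
      prob A * prob ((\<lambda>\<omega>. B t \<omega> - B s \<omega>) -` C \<inter> space Pr)"

lemma wiener_process_brownian_motion:
  assumes basis: "stochastic_basis Pr F" and W: "wiener_process Pr F d W" and l: "l \<in> {1..d}"
  shows "brownian_motion Pr F (W l)"
proof -
  interpret prob_space Pr using basis by (simp add: stochastic_basis_def)
  interpret filtration "space Pr" F using basis by (simp add: stochastic_basis_def)
  have sub: "subalgebra Pr (F t)" for t using basis by (simp add: stochastic_basis_def)
  show ?thesis
  proof unfold_locales
    fix s t :: real and A and C :: "real set" assume st: "0 \<le> s" "s < t" and A: "A \<in> sets (F s)" and C: "C \<in> sets borel"
    let ?X = "\<lambda>l. (\<lambda>\<omega>. W l t \<omega> - W l s \<omega>) -` C \<inter> space Pr"
    have ind: "indep_sets (\<lambda>l. if l = 0 then sets (F s)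
               else {(\<lambda>\<omega>. W l t \<omega> - W l s \<omega>) -` B \<inter> space Pr |B. B \<in> sets borel}) {0..d}"
      using W st unfolding wiener_process_def by blast
    \<comment> \<open>From the independent family only the members \<open>0\<close>, which is the
      past, and \<open>l\<close> are selected; \<open>l \<ge> 1\<close> keeps them distinct.\<close>
    have "prob (\<Inter>j\<in>{0, l}. if j = 0 then A else ?X j) = (\<Prod>j\<in>{0, l}. prob (if j = 0 then A else ?X j))"
      by (rule indep_setsD[OF ind]) (use l A C in auto)
    then show "prob (A \<inter> ?X l) = prob A * prob (?X l)" using l by simp
  qed (use sub sets_F_mono W l in \<open>auto simp: wiener_process_def\<close>)
qed

section \<open>Moments of integrals of simple processes\<close>

context brownian_motion
begin

lemma measurable_mono: "s \<le> t \<Longrightarrow> f \<in> measurable (F s) N \<Longrightarrow> f \<in> measurable (F t) N"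
  using sets_mono[of s t] subalg[of s] subalg[of t]
  by (auto simp: measurable_def subalgebra_def)

lemma measurable_Pr: "f \<in> measurable (F t) N \<Longrightarrow> f \<in> measurable Pr N"
  by (rule measurable_from_subalg[OF subalg])

lemma increment_integrable:
  assumes "0 \<le> s" "s < t"
  shows "integrable Pr (\<lambda>\<omega>. B t \<omega> - B s \<omega>)" "integrable Pr (\<lambda>\<omega>. (B t \<omega> - B s \<omega>)\<^sup>2)"
  using distributed_integrable[OF increment[OF assms], of "\<lambda>x. x"]
    distributed_integrable[OF increment[OF assms], of "\<lambda>x. x\<^sup>2"]
    integrable_normal_moment[of "sqrt (t - s)" 0 1] integrable_normal_moment[of "sqrt (t - s)" 0 2] assms
  by auto

lemma increment_moments:
  assumes "0 \<le> s" "s < t"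
  shows "expectation (\<lambda>\<omega>. B t \<omega> - B s \<omega>) = 0" "expectation (\<lambda>\<omega>. (B t \<omega> - B s \<omega>)\<^sup>2) = t - s"
proof -
  show 1: "expectation (\<lambda>\<omega>. B t \<omega> - B s \<omega>) = 0"
    using normal_distributed_expectation[OF _ increment[OF assms]] assms by simp
  have "variance (\<lambda>\<omega>. B t \<omega> - B s \<omega>) = (sqrt (t - s))\<^sup>2"
    using normal_distributed_variance[OF _ increment[OF assms]] assms by simp
  then show "expectation (\<lambda>\<omega>. (B t \<omega> - B s \<omega>)\<^sup>2) = t - s" unfolding 1 using assms by simp
qed

text \<open>Preimages of Borel sets form a system stable under intersection, so the product formula
  for events extends to the generated sigma-algebras.\<close>

lemma increment_indep_var:
  assumes st: "0 \<le> s" "s < t" and \<xi>: "\<xi> \<in> borel_measurable (F s)"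
  shows "indep_var borel \<xi> borel (\<lambda>\<omega>. B t \<omega> - B s \<omega>)"
proof -
  let ?X = "\<lambda>\<omega>. B t \<omega> - B s \<omega>"
  have m: "\<xi> \<in> borel_measurable Pr" "?X \<in> borel_measurable Pr"
    using measurable_Pr[OF \<xi>] measurable_Pr[OF adapted, of t] measurable_Pr[OF adapted, of s] st by auto
  have sp: "space (F s) = space Pr" using subalg by (simp add: subalgebra_def)
  have stable: "Int_stable {f -` A \<inter> space Pr |A. A \<in> sets borel}" for f :: "'w \<Rightarrow> real"
  proof (rule Int_stableI)
    fix a b assume "a \<in> {f -` A \<inter> space Pr |A. A \<in> sets borel}" "b \<in> {f -` A \<inter> space Pr |A. A \<in> sets borel}"
    then obtain A C where "A \<in> sets borel" "a = f -` A \<inter> space Pr" "C \<in> sets borel" "b = f -` C \<inter> space Pr"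
      by blast
    then show "a \<inter> b \<in> {f -` A \<inter> space Pr |A. A \<in> sets borel}"
      by (intro CollectI exI[of _ "A \<inter> C"]) auto
  qed
  show ?thesis
    unfolding indep_var_eq
  proof (intro conjI indep_set_sigma_sets m)
    show "indep_set {\<xi> -` A \<inter> space Pr |A. A \<in> sets borel} {?X -` A \<inter> space Pr |A. A \<in> sets borel}"
    proof (rule indep_setI)
      fix a b assume "a \<in> {\<xi> -` A \<inter> space Pr |A. A \<in> sets borel}" "b \<in> {?X -` A \<inter> space Pr |A. A \<in> sets borel}"
      then obtain A C where AC: "A \<in> sets borel" "a = \<xi> -` A \<inter> space Pr" "C \<in> sets borel" "b = ?X -` C \<inter> space Pr"
        by blast
      have "a \<in> sets (F s)" using measurable_sets[OF \<xi> AC(1)] AC(2) sp by simp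
      then show "prob (a \<inter> b) = prob a * prob b" using increment_indep[OF st _ AC(3)] AC(4) by blast
    qed (use m measurable_sets in auto)
  qed (rule stable)+
qed

lemma increment_product:
  assumes st: "0 \<le> s" "s < t" and \<xi>: "\<xi> \<in> borel_measurable (F s)" "integrable Pr \<xi>"
  shows "integrable Pr (\<lambda>\<omega>. \<xi> \<omega> * (B t \<omega> - B s \<omega>))" "expectation (\<lambda>\<omega>. \<xi> \<omega> * (B t \<omega> - B s \<omega>)) = 0"
  using indep_var_integrable[OF increment_indep_var[OF st \<xi>(1)] \<xi>(2) increment_integrable(1)[OF st]]
    indep_var_lebesgue_integral[OF increment_indep_var[OF st \<xi>(1)] \<xi>(2) increment_integrable(1)[OF st]]
    increment_moments(1)[OF st] by auto

lemma increment_product_sq: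
  assumes st: "0 \<le> s" "s < t" and \<xi>: "\<xi> \<in> borel_measurable (F s)" "integrable Pr (\<lambda>\<omega>. (\<xi> \<omega>)\<^sup>2)"
  shows "integrable Pr (\<lambda>\<omega>. (\<xi> \<omega> * (B t \<omega> - B s \<omega>))\<^sup>2)"
    "expectation (\<lambda>\<omega>. (\<xi> \<omega> * (B t \<omega> - B s \<omega>))\<^sup>2) = expectation (\<lambda>\<omega>. (\<xi> \<omega>)\<^sup>2) * (t - s)"
proof -
  have "indep_var borel ((\<lambda>x. x\<^sup>2) \<circ> \<xi>) borel ((\<lambda>x. x\<^sup>2) \<circ> (\<lambda>\<omega>. B t \<omega> - B s \<omega>))"
    by (rule indep_var_compose[OF increment_indep_var[OF st \<xi>(1)]]) auto
  then have ind: "indep_var borel (\<lambda>\<omega>. (\<xi> \<omega>)\<^sup>2) borel (\<lambda>\<omega>. (B t \<omega> - B s \<omega>)\<^sup>2)" by (simp add: comp_def)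
  show "integrable Pr (\<lambda>\<omega>. (\<xi> \<omega> * (B t \<omega> - B s \<omega>))\<^sup>2)"
    "expectation (\<lambda>\<omega>. (\<xi> \<omega> * (B t \<omega> - B s \<omega>))\<^sup>2) = expectation (\<lambda>\<omega>. (\<xi> \<omega>)\<^sup>2) * (t - s)"
    using indep_var_integrable[OF ind \<xi>(2) increment_integrable(2)[OF st]]
      indep_var_lebesgue_integral[OF ind \<xi>(2) increment_integrable(2)[OF st]] increment_moments(2)[OF st]
    by (auto simp: power_mult_distrib)
qed

text \<open>With all steps included this is the time integral of the squared step function along a
  path (\<open>nn_integral_simple_value_sq\<close>); the partial sums serve to stop it.\<close>

definition energy :: "'w simple_process \<Rightarrow> nat \<Rightarrow> 'w \<Rightarrow> real" where
  "energy S n \<omega> = (case S of (k, \<tau>, \<xi>) \<Rightarrow> \<Sum>i<n. (\<xi> i \<omega>)\<^sup>2 * (\<tau> (Suc i) - \<tau> i))"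

lemma simple_process_measurable:
  assumes "simple_process Pr F a (k, \<tau>, \<xi>)" "i < k" "\<tau> i \<le> s"
  shows "\<xi> i \<in> borel_measurable (F s)"
  using assms measurable_mono unfolding simple_process_def by blast

lemma simple_process_mono:
  assumes "simple_process Pr F a (k, \<tau>, \<xi>)" "i \<le> j" "j \<le> k"
  shows "\<tau> i \<le> \<tau> j"
  using assms(2,3)
proof (induction j rule: dec_induct)
  case (step n)
  then have "\<tau> n \<le> \<tau> (Suc n)" using assms(1) by (simp add: simple_process_def)
  then show ?case using step by simp
qed simp

lemma bounded_integrable:
  fixes f :: "'w \<Rightarrow> real"
  assumes "f \<in> borel_measurable Pr" "\<And>\<omega>. \<omega> \<in> space Pr \<Longrightarrow> \<bar>f \<omega>\<bar> \<le> C"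
  shows "integrable Pr f"
  by (rule integrable_const_bound[of f C]) (use assms in \<open>auto intro: AE_I2\<close>)

text \<open>Induction on the number of steps. The next increment of \<open>B\<close> is independent
  of the past, so the mixed product with it has mean \<open>0\<close>; for this the sum so far must
  be measurable at time \<open>\<tau> n\<close>, which is why measurability is part of the claim.
  The guard \<open>0 < n\<close> covers the empty sum, measurable at every time. The second moment
  is bounded instead of computed because \<open>t\<close> may cut a step short.\<close>

lemma simple_integral_moments:
  assumes S: "simple_process Pr F a (k, \<tau>, \<xi>)" and t: "0 \<le> t" and n: "n \<le> k"
  defines "N \<equiv> \<lambda>n \<omega>. \<Sum>i<n. \<xi> i \<omega> * (B (min t (\<tau> (Suc i))) \<omega> - B (min t (\<tau> i)) \<omega>)"
  shows "(\<forall>s\<ge>0. (0 < n \<longrightarrow> \<tau> n \<le> s) \<longrightarrow> N n \<in> borel_measurable (F s)) \<and>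
    integrable Pr (N n) \<and> integrable Pr (\<lambda>\<omega>. (N n \<omega>)\<^sup>2) \<and> expectation (N n) = 0 \<and>
    expectation (\<lambda>\<omega>. (N n \<omega>)\<^sup>2) \<le> expectation (energy (k, \<tau>, \<xi>) n) \<and> integrable Pr (energy (k, \<tau>, \<xi>) n)"
  using n
proof (induction n)
  case 0
  show ?case by (simp add: N_def energy_def)
next
  case (Suc n)
  then have n: "n < k" by simp
  note IH = Suc.IH[OF less_imp_le[OF n]]
  have \<tau>: "0 \<le> \<tau> n" "\<tau> n \<le> \<tau> (Suc n)" and \<xi>F: "\<xi> n \<in> borel_measurable (F (\<tau> n))"
    using S n by (auto simp: simple_process_def)
  obtain C where C: "\<And>\<omega>. \<omega> \<in> space Pr \<Longrightarrow> \<bar>\<xi> n \<omega>\<bar> \<le> C"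
    using S n unfolding simple_process_def by blast
  have \<xi>m: "\<xi> n \<in> borel_measurable Pr" by (rule measurable_Pr[OF \<xi>F])
  have \<xi>int: "integrable Pr (\<xi> n)" by (rule bounded_integrable[OF \<xi>m C])
  have \<xi>2: "(\<xi> n \<omega>)\<^sup>2 \<le> C\<^sup>2" if "\<omega> \<in> space Pr" for \<omega>
    using C[OF that] by (metis abs_ge_zero order_trans power2_abs power_mono)
  have \<xi>2int: "integrable Pr (\<lambda>\<omega>. (\<xi> n \<omega>)\<^sup>2)"
    by (rule bounded_integrable[of _ "C\<^sup>2"]) (use \<xi>m \<xi>2 in auto)
  define X where "X \<omega> = \<xi> n \<omega> * (B (min t (\<tau> (Suc n))) \<omega> - B (min t (\<tau> n)) \<omega>)" for \<omega>
  have N_Suc: "N (Suc n) = (\<lambda>\<omega>. N n \<omega> + X \<omega>)" by (simp add: N_def X_def fun_eq_iff)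
  have en_Suc: "energy (k, \<tau>, \<xi>) (Suc n) = (\<lambda>\<omega>. energy (k, \<tau>, \<xi>) n \<omega> + (\<xi> n \<omega>)\<^sup>2 * (\<tau> (Suc n) - \<tau> n))"
    by (simp add: energy_def fun_eq_iff)
  have N\<tau>: "N n \<in> borel_measurable (F (\<tau> n))" using IH \<tau> by simp
  have X: "integrable Pr X \<and> integrable Pr (\<lambda>\<omega>. (X \<omega>)\<^sup>2) \<and> expectation X = 0 \<and>
     expectation (\<lambda>\<omega>. (X \<omega>)\<^sup>2) \<le> expectation (\<lambda>\<omega>. (\<xi> n \<omega>)\<^sup>2) * (\<tau> (Suc n) - \<tau> n) \<and>
     integrable Pr (\<lambda>\<omega>. N n \<omega> * X \<omega>) \<and> expectation (\<lambda>\<omega>. N n \<omega> * X \<omega>) = 0"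
  proof (cases "\<tau> n < min t (\<tau> (Suc n))")
    case True
    then have m: "min t (\<tau> n) = \<tau> n" by simp
    have X_eq: "X = (\<lambda>\<omega>. \<xi> n \<omega> * (B (min t (\<tau> (Suc n))) \<omega> - B (\<tau> n) \<omega>))"
      by (simp add: X_def m fun_eq_iff)
    have NX_eq: "(\<lambda>\<omega>. N n \<omega> * X \<omega>) = (\<lambda>\<omega>. (N n \<omega> * \<xi> n \<omega>) * (B (min t (\<tau> (Suc n))) \<omega> - B (\<tau> n) \<omega>))"
      by (simp add: X_eq mult.assoc)
    have N\<xi>: "integrable Pr (\<lambda>\<omega>. N n \<omega> * \<xi> n \<omega>)"
    proof (rule Bochner_Integration.integrable_bound)
      show "integrable Pr (\<lambda>\<omega>. C * N n \<omega>)" using IH by simp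
      show "AE \<omega> in Pr. norm (N n \<omega> * \<xi> n \<omega>) \<le> norm (C * N n \<omega>)"
      proof (rule AE_I2)
        fix \<omega> assume "\<omega> \<in> space Pr"
        then have "\<bar>\<xi> n \<omega>\<bar> \<le> \<bar>C\<bar>" using C[of \<omega>] by linarith
        then show "norm (N n \<omega> * \<xi> n \<omega>) \<le> norm (C * N n \<omega>)"
          using mult_right_mono[of "\<bar>\<xi> n \<omega>\<bar>" "\<bar>C\<bar>" "\<bar>N n \<omega>\<bar>"] by (simp add: abs_mult mult.commute)
      qed
    qed (use IH \<xi>m in auto)
    have "expectation (\<lambda>\<omega>. (X \<omega>)\<^sup>2) = expectation (\<lambda>\<omega>. (\<xi> n \<omega>)\<^sup>2) * (min t (\<tau> (Suc n)) - \<tau> n)"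
      unfolding X_eq by (rule increment_product_sq(2)[OF \<tau>(1) True \<xi>F \<xi>2int])
    also have "\<dots> \<le> expectation (\<lambda>\<omega>. (\<xi> n \<omega>)\<^sup>2) * (\<tau> (Suc n) - \<tau> n)"
      by (intro mult_left_mono) auto
    finally show ?thesis
      using increment_product[OF \<tau>(1) True \<xi>F \<xi>int] increment_product_sq(1)[OF \<tau>(1) True \<xi>F \<xi>2int]
        increment_product[OF \<tau>(1) True borel_measurable_times[OF N\<tau> \<xi>F] N\<xi>]
      unfolding NX_eq by (simp add: X_eq)
  next
    case False
    \<comment> \<open>The step is empty or begins no earlier than \<open>t\<close>, so it
      contributes nothing.\<close>
    then have "min t (\<tau> (Suc n)) = min t (\<tau> n)" using \<tau>(2) by (auto simp: min_def split: if_splits)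
    then have "X = (\<lambda>_. 0)" by (simp add: X_def fun_eq_iff)
    then show ?thesis using \<tau>(2) by (simp add: mult_nonneg_nonneg)
  qed
  have sq: "(\<lambda>\<omega>. (N (Suc n) \<omega>)\<^sup>2) = (\<lambda>\<omega>. (N n \<omega>)\<^sup>2 + 2 * (N n \<omega> * X \<omega>) + (X \<omega>)\<^sup>2)"
    by (simp add: N_Suc power2_sum fun_eq_iff)
  have meas: "N (Suc n) \<in> borel_measurable (F s)" if s: "0 \<le> s" "\<tau> (Suc n) \<le> s" for s
  proof -
    have "B (min t (\<tau> (Suc n))) \<in> borel_measurable (F s)" "B (min t (\<tau> n)) \<in> borel_measurable (F s)"
      using t \<tau> s by (auto intro!: measurable_mono[OF _ adapted] simp: min_le_iff_disj)
    moreover have "\<xi> n \<in> borel_measurable (F s)" using \<tau> s by (intro measurable_mono[OF _ \<xi>F]) auto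
    moreover have "N n \<in> borel_measurable (F s)" using \<tau> s by (intro measurable_mono[OF _ N\<tau>]) auto
    ultimately show ?thesis unfolding N_Suc X_def by measurable
  qed
  show ?case
    using IH X meas \<xi>2int unfolding sq en_Suc
    by (auto simp: N_Suc)
qed

lemma simple_integral_eq:
  "simple_integral B (k, \<tau>, \<xi>) t \<omega> = (\<Sum>i<k. \<xi> i \<omega> * (B (min t (\<tau> (Suc i))) \<omega> - B (min t (\<tau> i)) \<omega>))"
  by (simp add: simple_integral_def)

lemma simple_integral_mean:
  assumes S: "simple_process Pr F a S" and t: "0 \<le> t"
    and bound: "\<And>\<omega>. \<omega> \<in> space Pr \<Longrightarrow> energy S (fst S) \<omega> \<le> K"
  shows "integrable Pr (simple_integral B S t)" "integrable Pr (\<lambda>\<omega>. (simple_integral B S t \<omega>)\<^sup>2)"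
    "expectation (simple_integral B S t) = 0" "expectation (\<lambda>\<omega>. (simple_integral B S t \<omega>)\<^sup>2) \<le> K"
proof -
  obtain k \<tau> \<xi> where S_eq: "S = (k, \<tau>, \<xi>)" by (cases S) auto
  note m = simple_integral_moments[OF S[unfolded S_eq] t order_refl, folded simple_integral_eq]
  show "integrable Pr (simple_integral B S t)" "integrable Pr (\<lambda>\<omega>. (simple_integral B S t \<omega>)\<^sup>2)"
    "expectation (simple_integral B S t) = 0"
    using m unfolding S_eq by auto
  have "expectation (energy S k) \<le> expectation (\<lambda>_. K)"
    using m bound unfolding S_eq by (intro integral_mono) auto
  then show "expectation (\<lambda>\<omega>. (simple_integral B S t \<omega>)\<^sup>2) \<le> K"
    using m unfolding S_eq by (simp add: prob_space)
qed

text \<open>A step is dropped once the energy including that step exceeds \<open>K\<close>. As the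
  times are deterministic, this energy is known at the beginning \<open>\<tau> i\<close> of the
  step, so the result is again a simple process, and its energy never overshoots
  \<open>K\<close>.\<close>

definition stop_energy :: "real \<Rightarrow> 'w simple_process \<Rightarrow> 'w simple_process" where
  "stop_energy K S = (case S of (k, \<tau>, \<xi>) \<Rightarrow>
     (k, \<tau>, \<lambda>i \<omega>. if energy S (Suc i) \<omega> \<le> K then \<xi> i \<omega> else 0))"

lemma stop_energy:
  assumes S: "simple_process Pr F a S" and K: "0 \<le> K"
  shows stop_energy_simple_process: "simple_process Pr F a (stop_energy K S)"
    and stop_energy_bound: "energy (stop_energy K S) (fst (stop_energy K S)) \<omega> \<le> K"
    and stop_energy_same: "energy S (fst S) \<omega> \<le> K \<Longrightarrow>
      simple_integral B (stop_energy K S) t \<omega> = simple_integral B S t \<omega>"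
proof -
  obtain k \<tau> \<xi> where S_eq: "S = (k, \<tau>, \<xi>)" by (cases S) auto
  note S' = S[unfolded S_eq]
  have inc: "energy S n \<omega> \<le> energy S (Suc n) \<omega>" if "n < k" for n \<omega>
    using S' that by (simp add: S_eq energy_def simple_process_def)
  have inc': "energy S i \<omega> \<le> energy S j \<omega>" if "i \<le> j" "j \<le> k" for i j \<omega>
    using that
  proof (induction j rule: dec_induct)
    case (step n) then show ?case using inc[of n \<omega>] by simp
  qed simp
  show "simple_process Pr F a (stop_energy K S)"
    unfolding simple_process_def stop_energy_def S_eq
  proof (clarsimp, intro conjI)
    fix i assume i: "i < k"
    show "0 \<le> \<tau> i" "\<tau> i \<le> \<tau> (Suc i)" "\<tau> (Suc i) \<le> a" using S' i by (auto simp: simple_process_def)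
    have "(\<lambda>\<omega>. energy (k, \<tau>, \<xi>) (Suc i) \<omega>) \<in> borel_measurable (F (\<tau> i))"
      unfolding energy_def prod.case
    proof (intro borel_measurable_sum borel_measurable_times borel_measurable_power borel_measurable_const)
      fix j assume "j \<in> {..<Suc i}"
      then show "\<xi> j \<in> borel_measurable (F (\<tau> i))"
        using i by (intro simple_process_measurable[OF S'] simple_process_mono[OF S']) auto
    qed
    moreover have "\<xi> i \<in> borel_measurable (F (\<tau> i))" using S' i by (simp add: simple_process_def)
    ultimately show "(\<lambda>\<omega>. if energy (k, \<tau>, \<xi>) (Suc i) \<omega> \<le> K then \<xi> i \<omega> else 0) \<in> borel_measurable (F (\<tau> i))"
      by measurable
    obtain C where "\<forall>\<omega>\<in>space Pr. \<bar>\<xi> i \<omega>\<bar> \<le> C" using S' i unfolding simple_process_def by blast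
    then show "\<exists>C. \<forall>\<omega>\<in>space Pr. (energy (k, \<tau>, \<xi>) (Suc i) \<omega> \<le> K \<longrightarrow> \<bar>\<xi> i \<omega>\<bar> \<le> C) \<and>
        (\<not> energy (k, \<tau>, \<xi>) (Suc i) \<omega> \<le> K \<longrightarrow> 0 \<le> C)"
      by (intro exI[of _ "\<bar>C\<bar>"]) force
  qed
  \<comment> \<open>The bound alone is not inductive: when a step is kept, the new bound comes from
    equality with the energy of the original process.\<close>
  have "n \<le> k \<Longrightarrow> energy (stop_energy K S) n \<omega> \<le> K \<and>
      (energy S n \<omega> \<le> K \<longrightarrow> energy (stop_energy K S) n \<omega> = energy S n \<omega>)" for n
  proof (induction n)
    case 0 then show ?case using K by (simp add: energy_def stop_energy_def S_eq)
  next
    case (Suc n)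
    have step: "energy (stop_energy K S) (Suc n) \<omega> = energy (stop_energy K S) n \<omega> +
       (if energy S (Suc n) \<omega> \<le> K then \<xi> n \<omega> else 0)\<^sup>2 * (\<tau> (Suc n) - \<tau> n)"
      by (simp add: energy_def stop_energy_def S_eq)
    have step': "energy S (Suc n) \<omega> = energy S n \<omega> + (\<xi> n \<omega>)\<^sup>2 * (\<tau> (Suc n) - \<tau> n)"
      by (simp add: energy_def S_eq)
    show ?case
    proof (cases "energy S (Suc n) \<omega> \<le> K")
      case True
      then have "energy S n \<omega> \<le> K" using inc[of n \<omega>] Suc.prems by simp
      then have "energy (stop_energy K S) n \<omega> = energy S n \<omega>" using Suc by simp
      then show ?thesis using True step step' by simp
    next
      case False
      then show ?thesis using step Suc by simp
    qed
  qed
  then show "energy (stop_energy K S) (fst (stop_energy K S)) \<omega> \<le> K"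
    by (simp add: stop_energy_def S_eq)
  show "simple_integral B (stop_energy K S) t \<omega> = simple_integral B S t \<omega>" if "energy S (fst S) \<omega> \<le> K"
  proof -
    have "energy S (Suc i) \<omega> \<le> K" if "i < k" for i
      using inc'[of "Suc i" k \<omega>] that \<open>energy S (fst S) \<omega> \<le> K\<close> by (simp add: S_eq)
    then show ?thesis by (simp add: simple_integral_def stop_energy_def S_eq)
  qed
qed

end

section \<open>Limits in probability under a second moment bound\<close>

context prob_space
begin

text \<open>The second moments are uniformly bounded, hence so is that of the limit, and the expectations
  converge.\<close>
lemma expectation_limit_in_probability:
  fixes Z :: "nat \<Rightarrow> 'a \<Rightarrow> real"
  assumes Z: "\<And>n. integrable M (Z n)" "\<And>n. integrable M (\<lambda>\<omega>. (Z n \<omega>)\<^sup>2)" "\<And>n. expectation (Z n) = 0"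
      "\<And>n. expectation (\<lambda>\<omega>. (Z n \<omega>)\<^sup>2) \<le> K"
    and Y [measurable]: "Y \<in> borel_measurable M"
    and lim: "\<And>e. 0 < e \<Longrightarrow> (\<lambda>n. prob {\<omega>\<in>space M. e < \<bar>Z n \<omega> - Y \<omega>\<bar>}) \<longlonglongrightarrow> 0"
  shows "integrable M Y" "expectation Y = 0"
proof -
  have [measurable]: "Z n \<in> borel_measurable M" for n using Z(1) by auto
  let ?P = "\<lambda>n e. prob {\<omega>\<in>space M. e < \<bar>Z n \<omega> - Y \<omega>\<bar>}"
  have "0 \<le> expectation (\<lambda>\<omega>. (Z 0 \<omega>)\<^sup>2)" by (rule Bochner_Integration.integral_nonneg) simp
  then have K: "0 \<le> K" using Z(4)[of 0] by linarith
  have ind: "integrable M (indicator {\<omega>\<in>space M. e < \<bar>Z n \<omega> - Y \<omega>\<bar>} :: _ \<Rightarrow> real)"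
    "expectation (indicator {\<omega>\<in>space M. e < \<bar>Z n \<omega> - Y \<omega>\<bar>} :: _ \<Rightarrow> real) = ?P n e" for n e
    by (auto intro!: integrable_real_indicator simp: emeasure_eq_measure)
  \<comment> \<open>Off the event that \<open>Z n\<close> and \<open>Y\<close> differ by more than
    \<open>1\<close>, \<open>Y\<^sup>2\<close> is at most \<open>2 Z\<^sup>2 + 2\<close>. On it the
    truncated square is at most \<open>m\<^sup>2\<close>, and \<open>n\<close> is chosen so late
    that this is outweighed by a probability below \<open>1 / (2 m\<^sup>2 + 1)\<close>. The result
    does not depend on \<open>m\<close>, so monotone convergence removes the truncation.\<close>
  have trunc: "(\<integral>\<^sup>+ \<omega>. ennreal ((min \<bar>Y \<omega>\<bar> (real m))\<^sup>2) \<partial>M) \<le> ennreal (2 * K + 3)" for m :: nat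
  proof -
    have "eventually (\<lambda>n. ?P n 1 < 1 / (2 * (real m)\<^sup>2 + 1)) sequentially"
      using lim[of 1] by (rule order_tendstoD) (auto intro: divide_pos_pos add_nonneg_pos)
    then obtain n where n: "?P n 1 < 1 / (2 * (real m)\<^sup>2 + 1)" by (auto simp: eventually_sequentially)
    have "2 * (real m)\<^sup>2 * ?P n 1 \<le> (2 * (real m)\<^sup>2 + 1) * ?P n 1" by (intro mult_right_mono) auto
    also have "\<dots> = ?P n 1 * (2 * (real m)\<^sup>2 + 1)" by (rule mult.commute)
    also have "\<dots> \<le> 1"
    proof -
      have "0 < 2 * (real m)\<^sup>2 + 1" by (intro add_nonneg_pos) auto
      then show ?thesis using n pos_less_divide_eq by (metis less_imp_le)
    qed
    finally have n': "2 * (real m)\<^sup>2 * ?P n 1 \<le> 1" .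
    let ?g = "\<lambda>\<omega>. 2 * (Z n \<omega>)\<^sup>2 + 2 + 2 * (real m)\<^sup>2 * indicator {\<omega>\<in>space M. 1 < \<bar>Z n \<omega> - Y \<omega>\<bar>} \<omega>"
    have pt: "(min \<bar>Y \<omega>\<bar> (real m))\<^sup>2 \<le> ?g \<omega>" if \<omega>: "\<omega> \<in> space M" for \<omega>
    proof (cases "1 < \<bar>Z n \<omega> - Y \<omega>\<bar>")
      case True
      have "(min \<bar>Y \<omega>\<bar> (real m))\<^sup>2 \<le> (real m)\<^sup>2" by (intro power_mono) auto
      moreover have "0 \<le> (real m)\<^sup>2" "0 \<le> (Z n \<omega>)\<^sup>2" by auto
      ultimately have "(min \<bar>Y \<omega>\<bar> (real m))\<^sup>2 \<le> 2 * (Z n \<omega>)\<^sup>2 + 2 + 2 * (real m)\<^sup>2" by linarith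
      then show ?thesis using True \<omega> by simp
    next
      case False
      have "(min \<bar>Y \<omega>\<bar> (real m))\<^sup>2 \<le> \<bar>Y \<omega>\<bar>\<^sup>2" by (intro power_mono) auto
      also have "\<dots> = (Z n \<omega> - (Z n \<omega> - Y \<omega>))\<^sup>2" by simp
      also have "\<dots> \<le> 2 * (Z n \<omega>)\<^sup>2 + 2 * (Z n \<omega> - Y \<omega>)\<^sup>2"
        using zero_le_power2[of "Z n \<omega> + (Z n \<omega> - Y \<omega>)"] by (simp add: power2_eq_square algebra_simps)
      also have "(Z n \<omega> - Y \<omega>)\<^sup>2 \<le> 1" using False by (simp add: abs_square_le_1)
      finally show ?thesis using False by simp
    qed
    have int: "integrable M ?g" using Z(2)[of n] ind(1) by auto
    have "(\<integral>\<^sup>+ \<omega>. ennreal ((min \<bar>Y \<omega>\<bar> (real m))\<^sup>2) \<partial>M) \<le> (\<integral>\<^sup>+ \<omega>. ennreal (?g \<omega>) \<partial>M)"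
      by (intro nn_integral_mono ennreal_leI pt)
    also have "\<dots> = ennreal (expectation ?g)"
      by (rule nn_integral_eq_integral[OF int]) (auto intro!: AE_I2 add_nonneg_nonneg)
    also have "expectation ?g = 2 * expectation (\<lambda>\<omega>. (Z n \<omega>)\<^sup>2) + 2 + 2 * (real m)\<^sup>2 * ?P n 1"
      using Z(2)[of n] ind[of 1 n] by (simp add: prob_space)
    also have "\<dots> \<le> 2 * K + 3" using Z(4)[of n] n' by linarith
    finally show ?thesis by (simp add: ennreal_leI)
  qed
  have "(\<integral>\<^sup>+ \<omega>. ennreal ((Y \<omega>)\<^sup>2) \<partial>M) \<le> (\<integral>\<^sup>+ \<omega>. (SUP m. ennreal ((min \<bar>Y \<omega>\<bar> (real m))\<^sup>2)) \<partial>M)"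
  proof (rule nn_integral_mono)
    fix \<omega>
    obtain m :: nat where "\<bar>Y \<omega>\<bar> \<le> real m" using real_arch_simple by blast
    then have "(Y \<omega>)\<^sup>2 = (min \<bar>Y \<omega>\<bar> (real m))\<^sup>2" by (simp add: min_def)
    then show "ennreal ((Y \<omega>)\<^sup>2) \<le> (SUP m. ennreal ((min \<bar>Y \<omega>\<bar> (real m))\<^sup>2))"
      by (metis SUP_upper UNIV_I)
  qed
  also have "\<dots> = (SUP m. \<integral>\<^sup>+ \<omega>. ennreal ((min \<bar>Y \<omega>\<bar> (real m))\<^sup>2) \<partial>M)"
    by (rule nn_integral_monotone_convergence_SUP)
      (auto simp: incseq_def le_fun_def intro!: ennreal_leI power_mono)
  also have "\<dots> \<le> ennreal (2 * K + 3)" by (rule SUP_least) (rule trunc)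
  finally have Y2_le: "(\<integral>\<^sup>+ \<omega>. ennreal ((Y \<omega>)\<^sup>2) \<partial>M) \<le> ennreal (2 * K + 3)" .
  have Y2: "integrable M (\<lambda>\<omega>. (Y \<omega>)\<^sup>2)"
    by (rule integrableI_bounded) (use Y2_le in \<open>auto simp: ennreal_less_top intro: le_less_trans\<close>)
  have EY2: "expectation (\<lambda>\<omega>. (Y \<omega>)\<^sup>2) \<le> 2 * K + 3"
  proof -
    have "ennreal (expectation (\<lambda>\<omega>. (Y \<omega>)\<^sup>2)) \<le> ennreal (2 * K + 3)"
      using Y2_le nn_integral_eq_integral[OF Y2] by (simp del: ennreal_plus)
    moreover have "0 \<le> 2 * K + 3" using K by simp
    ultimately show ?thesis by (simp only: ennreal_le_iff)
  qed
  have le_sq: "\<bar>x\<bar> \<le> 1 + x\<^sup>2" for x :: real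
    using zero_le_power2[of "\<bar>x\<bar> - 1"] zero_le_power2[of x] abs_ge_zero[of x]
    by (simp add: power2_diff)
  show int: "integrable M Y"
    by (rule Bochner_Integration.integrable_bound[of M "\<lambda>\<omega>. 1 + (Y \<omega>)\<^sup>2"])
      (use Y2 le_sq in \<open>auto intro!: AE_I2\<close>)
  \<comment> \<open>The sum of \<open>2 * K\<close> from \<open>Z n\<close> and of
    \<open>2 * (2 * K + 3)\<close> from \<open>Y\<close>.\<close>
  define K' where "K' = 6 * K + 6"
  have small: "\<bar>expectation Y\<bar> \<le> e + \<eta> * K'" if e: "0 < e" and \<eta>: "0 < \<eta>" for e \<eta>
  proof -
    have le: "\<bar>expectation Y\<bar> \<le> e + \<eta> * K' + ?P n e / (4 * \<eta>)" for n
    proof -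
      let ?D = "\<lambda>\<omega>. Z n \<omega> - Y \<omega>"
      let ?I = "indicator {\<omega>\<in>space M. e < \<bar>Z n \<omega> - Y \<omega>\<bar>} :: _ \<Rightarrow> real"
      \<comment> \<open>Where the deviation \<open>x\<close> exceeds \<open>e\<close>, it is split
        by the inequality between \<open>x\<close> and
        \<open>\<eta> x\<^sup>2 + 1 / (4 \<eta>)\<close>. The large constant then multiplies only a
        small probability, and \<open>n\<close> tends to infinity before \<open>\<eta>\<close> tends
        to \<open>0\<close>.\<close>
      let ?h = "\<lambda>\<omega>. e + \<eta> * (2 * (Z n \<omega>)\<^sup>2 + 2 * (Y \<omega>)\<^sup>2) + ?I \<omega> / (4 * \<eta>)"
      have pt: "\<bar>?D \<omega>\<bar> \<le> ?h \<omega>" if \<omega>: "\<omega> \<in> space M" for \<omega>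
      proof (cases "e < \<bar>?D \<omega>\<bar>")
        case True
        have "0 \<le> (2 * \<eta> * \<bar>?D \<omega>\<bar> - 1)\<^sup>2" by simp
        then have "4 * \<eta> * \<bar>?D \<omega>\<bar> \<le> 4 * \<eta> * (\<eta> * (?D \<omega>)\<^sup>2) + 1"
          by (simp add: power2_diff power_mult_distrib) (simp add: power2_eq_square algebra_simps)
        then have "\<bar>?D \<omega>\<bar> \<le> \<eta> * (?D \<omega>)\<^sup>2 + 1 / (4 * \<eta>)" using \<eta> by (simp add: field_simps)
        moreover have "(?D \<omega>)\<^sup>2 \<le> 2 * (Z n \<omega>)\<^sup>2 + 2 * (Y \<omega>)\<^sup>2"
          using zero_le_power2[of "Z n \<omega> + Y \<omega>"] by (simp add: power2_eq_square algebra_simps)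
        then have "\<eta> * (?D \<omega>)\<^sup>2 \<le> \<eta> * (2 * (Z n \<omega>)\<^sup>2 + 2 * (Y \<omega>)\<^sup>2)"
          using \<eta> by (intro mult_left_mono) auto
        ultimately show ?thesis using True \<omega> e by simp
      next
        case False
        have "0 \<le> \<eta> * (2 * (Z n \<omega>)\<^sup>2 + 2 * (Y \<omega>)\<^sup>2)" using \<eta> by simp
        then show ?thesis using False by simp
      qed
      have int_h: "integrable M ?h" using Z(2)[of n] Y2 ind(1) by auto
      have "\<bar>expectation Y\<bar> = \<bar>expectation ?D\<bar>" using Z(1,3) int by simp
      also have "\<dots> \<le> expectation (\<lambda>\<omega>. \<bar>?D \<omega>\<bar>)" by (rule integral_abs_bound)
      also have "\<dots> \<le> expectation ?h" using Z(1) int int_h pt by (intro integral_mono) auto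
      also have "\<dots> = e + \<eta> * (2 * expectation (\<lambda>\<omega>. (Z n \<omega>)\<^sup>2) + 2 * expectation (\<lambda>\<omega>. (Y \<omega>)\<^sup>2)) + ?P n e / (4 * \<eta>)"
        using Z(2)[of n] Y2 ind[of e n] by (simp add: prob_space)
      also have "\<dots> \<le> e + \<eta> * K' + ?P n e / (4 * \<eta>)"
        using Z(4)[of n] EY2 \<eta> by (simp add: K'_def)
      finally show ?thesis .
    qed
    have "(\<lambda>n. e + \<eta> * K' + ?P n e / (4 * \<eta>)) \<longlonglongrightarrow> e + \<eta> * K' + 0 / (4 * \<eta>)"
      using \<eta> by (intro tendsto_intros lim[OF e]) auto
    then show ?thesis using LIMSEQ_le_const[of _ _ "\<bar>expectation Y\<bar>"] le by fastforce
  qed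
  have "\<bar>expectation Y\<bar> \<le> 0 + e" if e: "0 < e" for e
  proof -
    have K': "K' > 0" using K by (simp add: K'_def)
    show ?thesis using small[of "e / 2" "e / (2 * K')"] e K' by simp
  qed
  then have "\<bar>expectation Y\<bar> \<le> 0" by (rule field_le_epsilon)
  then show "expectation Y = 0" by simp
qed

end

section \<open>From simple processes to the Ito integral\<close>

context brownian_motion
begin

lemma space_F: "space (F t) = space Pr"
  using subalg by (simp add: subalgebra_def)

text \<open>At most one of the half-open intervals contains \<open>s\<close>, so no mixed products
  survive.\<close>

lemma simple_value_sq:
  assumes S: "simple_process Pr F a (k, \<tau>, \<xi>)" and n: "n \<le> k"
  shows "(\<Sum>i<n. \<xi> i \<omega> * indicator {\<tau> i<..\<tau> (Suc i)} s)\<^sup>2 =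
    (\<Sum>i<n. (\<xi> i \<omega>)\<^sup>2 * indicator {\<tau> i<..\<tau> (Suc i)} (s::real))"
  using n
proof (induction n)
  case (Suc n)
  show ?case
  proof (cases "s \<in> {\<tau> n<..\<tau> (Suc n)}")
    case True
    have "indicator {\<tau> i<..\<tau> (Suc i)} s = (0::real)" if "i < n" for i
      using True simple_process_mono[OF S, of "Suc i" n] that Suc.prems by (auto simp: indicator_def)
    then show ?thesis using True by simp
  next
    case False
    then show ?thesis using Suc by simp
  qed
qed simp

lemma nn_integral_simple_value_sq:
  assumes S: "simple_process Pr F a S" and \<omega>: "\<omega> \<in> space Pr"
  shows "(\<integral>\<^sup>+ s\<in>{0..a}. ennreal ((simple_value S s \<omega>)\<^sup>2) \<partial>lborel) = ennreal (energy S (fst S) \<omega>)"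
proof -
  obtain k \<tau> \<xi> where S_eq: "S = (k, \<tau>, \<xi>)" by (cases S) auto
  note S' = S[unfolded S_eq]
  have \<tau>: "0 \<le> \<tau> i" "\<tau> i \<le> \<tau> (Suc i)" "\<tau> (Suc i) \<le> a" if "i < k" for i
    using S' that by (auto simp: simple_process_def)
  have "(\<integral>\<^sup>+ s\<in>{0..a}. ennreal ((simple_value S s \<omega>)\<^sup>2) \<partial>lborel)
      = (\<integral>\<^sup>+ s. (\<Sum>i<k. ennreal ((\<xi> i \<omega>)\<^sup>2) * indicator {\<tau> i<..\<tau> (Suc i)} s) \<partial>lborel)"
  proof (rule nn_integral_cong)
    fix s :: real
    have "(simple_value S s \<omega>)\<^sup>2 = (\<Sum>i<k. (\<xi> i \<omega>)\<^sup>2 * indicator {\<tau> i<..\<tau> (Suc i)} s)"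
      using simple_value_sq[OF S' order_refl, of \<omega> s] by (simp add: simple_value_def S_eq)
    then have "ennreal ((simple_value S s \<omega>)\<^sup>2) = (\<Sum>i<k. ennreal ((\<xi> i \<omega>)\<^sup>2 * indicator {\<tau> i<..\<tau> (Suc i)} s))"
      by (simp add: sum_ennreal)
    also have "\<dots> = (\<Sum>i<k. ennreal ((\<xi> i \<omega>)\<^sup>2) * indicator {\<tau> i<..\<tau> (Suc i)} s)"
      by (intro sum.cong refl) (auto simp: indicator_def)
    finally have *: "ennreal ((simple_value S s \<omega>)\<^sup>2) = \<dots>" .
    have "(\<Sum>i<k. ennreal ((\<xi> i \<omega>)\<^sup>2) * indicator {\<tau> i<..\<tau> (Suc i)} s) = 0" if "s \<notin> {0..a}"
    proof (rule sum.neutral, rule ballI)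
      fix i assume "i \<in> {..<k}"
      then have "s \<notin> {\<tau> i<..\<tau> (Suc i)}" using \<tau>[of i] that by auto
      then show "ennreal ((\<xi> i \<omega>)\<^sup>2) * indicator {\<tau> i<..\<tau> (Suc i)} s = 0" by simp
    qed
    then show "ennreal ((simple_value S s \<omega>)\<^sup>2) * indicator {0..a} s = (\<Sum>i<k. ennreal ((\<xi> i \<omega>)\<^sup>2) * indicator {\<tau> i<..\<tau> (Suc i)} s)"
      unfolding * by (cases "s \<in> {0..a}") auto
  qed
  also have "\<dots> = (\<Sum>i<k. ennreal ((\<xi> i \<omega>)\<^sup>2) * ennreal (\<tau> (Suc i) - \<tau> i))"
    by (subst nn_integral_sum) (use \<tau> in \<open>auto simp: nn_integral_cmult_indicator\<close>)
  also have "\<dots> = ennreal (\<Sum>i<k. (\<xi> i \<omega>)\<^sup>2 * (\<tau> (Suc i) - \<tau> i))"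
    by (subst sum_ennreal[symmetric]) (use \<tau> in \<open>auto simp: ennreal_mult intro!: mult_nonneg_nonneg\<close>)
  finally show ?thesis by (simp add: energy_def S_eq)
qed

text \<open>\<open>null_in_probability\<close> is phrased with \<open>measure\<close>, which is
  \<open>0\<close> on sets that are not measurable, so it yields information only for events shown
  to be measurable. By continuity the supremum is decided at rational times, which are dense in the
  interval because \<open>0 < a\<close>.\<close>

lemma sup_deviation_measurable:
  fixes D :: "real \<Rightarrow> 'w \<Rightarrow> real"
  assumes a: "0 < a" and cont: "\<And>\<omega>. \<omega> \<in> space Pr \<Longrightarrow> continuous_on {0..a} (\<lambda>t. D t \<omega>)"
    and meas: "\<And>t. t \<in> {0..a} \<Longrightarrow> D t \<in> borel_measurable Pr"
  shows "{\<omega>\<in>space Pr. ennreal e < (SUP t\<in>{0..a}. ennreal \<bar>D t \<omega>\<bar>)} \<in> sets Pr"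
proof -
  have "{\<omega>\<in>space Pr. ennreal e < (SUP t\<in>{0..a}. ennreal \<bar>D t \<omega>\<bar>)} =
     (\<Union>q\<in>\<rat> \<inter> {0..a}. {\<omega>\<in>space Pr. ennreal e < ennreal \<bar>D q \<omega>\<bar>})"
  proof (intro set_eqI iffI)
    fix \<omega> assume "\<omega> \<in> {\<omega>\<in>space Pr. ennreal e < (SUP t\<in>{0..a}. ennreal \<bar>D t \<omega>\<bar>)}"
    then obtain t where \<omega>: "\<omega> \<in> space Pr" and t: "t \<in> {0..a}" "ennreal e < ennreal \<bar>D t \<omega>\<bar>"
      by (auto simp: less_SUP_iff)
    have "continuous_on {0..a} (\<lambda>t. ennreal \<bar>D t \<omega>\<bar>)"
      using cont[OF \<omega>] by (intro continuous_on_ennreal continuous_intros)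
    then have "((\<lambda>t. ennreal \<bar>D t \<omega>\<bar>) \<longlongrightarrow> ennreal \<bar>D t \<omega>\<bar>) (at t within {0..a})"
      using t(1) by (simp add: continuous_on_def)
    then have "eventually (\<lambda>s. ennreal e < ennreal \<bar>D s \<omega>\<bar>) (at t within {0..a})"
      using t(2) by (rule order_tendstoD)
    then obtain d where d: "d > 0" "\<And>s. s \<in> {0..a} \<Longrightarrow> s \<noteq> t \<Longrightarrow> dist s t < d \<Longrightarrow> ennreal e < ennreal \<bar>D s \<omega>\<bar>"
      unfolding eventually_at by blast
    have "max 0 (t - d) < min a (t + d)" using t(1) d(1) a by auto
    then obtain q where q: "q \<in> \<rat>" "max 0 (t - d) < q" "q < min a (t + d)"
      using Rats_dense_in_real by blast
    have "ennreal e < ennreal \<bar>D q \<omega>\<bar>"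
      using d(2)[of q] q t(2) by (cases "q = t") (auto simp: dist_real_def)
    then show "\<omega> \<in> (\<Union>q\<in>\<rat> \<inter> {0..a}. {\<omega>\<in>space Pr. ennreal e < ennreal \<bar>D q \<omega>\<bar>})"
      using q \<omega> by auto
  next
    fix \<omega> assume "\<omega> \<in> (\<Union>q\<in>\<rat> \<inter> {0..a}. {\<omega>\<in>space Pr. ennreal e < ennreal \<bar>D q \<omega>\<bar>})"
    then show "\<omega> \<in> {\<omega>\<in>space Pr. ennreal e < (SUP t\<in>{0..a}. ennreal \<bar>D t \<omega>\<bar>)}"
      by (auto simp: less_SUP_iff)
  qed
  also have "\<dots> \<in> sets Pr"
  proof (rule sets.countable_UN'')
    show "countable (\<rat> \<inter> {0..a})" using countable_rat by blast
    fix q assume "q \<in> \<rat> \<inter> {0..a}"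
    then have [measurable]: "D q \<in> borel_measurable Pr" using meas by blast
    show "{\<omega>\<in>space Pr. ennreal e < ennreal \<bar>D q \<omega>\<bar>} \<in> sets Pr" by measurable
  qed
  finally show ?thesis .
qed

lemma simple_integral_continuous:
  assumes S: "simple_process Pr F a S" and \<omega>: "\<omega> \<in> space Pr"
  shows "continuous_on {0..a} (\<lambda>t. simple_integral B S t \<omega>)"
proof -
  obtain k \<tau> \<xi> where S_eq: "S = (k, \<tau>, \<xi>)" by (cases S) auto
  have \<tau>: "0 \<le> \<tau> i" "0 \<le> \<tau> (Suc i)" if "i < k" for i
    using S that unfolding S_eq simple_process_def by force+
  have "continuous_on {0..a} (\<lambda>t. B (min t u) \<omega>)" if "0 \<le> u" for u
    by (rule continuous_on_compose2[OF path_continuous[OF \<omega>]]) (use that in \<open>auto intro: continuous_intros\<close>)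
  then show ?thesis unfolding S_eq simple_integral_eq using \<tau> by (intro continuous_intros) auto
qed

lemma simple_integral_measurable:
  assumes S: "simple_process Pr F a S" and t: "0 \<le> t"
  shows "simple_integral B S t \<in> borel_measurable Pr"
proof -
  obtain k \<tau> \<xi> where S_eq: "S = (k, \<tau>, \<xi>)" by (cases S) auto
  have "integrable Pr (\<lambda>\<omega>. \<Sum>i<k. \<xi> i \<omega> * (B (min t (\<tau> (Suc i))) \<omega> - B (min t (\<tau> i)) \<omega>))"
    using simple_integral_moments[OF S[unfolded S_eq] t order_refl] by blast
  then show ?thesis unfolding S_eq simple_integral_eq[abs_def] by auto
qed

text \<open>Progressive measurability at the last time \<open>a\<close> gives joint measurability in
  time and path, and integrating over time keeps the dependence on the path measurable.\<close>

lemma progressive_diff_measurable: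
  assumes a: "0 \<le> a" and S: "simple_process Pr F a S" and H: "progressive F a H"
  shows "(\<lambda>\<omega>. \<integral>\<^sup>+ s\<in>{0..a}. ennreal ((simple_value S s \<omega> - H s \<omega>)\<^sup>2) \<partial>lborel) \<in> borel_measurable Pr"
    and "\<omega> \<in> space Pr \<Longrightarrow> (\<lambda>s. H s \<omega>) \<in> borel_measurable (restrict_space lborel {0..a})"
proof -
  obtain k \<tau> \<xi> where S_eq: "S = (k, \<tau>, \<xi>)" by (cases S) auto
  let ?R = "restrict_space lborel {0..a}"
  have sets_R: "sets (restrict_space borel {0..a}) = sets ?R" by (rule sets_restrict_space_cong) simp
  have "(\<lambda>(s, \<omega>). H s \<omega>) \<in> borel_measurable (restrict_space borel {0..a} \<Otimes>\<^sub>M F a)"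
    using H a unfolding progressive_def by auto
  then have H': "(\<lambda>(s, \<omega>). H s \<omega>) \<in> borel_measurable (?R \<Otimes>\<^sub>M F a)"
    by (simp only: measurable_cong_sets[OF sets_pair_measure_cong[OF sets_R refl] refl])
  from measurable_pair_swap[OF H']
  have Hs [measurable]: "(\<lambda>(\<omega>, s). H s \<omega>) \<in> borel_measurable (F a \<Otimes>\<^sub>M ?R)" by simp
  have \<xi>: "\<xi> i \<in> borel_measurable (F a)" if "i < k" for i
  proof (rule simple_process_measurable[OF S[unfolded S_eq] that])
    show "\<tau> i \<le> a" using S that unfolding S_eq simple_process_def by force
  qed
  have [measurable]: "(\<lambda>(\<omega>, s). simple_value S s \<omega>) \<in> borel_measurable (F a \<Otimes>\<^sub>M ?R)"
  proof -
    have "(\<lambda>(\<omega>, s). \<Sum>i<k. \<xi> i \<omega> * indicator {\<tau> i<..\<tau> (Suc i)} s) \<in> borel_measurable (F a \<Otimes>\<^sub>M ?R)"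
      unfolding split_beta'
    proof (intro borel_measurable_sum borel_measurable_times)
      fix i assume "i \<in> {..<k}"
      then show "(\<lambda>x. \<xi> i (fst x)) \<in> borel_measurable (F a \<Otimes>\<^sub>M ?R)"
        using measurable_compose[OF measurable_fst \<xi>] by simp
      have "(\<lambda>s. indicator {\<tau> i<..\<tau> (Suc i)} s :: real) \<in> borel_measurable ?R"
        by (rule measurable_restrict_space1) simp
      from measurable_compose[OF measurable_snd this]
      show "(\<lambda>x. indicator {\<tau> i<..\<tau> (Suc i)} (snd x) :: real) \<in> borel_measurable (F a \<Otimes>\<^sub>M ?R)" .
    qed
    then show ?thesis by (simp add: simple_value_def S_eq)
  qed
  interpret R: sigma_finite_measure ?R
    by (rule sigma_finite_measure_restrict_space) (auto simp: lborel.sigma_finite_measure_axioms)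
  have "(\<lambda>\<omega>. \<integral>\<^sup>+ s. ennreal ((simple_value S s \<omega> - H s \<omega>)\<^sup>2) \<partial>?R) \<in> borel_measurable (F a)"
    by measurable
  then show "(\<lambda>\<omega>. \<integral>\<^sup>+ s\<in>{0..a}. ennreal ((simple_value S s \<omega> - H s \<omega>)\<^sup>2) \<partial>lborel) \<in> borel_measurable Pr"
    using measurable_Pr by (simp add: nn_integral_restrict_space)
  show "(\<lambda>s. H s \<omega>) \<in> borel_measurable ?R" if "\<omega> \<in> space Pr"
    using measurable_Pair1[OF H', of \<omega>] that space_F by simp
qed

text \<open>The inequality \<open>x\<^sup>2 \<le> 2 (x - y)\<^sup>2 + 2 y\<^sup>2\<close> is
  integrated over \<open>{0..a}\<close>. The bound on \<open>H\<close> is available at positive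
  times only, but the time \<open>0\<close> is a null set.\<close>

lemma energy_le:
  assumes a: "0 < a" and S: "simple_process Pr F a S" and H: "progressive F a H"
    and \<omega>: "\<omega> \<in> space Pr" and bound: "\<And>s. s \<in> {0<..a} \<Longrightarrow> (H s \<omega>)\<^sup>2 \<le> C" and C: "0 \<le> C"
    and near: "(\<integral>\<^sup>+ s\<in>{0..a}. ennreal ((simple_value S s \<omega> - H s \<omega>)\<^sup>2) \<partial>lborel) \<le> ennreal 1"
  shows "energy S (fst S) \<omega> \<le> 2 + 2 * C * a"
proof -
  obtain k \<tau> \<xi> where S_eq: "S = (k, \<tau>, \<xi>)" by (cases S) auto
  let ?R = "restrict_space lborel {0..a}"
  have [measurable]: "(\<lambda>s. H s \<omega>) \<in> borel_measurable ?R"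
    using progressive_diff_measurable(2)[OF _ S H \<omega>] a by simp
  have [measurable]: "(\<lambda>s. simple_value S s \<omega>) \<in> borel_measurable ?R"
    unfolding simple_value_def S_eq prod.case by (rule measurable_restrict_space1) measurable
  have "ennreal (energy S (fst S) \<omega>) = (\<integral>\<^sup>+ s. ennreal ((simple_value S s \<omega>)\<^sup>2) \<partial>?R)"
    using nn_integral_simple_value_sq[OF S \<omega>] by (simp add: nn_integral_restrict_space)
  also have "\<dots> \<le> (\<integral>\<^sup>+ s. 2 * ennreal ((simple_value S s \<omega> - H s \<omega>)\<^sup>2) + ennreal (2 * C) \<partial>?R)"
  proof (rule nn_integral_mono_AE)
    have "AE s in lborel. s \<noteq> (0::real)" by (rule AE_lborel_singleton)
    then have "AE s in ?R. s \<noteq> 0" by (auto simp: AE_restrict_space_iff elim: eventually_mono)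
    moreover have "AE s in ?R. s \<in> {0..a}" by (rule AE_I2) (simp add: space_restrict_space)
    ultimately show "AE s in ?R. ennreal ((simple_value S s \<omega>)\<^sup>2) \<le>
        2 * ennreal ((simple_value S s \<omega> - H s \<omega>)\<^sup>2) + ennreal (2 * C)"
    proof eventually_elim
      case (elim s)
      let ?x = "simple_value S s \<omega>" and ?y = "H s \<omega>"
      have "?x\<^sup>2 \<le> 2 * (?x - ?y)\<^sup>2 + 2 * ?y\<^sup>2"
        using zero_le_power2[of "?x - 2 * ?y"] by (simp add: power2_eq_square algebra_simps)
      also have "?y\<^sup>2 \<le> C" using elim by (intro bound) auto
      finally have "ennreal (?x\<^sup>2) \<le> ennreal (2 * (?x - ?y)\<^sup>2 + 2 * C)" by (simp add: ennreal_leI)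
      also have "\<dots> = 2 * ennreal ((?x - ?y)\<^sup>2) + ennreal (2 * C)"
        using C by (simp add: ennreal_plus ennreal_mult')
      finally show ?case .
    qed
  qed
  also have "\<dots> = 2 * (\<integral>\<^sup>+ s. ennreal ((simple_value S s \<omega> - H s \<omega>)\<^sup>2) \<partial>?R) + ennreal (2 * C) * emeasure ?R (space ?R)"
    by (simp add: nn_integral_add nn_integral_cmult)
  also have "emeasure ?R (space ?R) = ennreal a"
    using a by (simp add: space_restrict_space emeasure_restrict_space)
  also have "(\<integral>\<^sup>+ s. ennreal ((simple_value S s \<omega> - H s \<omega>)\<^sup>2) \<partial>?R) \<le> ennreal 1"
    using near by (simp add: nn_integral_restrict_space)
  also have "2 * ennreal 1 + ennreal (2 * C) * ennreal a = ennreal (2 + 2 * C * a)"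
    using C a by (simp add: ennreal_mult'[symmetric] ennreal_plus)
  finally have "ennreal (energy S (fst S) \<omega>) \<le> ennreal (2 + 2 * C * a)"
    by (simp add: mult_left_mono add_mono)
  moreover have "0 \<le> 2 + 2 * C * a" using C a by simp
  ultimately show ?thesis by (simp only: ennreal_le_iff)
qed

text \<open>Unless the integral over \<open>{0..a}\<close> of the squared difference between a
  simple process and \<open>H\<close> exceeds \<open>1\<close>, the energy is almost surely at most
  \<open>K = 2 + 2 * C * a\<close> and stopping changes nothing. The probability of the exception
  tends to \<open>0\<close>, so the stopped integrals have the same limit in probability, while
  their second moments are at most \<open>K\<close>.\<close>

lemma ito_integral_mean_zero:
  assumes a: "0 < a" and I: "is_ito_integral Pr F a B H Y" and t: "t \<in> {0..a}"
    and C: "0 \<le> C" and bound: "AE \<omega> in Pr. \<forall>s\<in>{0<..a}. (H s \<omega>)\<^sup>2 \<le> C"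
  shows "integrable Pr (Y t)" "expectation (Y t) = 0"
proof -
  have H: "progressive F a H" and Ym: "\<And>t. t \<in> {0..a} \<Longrightarrow> Y t \<in> borel_measurable Pr"
    and Yc: "\<And>\<omega>. \<omega> \<in> space Pr \<Longrightarrow> continuous_on {0..a} (\<lambda>t. Y t \<omega>)"
    using I unfolding is_ito_integral_def by blast+
  obtain S where S: "\<And>n. simple_process Pr F a (S n)"
    and S1: "null_in_probability Pr
          (\<lambda>n \<omega>. \<integral>\<^sup>+ s\<in>{0..a}. ennreal ((simple_value (S n) s \<omega> - H s \<omega>)\<^sup>2) \<partial>lborel)"
    and S2: "null_in_probability Pr
          (\<lambda>n \<omega>. SUP t\<in>{0..a}. ennreal \<bar>simple_integral B (S n) t \<omega> - Y t \<omega>\<bar>)"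
    using I unfolding is_ito_integral_def by blast
  have t0: "0 \<le> t" using t by simp
  define K where "K = 2 + 2 * C * a"
  have K: "0 \<le> K" using C a by (simp add: K_def)
  let ?S = "\<lambda>n. stop_energy K (S n)"
  note S' = stop_energy_simple_process[OF S K]
  have bd: "energy (?S n) (fst (?S n)) \<omega> \<le> K" for n \<omega> by (rule stop_energy_bound[OF S K])
  note mean = simple_integral_mean[OF S' t0 bd]
  have [measurable]: "Y t \<in> borel_measurable Pr" by (rule Ym[OF t])
  have [measurable]: "simple_integral B (S n) t \<in> borel_measurable Pr"
    "simple_integral B (?S n) t \<in> borel_measurable Pr" for n
    using simple_integral_measurable[OF S t0] simple_integral_measurable[OF S' t0] by auto
  let ?J = "\<lambda>n \<omega>. \<integral>\<^sup>+ s\<in>{0..a}. ennreal ((simple_value (S n) s \<omega> - H s \<omega>)\<^sup>2) \<partial>lborel"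
  let ?A = "\<lambda>n. {\<omega>\<in>space Pr. ennreal 1 < ?J n \<omega>}"
  let ?B = "\<lambda>n e. {\<omega>\<in>space Pr. ennreal e < (SUP t\<in>{0..a}. ennreal \<bar>simple_integral B (S n) t \<omega> - Y t \<omega>\<bar>)}"
  have Jm [measurable]: "?J n \<in> borel_measurable Pr" for n
    using progressive_diff_measurable(1)[OF _ S H] a by simp
  have A: "?A n \<in> sets Pr" for n by measurable
  have Bm: "?B n e \<in> sets Pr" for n e
    by (rule sup_deviation_measurable[OF a])
      (use simple_integral_continuous[OF S] Yc simple_integral_measurable[OF S] Ym in
        \<open>auto intro!: continuous_intros borel_measurable_diff\<close>)
  have le: "prob {\<omega>\<in>space Pr. e < \<bar>simple_integral B (?S n) t \<omega> - Y t \<omega>\<bar>} \<le> prob (?A n) + prob (?B n e)"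
    if e: "0 < e" for n e
  proof -
    have "prob {\<omega>\<in>space Pr. e < \<bar>simple_integral B (?S n) t \<omega> - Y t \<omega>\<bar>} \<le> prob (?A n \<union> ?B n e)"
    proof (rule finite_measure_mono_AE)
      show "AE \<omega> in Pr. \<omega> \<in> {\<omega>\<in>space Pr. e < \<bar>simple_integral B (?S n) t \<omega> - Y t \<omega>\<bar>} \<longrightarrow> \<omega> \<in> ?A n \<union> ?B n e"
        using bound
      proof eventually_elim
        case (elim \<omega>)
        show ?case
        proof (intro impI)
          assume "\<omega> \<in> {\<omega>\<in>space Pr. e < \<bar>simple_integral B (?S n) t \<omega> - Y t \<omega>\<bar>}"
          then have \<omega>: "\<omega> \<in> space Pr" and dev: "e < \<bar>simple_integral B (?S n) t \<omega> - Y t \<omega>\<bar>" by auto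
          show "\<omega> \<in> ?A n \<union> ?B n e"
          proof (cases "\<omega> \<in> ?A n")
            case False
            then have "?J n \<omega> \<le> ennreal 1" using \<omega> by (auto simp: not_less)
            then have "energy (S n) (fst (S n)) \<omega> \<le> K"
              unfolding K_def using elim by (intro energy_le[OF a S H \<omega> _ C]) auto
            then have "e < \<bar>simple_integral B (S n) t \<omega> - Y t \<omega>\<bar>"
              using dev stop_energy_same[OF S K] by simp
            then have "ennreal e < ennreal \<bar>simple_integral B (S n) t \<omega> - Y t \<omega>\<bar>"
              using e by (simp add: ennreal_less_iff)
            then show ?thesis using \<omega> t by (auto simp: less_SUP_iff)
          qed simp
        qed
      qed
    qed (use A Bm in auto)
    also have "\<dots> \<le> prob (?A n) + prob (?B n e)" using A Bm by (rule measure_Un_le)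
    finally show ?thesis .
  qed
  have lim: "(\<lambda>n. prob {\<omega>\<in>space Pr. e < \<bar>simple_integral B (?S n) t \<omega> - Y t \<omega>\<bar>}) \<longlonglongrightarrow> 0" if e: "0 < e" for e
  proof (rule tendsto_sandwich[where f = "\<lambda>_. 0" and h = "\<lambda>n. prob (?A n) + prob (?B n e)"])
    have "(\<lambda>n. prob (?A n)) \<longlonglongrightarrow> 0" 
      by (rule S1[unfolded null_in_probability_def, rule_format, OF zero_less_one])
    moreover have "(\<lambda>n. prob (?B n e)) \<longlonglongrightarrow> 0" 
      by (rule S2[unfolded null_in_probability_def, rule_format, OF e])
    ultimately show "(\<lambda>n. prob (?A n) + prob (?B n e)) \<longlonglongrightarrow> 0" using tendsto_add by fastforce
  qed (use le[OF e] in auto)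
  show "integrable Pr (Y t)" "expectation (Y t) = 0"
    using expectation_limit_in_probability[of "\<lambda>n. simple_integral B (?S n) t" K "Y t"] mean lim by auto
qed

end

section \<open>The solution stays in the fibre\<close>

lemma rational_zero_imp_zero:
  fixes u :: "real \<Rightarrow> real"
  assumes a: "0 < a" and u: "continuous_on {0..a} u" and zero: "\<And>q. q \<in> \<rat> \<inter> {0..a} \<Longrightarrow> u q = 0"
    and t: "t \<in> {0..a}"
  shows "u t = 0"
proof (rule ccontr)
  assume "u t \<noteq> 0"
  moreover have "(u \<longlongrightarrow> u t) (at t within {0..a})" using u t by (simp add: continuous_on_def)
  ultimately have "eventually (\<lambda>s. u s \<noteq> 0) (at t within {0..a})"
    using tendsto_imp_eventually_ne by blast
  then obtain d where d: "d > 0" "\<And>s. s \<in> {0..a} \<Longrightarrow> s \<noteq> t \<Longrightarrow> dist s t < d \<Longrightarrow> u s \<noteq> 0"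
    unfolding eventually_at by blast
  have "max 0 (t - d) < min a (t + d)" using t d(1) a by auto
  then obtain q where q: "q \<in> \<rat>" "max 0 (t - d) < q" "q < min a (t + d)"
    using Rats_dense_in_real by blast
  have "q \<in> {0..a}" "dist q t < d" using q by (auto simp: dist_real_def)
  then show False using d(2)[of q] zero[of q] q(1) \<open>u t \<noteq> 0\<close> by (cases "q = t") auto
qed

text \<open>An almost sure statement supplies a measurable null superset, so \<open>A\<close> itself
  may fail to be measurable.\<close>

lemma outer_measure_of_AE:
  assumes "AE \<omega> in M. \<omega> \<notin> A" "A \<subseteq> space M"
  shows "outer_measure_of M A = 0"
proof -
  obtain N where N: "{\<omega>\<in>space M. \<not> \<omega> \<notin> A} \<subseteq> N" "emeasure M N = 0" "N \<in> sets M"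
    using AE_E[OF assms(1)] by blast
  have "A \<subseteq> N" using N(1) assms(2) by blast
  then have "outer_measure_of M A \<le> emeasure M N"
    unfolding outer_measure_of_def using N(3) by (intro INF_lower) auto
  then show ?thesis using N(2) by simp
qed

lemma AE_in_fibre:
  fixes AM :: "('m::{t2_space,second_countable_topology}, 'e::euclidean_space) atlas"
    and AN :: "('n::{t2_space,second_countable_topology}, 'f::euclidean_space) atlas"
    and AP :: "('p::{t2_space,second_countable_topology}, 'k::euclidean_space) atlas"
    and X :: "real \<Rightarrow> 'w \<Rightarrow> 'm" and U :: "real \<Rightarrow> 'w \<Rightarrow> 'n"
  assumes AM: "manifold AM" and ball: "normal_ball AP g p c r" and h: "smooth_map AM AP h"
    and G: "diffusion_generator AM G" and V: "\<forall>x u. V x u \<in> tangent_space AM x"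
    and \<sigma>: "\<forall>l\<in>{1..d}. \<forall>u. smooth_vector_field AM (\<lambda>x. \<sigma> l x u)"
    and basis: "stochastic_basis Pr F" and W: "wiener_process Pr F d W" and a: "0 < a" and b: "0 \<le> b"
    and X: "\<And>\<omega>. \<omega> \<in> space Pr \<Longrightarrow> continuous_on {0..a} (\<lambda>t. X t \<omega>)"
    and X0: "AE \<omega> in Pr. h (X 0 \<omega>) = p" and sde: "solves_sde AM G d V \<sigma> Pr F W a X U"
    and drift: "AE \<omega> in Pr. \<forall>t\<in>{0<..a}. smooth_fun_at AP (h (X t \<omega>)) (dist_sq AP g p) \<longrightarrow>
           image_drift AM AP h G d V \<sigma> (X t \<omega>) (U t \<omega>) (dist_sq AP g p)
             = - b * dist_sq AP g p (h (X t \<omega>))"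
    and noise: "noise_bound AP g h p d \<sigma> Pr a X U < \<infinity>"
  shows "AE \<omega> in Pr. \<forall>t\<in>{0..a}. h (X t \<omega>) = p"
proof -
  interpret M: manifold AM by fact
  interpret P: normal_ball AP g p c r by fact
  interpret prob_space Pr using basis by (simp add: stochastic_basis_def)
  \<comment> \<open>Half of \<open>r\<^sup>2\<close> leaves room inside the normal ball;
    \<open>1 / 2\<close> ensures the concavity of \<open>cap \<kappa>\<close> on nonnegative
    arguments.\<close>
  define \<kappa> where "\<kappa> = min (1 / 2) (r\<^sup>2 / 2)"
  have \<kappa>: "0 < \<kappa>" "\<kappa> < r\<^sup>2" "\<kappa> \<le> 1 / 2" using P.r by (auto simp: \<kappa>_def min_less_iff_disj)
  define f where "f = (\<lambda>y. P.cutoff \<kappa> (h y))"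
  define C where "C = enn2real (noise_bound AP g h p d \<sigma> Pr a X U)"
  have f_smooth: "smooth_fun_at AM x f" for x
  proof -
    have "smooth_map_at AM euclidean_atlas x f"
      unfolding f_def
      using AM h P.cutoff_smooth[OF \<kappa>(1,2)]
      by (intro smooth_map_at_compose[of AM AP euclidean_atlas x h "P.cutoff \<kappa>"])
        (auto simp: manifold_euclidean smooth_map_def smooth_fun_def smooth_fun_at_def P.manifold_axioms)
    then show ?thesis by (simp add: smooth_fun_at_def)
  qed
  have f_cont: "isCont f x" for x
    using smooth_map_at_isCont[OF AM manifold_euclidean] f_smooth unfolding smooth_fun_at_def by blast
  have f_nonneg: "0 \<le> f x" for x unfolding f_def by (rule P.cutoff_nonneg[OF \<kappa>(1)])
  have f_0: "f x = 0 \<longleftrightarrow> h x = p" for x unfolding f_def by (rule P.cutoff_eq_0_iff[OF \<kappa>(1)])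
  obtain Y where Y: "\<And>l. l \<in> {1..d} \<Longrightarrow> is_ito_integral Pr F a (W l) (\<lambda>s \<omega>. \<sigma> l (X s \<omega>) (U s \<omega>) f) (Y l)"
    and eq: "AE \<omega> in Pr. \<forall>t\<in>{0..a}. f (X t \<omega>) = f (X 0 \<omega>)
              + (LBINT s:{0..t}. sde_drift G d V \<sigma> (X s \<omega>) (U s \<omega>) f) + (\<Sum>l=1..d. Y l t \<omega>)"
  proof -
    have "smooth_fun AM f" using f_smooth by (simp add: smooth_fun_def)
    then obtain Y where "\<forall>l\<in>{1..d}. is_ito_integral Pr F a (W l) (\<lambda>s \<omega>. \<sigma> l (X s \<omega>) (U s \<omega>) f) (Y l)"
      and eq: "AE \<omega> in Pr. set_integrable lborel {0..a} (\<lambda>s. sde_drift G d V \<sigma> (X s \<omega>) (U s \<omega>) f) \<and>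
           (\<forall>t\<in>{0..a}. f (X t \<omega>) = f (X 0 \<omega>)
              + (LBINT s:{0..t}. sde_drift G d V \<sigma> (X s \<omega>) (U s \<omega>) f) + (\<Sum>l=1..d. Y l t \<omega>))"
      using sde unfolding solves_sde_def by blast
    moreover from eq have "AE \<omega> in Pr. \<forall>t\<in>{0..a}. f (X t \<omega>) = f (X 0 \<omega>)
              + (LBINT s:{0..t}. sde_drift G d V \<sigma> (X s \<omega>) (U s \<omega>) f) + (\<Sum>l=1..d. Y l t \<omega>)"
      by eventually_elim blast
    ultimately show ?thesis using that by blast
  qed
  have \<sigma>': "\<sigma> l x u \<in> tangent_space AM x" if "l \<in> {1..d}" for l x u
    using \<sigma> that unfolding smooth_vector_field_def by blast
  have V': "V x u \<in> tangent_space AM x" for x u using V by blast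
  have noise_le: "(\<Sum>l=1..d. (pushforward AP h (X t \<omega>) (\<sigma> l (X t \<omega>) (U t \<omega>)) (dist_sq AP g p))\<^sup>2) \<le> C"
    if "t \<in> {0<..a}" "\<omega> \<in> space Pr" for t \<omega>
  proof -
    have "ennreal (\<Sum>l=1..d. (pushforward AP h (X t \<omega>) (\<sigma> l (X t \<omega>) (U t \<omega>)) (dist_sq AP g p))\<^sup>2)
        \<le> noise_bound AP g h p d \<sigma> Pr a X U"
      unfolding noise_bound_def using that by (intro SUP_upper2[of "(X t \<omega>, U t \<omega>)"]) auto
    also have "\<dots> = ennreal C" using noise by (simp add: C_def)
    finally show ?thesis by (simp add: C_def ennreal_le_iff)
  qed
  have bounds: "AE \<omega> in Pr. \<forall>s\<in>{0<..a}. sde_drift G d V \<sigma> (X s \<omega>) (U s \<omega>) f \<le> 0 \<and>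
      (\<forall>l\<in>{1..d}. (\<sigma> l (X s \<omega>) (U s \<omega>) f)\<^sup>2 \<le> 16 * C)"
    using drift AE_space
  proof eventually_elim
    case (elim \<omega>)
    show ?case
    proof (intro ballI conjI)
      fix s assume s: "s \<in> {0<..a}"
      note cd = cutoff_drift[where V = V and \<sigma> = \<sigma> and x = "X s \<omega>" and u = "U s \<omega>" and d = d and b = b,
          OF AM ball h G V' \<sigma>' \<kappa> b, folded f_def]
      show "sde_drift G d V \<sigma> (X s \<omega>) (U s \<omega>) f \<le> 0" using cd(1) elim s by blast
      fix l assume l: "l \<in> {1..d}"
      have "(\<sigma> l (X s \<omega>) (U s \<omega>) f)\<^sup>2 \<le>
        16 * (\<Sum>l=1..d. (pushforward AP h (X s \<omega>) (\<sigma> l (X s \<omega>) (U s \<omega>)) (dist_sq AP g p))\<^sup>2)"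
        using cd(2)[OF _ _ l] elim s l by blast
      also have "\<dots> \<le> 16 * C" using noise_le[OF s] elim by simp
      finally show "(\<sigma> l (X s \<omega>) (U s \<omega>) f)\<^sup>2 \<le> 16 * C" .
    qed
  qed
  have mean: "integrable Pr (Y l t) \<and> expectation (Y l t) = 0" if l: "l \<in> {1..d}" and t: "t \<in> {0..a}" for l t
  proof -
    interpret B: brownian_motion Pr F "W l" by (rule wiener_process_brownian_motion[OF basis W l])
    have "AE \<omega> in Pr. \<forall>s\<in>{0<..a}. (\<sigma> l (X s \<omega>) (U s \<omega>) f)\<^sup>2 \<le> 16 * C"
      using bounds by eventually_elim (use l in blast)
    then show ?thesis
      using B.ito_integral_mean_zero[OF a Y[OF l] t, of "16 * C"] by (simp add: C_def)
  qed
  have zero_at: "AE \<omega> in Pr. f (X t \<omega>) = 0" if t: "t \<in> {0..a}" for t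
  proof -
    let ?N = "\<lambda>\<omega>. \<Sum>l=1..d. Y l t \<omega>"
    have le: "AE \<omega> in Pr. f (X t \<omega>) \<le> ?N \<omega>"
      using eq bounds X0
    proof eventually_elim
      case (elim \<omega>)
      let ?b = "\<lambda>s. sde_drift G d V \<sigma> (X s \<omega>) (U s \<omega>) f"
      \<comment> \<open>The sign of the drift is known at positive times only; the single time
        \<open>0\<close> does not affect the integral.\<close>
      have "AE s in lborel. s \<noteq> (0::real)" by (rule AE_lborel_singleton)
      then have "AE s in lborel. 0 \<le> - (indicator {0..t} s *\<^sub>R ?b s)"
        by eventually_elim (use elim(2) t in \<open>auto simp: indicator_def\<close>)
      then have "0 \<le> (LBINT s. - (indicator {0..t} s *\<^sub>R ?b s))" by (rule integral_nonneg_AE)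
      then have "(LBINT s:{0..t}. ?b s) \<le> 0" by (simp add: set_lebesgue_integral_def)
      moreover have "f (X 0 \<omega>) = 0" using elim(3) f_0 by simp
      ultimately show ?case using elim(1) t by simp
    qed
    have int: "integrable Pr ?N" using mean[OF _ t] by auto
    \<comment> \<open>A nonnegative variable with mean \<open>0\<close> vanishes almost surely, and
      \<open>f (X t \<omega>)\<close> is squeezed between \<open>0\<close> and this one.\<close>
    have "expectation ?N = 0" using mean[OF _ t] by (subst Bochner_Integration.integral_sum) auto
    moreover have "AE \<omega> in Pr. 0 \<le> ?N \<omega>" using le by eventually_elim (use f_nonneg order_trans in blast)
    ultimately have "AE \<omega> in Pr. ?N \<omega> = 0" using integral_nonneg_eq_0_iff_AE[OF int] by simp
    then show ?thesis using le by eventually_elim (use f_nonneg antisym in metis)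
  qed
  \<comment> \<open>The exceptional null set depends on the time, so countably many times are
    treated at once; the others follow by continuity of the paths.\<close>
  have "AE \<omega> in Pr. \<forall>q\<in>\<rat> \<inter> {0..a}. f (X q \<omega>) = 0"
  proof (rule AE_ball_countable[THEN iffD2])
    show "countable (\<rat> \<inter> {0..a})" using countable_rat by blast
  qed (use zero_at in blast)
  then show ?thesis
    using AE_space
  proof eventually_elim
    case (elim \<omega>)
    have "continuous_on UNIV f" using f_cont by (intro continuous_at_imp_continuous_on) blast
    then have "continuous_on {0..a} (\<lambda>t. f (X t \<omega>))"
      by (rule continuous_on_compose2[OF _ X[OF elim(2)]]) simp
    from rational_zero_imp_zero[OF a this] elim(1) f_0 show ?case by blast
  qed
qed

theorem corollary4p3p1:
  fixes AM :: "('m::{t2_space,second_countable_topology}, 'e::euclidean_space) atlas"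
    and AN :: "('n::{t2_space,second_countable_topology}, 'f::euclidean_space) atlas"
    and AP :: "('p::{t2_space,second_countable_topology}, 'k::euclidean_space) atlas"
    and g :: "'p metric" and p :: 'p and h :: "'m \<Rightarrow> 'p"
    and G :: "'m \<Rightarrow> 'm operator \<Rightarrow> 'm operator"
    and d :: nat
    and V :: "'m \<Rightarrow> 'n \<Rightarrow> 'm operator"
    and \<sigma> :: "nat \<Rightarrow> 'm \<Rightarrow> 'n \<Rightarrow> 'm operator"
    and Pr :: "'w measure" and F :: "real \<Rightarrow> 'w measure"
    and W :: "nat \<Rightarrow> real \<Rightarrow> 'w \<Rightarrow> real"
    and X :: "real \<Rightarrow> 'w \<Rightarrow> 'm" and U :: "real \<Rightarrow> 'w \<Rightarrow> 'n"
    and a \<alpha> \<epsilon> b :: real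
  assumes "smooth_manifold AM" and "smooth_manifold AN" and "smooth_manifold AP"
    and "riemannian_metric AP g"
    and "smooth_map AM AP h"
    and "diffusion_generator AM G"
    and "\<forall>x u. V x u \<in> tangent_space AM x"
    and "\<forall>l\<in>{1..d}. \<forall>u. smooth_vector_field AM (\<lambda>x. \<sigma> l x u)"
    and "stochastic_basis Pr F" and "wiener_process Pr F d W"
    and "0 < a" and "0 < \<alpha>" and "\<alpha> \<le> 1"
    and "0 < \<epsilon>" and "ennreal \<epsilon> < injectivity_radius AP g p"
    and "semimartingale_in (product_atlas AM AN) Pr F a (\<lambda>t \<omega>. (X t \<omega>, U t \<omega>))"
    and "AE \<omega> in Pr. h (X 0 \<omega>) = p"
    and "solves_sde AM G d V \<sigma> Pr F W a X U"
    and "AE \<omega> in Pr. \<forall>t\<in>{0<..a}. smooth_fun_at AP (h (X t \<omega>)) (dist_sq AP g p) \<longrightarrow>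
           image_drift AM AP h G d V \<sigma> (X t \<omega>) (U t \<omega>) (dist_sq AP g p)
             = - b * dist_sq AP g p (h (X t \<omega>))"
    and "noise_bound AP g h p d \<sigma> Pr a X U < \<infinity>"
    and "0 < b" and "b > enn2real (noise_bound AP g h p d \<sigma> Pr a X U) / (\<alpha> * \<epsilon> ^ 4)"
  shows "local_bounded_m_solution AM AN AP g h p G d V \<sigma> Pr F W a \<epsilon> \<alpha> X U \<and>
    outer_measure_of Pr {\<omega>\<in>space Pr. \<exists>t\<in>{0<..a}. h (X t \<omega>) \<in> cut_locus AP g p} < ennreal \<alpha>"
proof -
  have AM: "manifold AM" using assms(1) by unfold_locales
  interpret P0: riemannian AP g using assms(3,4) by unfold_locales
  interpret prob_space Pr using assms(9) by (simp add: stochastic_basis_def)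
  \<comment> \<open>The supremum that defines the injectivity radius lies above
    \<open>ennreal \<epsilon>\<close>, so the set of admissible radii is not empty.\<close>
  obtain r0 where "0 < r0" "exp_diffeo_on_ball AP g p r0"
    using assms(15) unfolding injectivity_radius_def by (auto simp: less_SUP_iff)
  then obtain c r where ball: "normal_ball AP g p c r" by (rule P0.ex_normal_ball)
  interpret P: normal_ball AP g p c r by fact
  have ad: "adapted_continuous Pr F a (\<lambda>t \<omega>. (X t \<omega>, U t \<omega>))"
    using assms(16) by (simp add: semimartingale_in_def)
  have Xc: "continuous_on {0..a} (\<lambda>t. X t \<omega>)" if "\<omega> \<in> space Pr" for \<omega>
  proof -
    have "continuous_on {0..a} (\<lambda>t. (X t \<omega>, U t \<omega>))" using ad that by (simp add: adapted_continuous_def)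
    from continuous_on_fst[OF this] show ?thesis by simp
  qed
  have fibre: "AE \<omega> in Pr. \<forall>t\<in>{0..a}. h (X t \<omega>) = p"
    by (rule AE_in_fibre[OF AM ball assms(5-10,11) less_imp_le[OF assms(21)] Xc assms(17-20)])
  have meas: "(\<lambda>\<omega>. h (X t \<omega>)) \<in> Pr \<rightarrow>\<^sub>M borel" if t: "t \<in> {0..a}" for t
  proof -
    have sub: "subalgebra Pr (F t)" using assms(9) by (simp add: stochastic_basis_def)
    have "(\<lambda>\<omega>. (X t \<omega>, U t \<omega>)) \<in> F t \<rightarrow>\<^sub>M borel" using ad t by (simp add: adapted_continuous_def)
    then have m: "(\<lambda>\<omega>. (X t \<omega>, U t \<omega>)) \<in> Pr \<rightarrow>\<^sub>M borel" by (rule measurable_from_subalg[OF sub])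
    have "continuous_on UNIV h"
      using smooth_map_at_isCont[OF AM P0.manifold_axioms] assms(5)
      by (auto simp: smooth_map_def intro: continuous_at_imp_continuous_on)
    \<comment> \<open>Adaptedness is given for the pair as a variable in the product space, so
      \<open>h\<close> is composed with the first projection.\<close>
    then have "continuous_on UNIV (\<lambda>z :: 'm \<times> 'n. h (fst z))"
      by (rule continuous_on_compose2) (auto intro: continuous_intros)
    then have "(\<lambda>z :: 'm \<times> 'n. h (fst z)) \<in> borel \<rightarrow>\<^sub>M borel" by (rule borel_measurable_continuous_onI)
    from measurable_compose[OF m this] show ?thesis by simp
  qed
  have "is_riemannian_mean AP g Pr (\<lambda>\<omega>. h (X t \<omega>)) p" if t: "t \<in> {0..a}" for t
  proof -
    \<comment> \<open>As \<open>h (X t \<omega>)\<close> is almost surely \<open>p\<close>, its mean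
      squared distance from \<open>q\<close> is that of the single point \<open>p\<close>; it is
      \<open>0\<close> at \<open>q = p\<close> and positive elsewhere.\<close>
    have eq: "(\<integral>\<^sup>+ \<omega>. (riem_dist AP g q (h (X t \<omega>)))\<^sup>2 \<partial>Pr) = (riem_dist AP g q p)\<^sup>2" for q
    proof -
      have "(\<integral>\<^sup>+ \<omega>. (riem_dist AP g q (h (X t \<omega>)))\<^sup>2 \<partial>Pr) = (\<integral>\<^sup>+ \<omega>. (riem_dist AP g q p)\<^sup>2 \<partial>Pr)"
        by (rule nn_integral_cong_AE) (use fibre in eventually_elim, use t in simp)
      then show ?thesis by (simp add: emeasure_space_1)
    qed
    show ?thesis
      unfolding is_riemannian_mean_def eq
      using meas[OF t] P.riem_dist_self P.riem_dist_pos by (simp add: zero_less_iff_neq_zero)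
  qed
  then have m_sol: "m_solution AM AN AP g h p G d V \<sigma> Pr F W a X U"
    using assms(16,18) by (simp add: m_solution_def)
  have "outer_measure_of Pr
        {\<omega>\<in>space Pr. (SUP s\<in>{0..t}. riem_dist AP g p (h (X s \<omega>))) > ennreal \<epsilon>} = 0" if t: "t \<in> {0<..a}" for t
  proof (rule outer_measure_of_AE)
    show "AE \<omega> in Pr. \<omega> \<notin> {\<omega>\<in>space Pr. (SUP s\<in>{0..t}. riem_dist AP g p (h (X s \<omega>))) > ennreal \<epsilon>}"
      using fibre
    proof eventually_elim
      case (elim \<omega>)
      have "(SUP s\<in>{0..t}. riem_dist AP g p (h (X s \<omega>))) \<le> 0"
        using elim t P.riem_dist_self by (intro SUP_least) auto
      then show ?case by simp
    qed
  qed auto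
  then have bounded: "local_bounded_m_solution AM AN AP g h p G d V \<sigma> Pr F W a \<epsilon> \<alpha> X U"
    using m_sol by (simp add: local_bounded_m_solution_def)
  have p_cut: "p \<notin> cut_locus AP g p"
  proof
    assume "p \<in> cut_locus AP g p"
    then obtain \<gamma> \<tau> J where "p = \<gamma> \<tau>" "\<tau> \<in> J" "0 < \<tau>"
      "\<forall>s\<in>J. 0 \<le> s \<longrightarrow> (riem_dist AP g p (\<gamma> s) = ennreal s \<longleftrightarrow> s \<le> \<tau>)"
      unfolding cut_locus_def by blast
    \<comment> \<open>The case \<open>s = \<tau>\<close> of the minimality condition, which would
      put \<open>p\<close> at the positive distance \<open>\<tau>\<close> from itself.\<close>
    then have "riem_dist AP g p p = ennreal \<tau>" by auto
    then show False using P.riem_dist_self \<open>0 < \<tau>\<close> by simp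
  qed
  have "outer_measure_of Pr {\<omega>\<in>space Pr. \<exists>t\<in>{0<..a}. h (X t \<omega>) \<in> cut_locus AP g p} = 0"
  proof (rule outer_measure_of_AE)
    show "AE \<omega> in Pr. \<omega> \<notin> {\<omega>\<in>space Pr. \<exists>t\<in>{0<..a}. h (X t \<omega>) \<in> cut_locus AP g p}"
      using fibre by eventually_elim (use p_cut in auto)
  qed auto
  then show ?thesis using bounded assms(12) by simp
qed

end
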